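(* Assume that $\mathcal{D}(A^{3/2})=\mathcal{D}(M^{3/2})$ with equivalent norms $|M^{3/2}v|_0$ and $\|A^{3/2}v\|_0$. If $\sigma\ge1$ and $v\in\mathcal{D}(M^\sigma)$, then $$\|v-P_{n,1}v\|_{1/2}^2=o\big(\mu_{n+1}^{1-2\sigma}\big)\quad\text{as }n\to\infty.$$ Moreover, if $\sigma\ge1$ and the first $\ell$ eigenvectors $u_1,\dots,u_\ell$ of $A$ are in $\mathcal{D}(M^\sigma)$, then for all large $n$ there exist eigenvectors $u_{j,n}$ of $A$ in the $\lambda_j$-eigenspace, normalized in $\mathcal{H}_{1/2}$, such that, as $n\to\infty$, in addition to $$\Lambda_j^{(n,1)}=\lambda_j+o\big(\mu_{n+1}^{2-2\sigma}\big)\quad\text{and}\quad\|u_{j,n}-u_j^{(n,1)}\|_{1}=o\big(\mu_{n+1}^{1-\sigma}\big),\qquad 1\le j\le\ell,$$ one has $$\|u_{j,n}-u_j^{(n,1)}\|_{1/2}^2=o\big(\mu_{n+1}^{1-2\sigma}\big),\qquad 1\le j\le\ell.$$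
   Context: $\mathcal{H}=\mathcal{H}_0$ is a separable complex Hilbert space with inner product $\langle\cdot,\cdot\rangle$ and norm $\|\cdot\|=\|\cdot\|_0$. $A$ is a selfadjoint operator in $\mathcal{H}$ that is positive definite ($\langle Au,u\rangle\ge\alpha\|u\|^2$ for $u\in\mathcal{D}(A)$, some $\alpha>0$), and the lower part of its spectrum consists of isolated eigenvalues of finite multiplicity $0<\lambda_1\le\lambda_2\le\dots$ (counted with multiplicity) lying below $\lambda_\infty$, the least point of the essential spectrum ($\lambda_\infty=\infty$ if $A^{-1}$ is compact), with corresponding orthonormal eigenvectors $u_1,u_2,\dots$. The eigenpairs with indices $1,\dots,\ell$ are among these. For $\tau\ge0$, $\mathcal{H}_\tau=\mathcal{D}(A^\tau)$ with inner product $\langle u,v\rangle_\tau=\langle A^\tau u,A^\tau v\rangle$ and norm $\|u\|_\tau=\|A^\tau u\|$. $\mathcal{G}_0$ is a Hilbert space consisting of the same elements as $\mathcal{H}_0$ with an equivalent norm; its inner product and norm are $(\cdot,\cdot)_0$ and $|\cdot|_0$. $M$ is a positive definite selfadjoint operator in $\mathcal{G}_0$ with $M^{-1}$ compact, with eigenvalues $0<\mu_1\le\mu_2\le\dots\to\infty$ (counted with multiplicity) and corresponding eigenvectors $q_1,q_2,\dots$ orthonormal in $\mathcal{G}_0$. For $s\ge0$, $\mathcal{D}(M^s)$ carries the norm $|M^sv|_0$. $P_{n,1}$ is the orthogonal projection in $\mathcal{H}_1$ onto $\mathrm{span}\{q_1,\dots,q_n\}$. Harmonic Ritz method (Rayleigh–Ritz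 in $\mathcal{H}_1$) with trial vectors $q_k$: $\Lambda_1^{(n,1)}\le\dots\le\Lambda_n^{(n,1)}$ are the eigenvalues of $[\langle Aq_i,Aq_j\rangle]_{i,j=1}^n\mathbf{x}=\Lambda[\langle q_i,Aq_j\rangle]_{i,j=1}^n\mathbf{x}$, and $u_1^{(n,1)},\dots,u_n^{(n,1)}\in\mathrm{span}\{q_1,\dots,q_n\}$ are the corresponding eigenvectors normalized so that $\langle u_i^{(n,1)},u_j^{(n,1)}\rangle_{1/2}=\delta_{ij}$ and $\langle u_i^{(n,1)},u_j^{(n,1)}\rangle_1=\Lambda_i^{(n,1)}\delta_{ij}$. *)

theory Defs
  imports "HOL-Analysis.Analysis" "HOL-Library.Landau_Symbols"
begin

(* Complex Hilbert spaces: a complete real inner product space with a compatible complex structure,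
   whose real inner product is the real part of the complex one. Norm and topology are those of
   the real structure. The complex inner product is antilinear in the first and linear in the
   second argument. *)

class complex_hilbert = real_inner + complete_space +
  fixes scaleC :: "complex \<Rightarrow> 'a \<Rightarrow> 'a" (infixr \<open>*\<^sub>C\<close> 75)
    and cinner :: "'a \<Rightarrow> 'a \<Rightarrow> complex"
  assumes scaleC_add_right: "a *\<^sub>C (x + y) = a *\<^sub>C x + a *\<^sub>C y"
    and scaleC_add_left: "(a + b) *\<^sub>C x = a *\<^sub>C x + b *\<^sub>C x"
    and scaleC_scaleC: "a *\<^sub>C (b *\<^sub>C x) = (a * b) *\<^sub>C x"
    and scaleC_of_real: "complex_of_real r *\<^sub>C x = r *\<^sub>R x"
    and cinner_commute: "cinner x y = cnj (cinner y x)"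
    and cinner_add_right: "cinner x (y + z) = cinner x y + cinner x z"
    and cinner_scaleC_right: "cinner x (a *\<^sub>C y) = a * cinner x y"
    and Re_cinner: "Re (cinner x y) = inner x y"

global_interpretation complex_vector: vector_space "scaleC :: complex \<Rightarrow> 'a \<Rightarrow> 'a::complex_hilbert"
  defines cspan = complex_vector.span
proof
  fix x :: 'a
  show "1 *\<^sub>C x = x"
    using scaleC_of_real[of 1 x] by simp
qed (simp_all add: scaleC_add_right scaleC_add_left scaleC_scaleC)

definition inner_product :: "('a::complex_hilbert \<Rightarrow> 'a \<Rightarrow> complex) \<Rightarrow> bool" where
  "inner_product g \<longleftrightarrow>
     (\<forall>x y z. g x (y + z) = g x y + g x z) \<and>
     (\<forall>a x y. g x (a *\<^sub>C y) = a * g x y) \<and>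
     (\<forall>x y. g x y = cnj (g y x)) \<and>
     (\<forall>x. x \<noteq> 0 \<longrightarrow> Re (g x x) > 0)"

definition ip_norm :: "('a \<Rightarrow> 'a \<Rightarrow> complex) \<Rightarrow> 'a \<Rightarrow> real" where
  "ip_norm g x = sqrt (Re (g x x))"

definition equivalent_norms_on :: "'a set \<Rightarrow> ('a \<Rightarrow> real) \<Rightarrow> ('a \<Rightarrow> real) \<Rightarrow> bool" where
  "equivalent_norms_on D p p' \<longleftrightarrow> (\<exists>c>0. \<exists>C>0. \<forall>x\<in>D. c * p x \<le> p' x \<and> p' x \<le> C * p x)"

(* Hilbert space on the same elements with an equivalent norm; completeness is inherited. *)
definition equivalent_inner_product :: "('a::complex_hilbert \<Rightarrow> 'a \<Rightarrow> complex) \<Rightarrow> bool" where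
  "equivalent_inner_product g \<longleftrightarrow> inner_product g \<and> equivalent_norms_on UNIV norm (ip_norm g)"

definition orthonormal_on :: "('a \<Rightarrow> 'a \<Rightarrow> complex) \<Rightarrow> nat set \<Rightarrow> (nat \<Rightarrow> 'a) \<Rightarrow> bool" where
  "orthonormal_on g I e \<longleftrightarrow> (\<forall>i\<in>I. \<forall>j\<in>I. g (e i) (e j) = (if i = j then 1 else 0))"

definition orth_proj :: "('a \<Rightarrow> 'a \<Rightarrow> complex) \<Rightarrow> 'a set \<Rightarrow> 'a \<Rightarrow> 'a::ab_group_add" where
  "orth_proj g V v = (THE p. p \<in> V \<and> (\<forall>x\<in>V. g x (v - p) = 0))"

(* Unbounded operators are represented by their graphs, so composition is relational composition,
   the inverse is the converse and the domain is Domain. *)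

type_synonym 'a operator = "('a \<times> 'a) set"

definition op_app :: "'a operator \<Rightarrow> 'a \<Rightarrow> 'a" where
  "op_app T x = (THE y. (x, y) \<in> T)"

definition op_adjoint :: "('a \<Rightarrow> 'a \<Rightarrow> complex) \<Rightarrow> 'a operator \<Rightarrow> 'a operator" where
  "op_adjoint g T = {(v, w). \<forall>(x, y)\<in>T. g v y = g w x}"

(* Linearity of T is implied, since an adjoint is always a linear relation. Density is understood
   in the norm topology, which is the same for all equivalent inner products. *)
definition selfadjoint :: "('a::topological_space \<Rightarrow> 'a \<Rightarrow> complex) \<Rightarrow> 'a operator \<Rightarrow> bool" where
  "selfadjoint g T \<longleftrightarrow> single_valued T \<and> closure (Domain T) = UNIV \<and> op_adjoint g T = T"

(* For selfadjoint T the numbers g x (T x) are real, so taking real parts loses nothing. *)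
definition nonnegative_op :: "('a \<Rightarrow> 'a \<Rightarrow> complex) \<Rightarrow> 'a operator \<Rightarrow> bool" where
  "nonnegative_op g T \<longleftrightarrow> (\<forall>(x, y)\<in>T. 0 \<le> Re (g x y))"

definition positive_definite :: "('a \<Rightarrow> 'a \<Rightarrow> complex) \<Rightarrow> 'a operator \<Rightarrow> bool" where
  "positive_definite g T \<longleftrightarrow> (\<exists>\<alpha>>0. \<forall>(x, y)\<in>T. \<alpha> * (ip_norm g x)\<^sup>2 \<le> Re (g x y))"

definition compact_op :: "'a::metric_space operator \<Rightarrow> bool" where
  "compact_op T \<longleftrightarrow> single_valued T \<and> Domain T = UNIV \<and>
     (\<forall>B. bounded B \<longrightarrow> compact (closure (T `` B)))"

definition eigenspace :: "'a::complex_hilbert operator \<Rightarrow> complex \<Rightarrow> 'a set" where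
  "eigenspace T z = {x. (x, z *\<^sub>C x) \<in> T}"

definition op_shift :: "'a::complex_hilbert operator \<Rightarrow> complex \<Rightarrow> 'a operator" where
  "op_shift T z = {(x, y - z *\<^sub>C x) | x y. (x, y) \<in> T}"

(* Complement of the set of z for which T - z is a bijection onto the space with bounded inverse. *)
definition op_spectrum :: "'a::complex_hilbert operator \<Rightarrow> complex set" where
  "op_spectrum T = - {z. single_valued ((op_shift T z)\<inverse>) \<and> Range (op_shift T z) = UNIV \<and>
     (\<exists>C. \<forall>(x, y)\<in>op_shift T z. norm x \<le> C * norm y)}"

(* The spectrum without the isolated eigenvalues of finite multiplicity. *)
definition ess_spectrum :: "'a::complex_hilbert operator \<Rightarrow> complex set" where
  "ess_spectrum T = op_spectrum T -
     {z. z isolated_in op_spectrum T \<and> eigenspace T z \<noteq> {0} \<and>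
         (\<exists>B. finite B \<and> eigenspace T z \<subseteq> cspan B)}"

(* Least point of the essential spectrum of a selfadjoint operator (whose spectrum is real);
   it is \<infinity> if the essential spectrum is empty. *)
definition lambda_inf :: "'a::complex_hilbert operator \<Rightarrow> ereal" where
  "lambda_inf T = Inf {ereal t | t. complex_of_real t \<in> ess_spectrum T}"

definition op_sqrt :: "'a::complex_hilbert operator \<Rightarrow> 'a operator" where
  "op_sqrt T = (THE S. selfadjoint cinner S \<and> nonnegative_op cinner S \<and> S O S = T)"

(* T^(k/2) for nonnegative selfadjoint T. *)
definition half_power :: "'a::complex_hilbert operator \<Rightarrow> nat \<Rightarrow> 'a operator" where
  "half_power T k = op_sqrt T ^^ k"

(* The space H_tau for tau = k/2 has Domain (half_power T k) as its elements. *)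
definition H_inner :: "'a::complex_hilbert operator \<Rightarrow> nat \<Rightarrow> 'a \<Rightarrow> 'a \<Rightarrow> complex" where
  "H_inner T k x y = cinner (op_app (half_power T k) x) (op_app (half_power T k) y)"

definition H_norm :: "'a::complex_hilbert operator \<Rightarrow> nat \<Rightarrow> 'a \<Rightarrow> real" where
  "H_norm T k x = norm (op_app (half_power T k) x)"

(* The eigenvalues of T below its essential spectrum, in increasing order and counted with
   multiplicity, together with orthonormal eigenvectors. Their number N may be infinite;
   indices start at 1. The last conjunct says that no eigenvector is missed. *)
definition lower_eigenpairs ::
  "'a::complex_hilbert operator \<Rightarrow> enat \<Rightarrow> (nat \<Rightarrow> real) \<Rightarrow> (nat \<Rightarrow> 'a) \<Rightarrow> bool" where
  "lower_eigenpairs T N lam u \<longleftrightarrow> (let I = {k. 1 \<le> k \<and> enat k \<le> N} in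
     mono_on I lam \<and>
     (\<forall>k\<in>I. 0 < lam k \<and> ereal (lam k) < lambda_inf T \<and> (u k, complex_of_real (lam k) *\<^sub>C u k) \<in> T) \<and>
     orthonormal_on cinner I u \<and>
     (\<forall>t. ereal t < lambda_inf T \<longrightarrow>
        eigenspace T (complex_of_real t) \<subseteq> cspan {u k | k. k \<in> I \<and> lam k = t}))"

(* As above, for an operator all of whose spectrum is discrete. *)
definition discrete_eigenpairs ::
  "('a::complex_hilbert \<Rightarrow> 'a \<Rightarrow> complex) \<Rightarrow> 'a operator \<Rightarrow> (nat \<Rightarrow> real) \<Rightarrow> (nat \<Rightarrow> 'a) \<Rightarrow> bool" where
  "discrete_eigenpairs g T mu q \<longleftrightarrow>
     mono_on {1..} mu \<and> 0 < mu 1 \<and> filterlim mu at_top sequentially \<and>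
     (\<forall>k\<ge>1. (q k, complex_of_real (mu k) *\<^sub>C q k) \<in> T) \<and>
     orthonormal_on g {1..} q \<and>
     (\<forall>t. eigenspace T (complex_of_real t) \<subseteq> cspan {q k | k. 1 \<le> k \<and> mu k = t})"

(* The power T^s of the operator with these eigenpairs, by functional calculus: its domain
   consists of the x for which the series converges. *)
definition eigen_power ::
  "('a::complex_hilbert \<Rightarrow> 'a \<Rightarrow> complex) \<Rightarrow> (nat \<Rightarrow> real) \<Rightarrow> (nat \<Rightarrow> 'a) \<Rightarrow> real \<Rightarrow> 'a operator" where
  "eigen_power g mu q s =
     {(x, y). ((\<lambda>k. (complex_of_real (mu k powr s) * g (q k) x) *\<^sub>C q k) has_sum y) {1..}}"

(* Harmonic Ritz values Lam 1, ..., Lam n and vectors U 1, ..., U n for the trial vectors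
   q 1, ..., q n. By the normalization the U i form a basis of the trial space, so the Lam i are
   all eigenvalues of the matrix problem, counted with multiplicity. *)
definition harmonic_ritz_pairs ::
  "'a::complex_hilbert operator \<Rightarrow> (nat \<Rightarrow> 'a) \<Rightarrow> nat \<Rightarrow> (nat \<Rightarrow> real) \<Rightarrow> (nat \<Rightarrow> 'a) \<Rightarrow> bool" where
  "harmonic_ritz_pairs T q n Lam U \<longleftrightarrow>
     mono_on {1..n} Lam \<and>
     (\<forall>i\<in>{1..n}. \<exists>x :: nat \<Rightarrow> complex.
        U i = (\<Sum>j=1..n. x j *\<^sub>C q j) \<and>
        (\<forall>k\<in>{1..n}. (\<Sum>j=1..n. cinner (op_app T (q k)) (op_app T (q j)) * x j) =
           complex_of_real (Lam i) * (\<Sum>j=1..n. cinner (q k) (op_app T (q j)) * x j))) \<and>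
     (\<forall>i\<in>{1..n}. \<forall>j\<in>{1..n}.
        H_inner T 1 (U i) (U j) = (if i = j then 1 else 0) \<and>
        H_inner T 2 (U i) (U j) = (if i = j then complex_of_real (Lam i) else 0))"

end

theory Submission
  imports Defs
begin

text \<open>Put \<open>T = A^(-1)\<close>, \<open>R = T^(1/2)\<close> and \<open>v = T f\<close>. Then \<open>v\<close> has \<open>H_norm A 2\<close> equal to \<open>|f|\<close> and \<open>H_norm A 1\<close>
  equal to \<open>|R f|\<close>, and the harmonic Ritz method is the Rayleigh--Ritz method for the bounded
  operator \<open>T\<close> with trial vectors \<open>A q\<^sub>k\<close>.

  The equivalence of the norms of \<open>A^(3/2)\<close> and \<open>M^(3/2)\<close> interpolates to \<open>|A v| \<le> C |M v|\<close>, by a dyadic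
  decomposition along the \<open>\<mu>\<^sub>k\<close> whose blocks are almost orthogonal. Hence truncated expansions in the
  \<open>q\<^sub>k\<close> give the rate of the stronger norm, and a vector \<open>R h\<close> is approximated by the trial space up
  to \<open>C \<mu>^(-1/2) |h|\<close>, where \<open>\<mu> = \<mu>\<^sub>n\<^sub>+\<^sub>1\<close>. The last bound gains the factor \<open>\<mu>^(-1/2)\<close> in the weaker norm by
  duality: an error \<open>e\<close> orthogonal to the trial space has
  \<open>|R e|^2 = (e, R (R e)) \<le> C \<mu>^(-1/2) |e| |R e|\<close>.

  For a Ritz vector let \<open>e\<close> be its component orthogonal to the exact eigenspace. The spectral gap around
  an isolated eigenvalue bounds \<open>|e|\<close>, and duality with \<open>T - 1 / \<lambda>\<^sub>j\<close> bounds \<open>|R e|\<close>. This also covers an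
  eigenspace of which only a part is spanned by \<open>u\<^sub>1, \<dots>, u\<^sub>l\<close>.\<close>

section \<open>Symmetric operators on real Hilbert spaces\<close>

text \<open>The spectrum is given by resolvent bounds and the square root of A by a definite
  description, so both are made usable by hand: the root comes from an iteration with a scalar
  majorant, spectral gaps come from extremal arguments on quadratic forms. This is done over the
  real inner product, because only real polynomials in one operator occur; complex statements are
  recovered by also testing with multiples of \<i>.

  The exponent 3/2 in the hypothesis is what R h needs: R h = A v with v = A^(-3/2) h in D(M^(3/2)),
  and the truncation error of this v in the stronger norm has order mu^(1 - 3/2). The little o is
  the tail of the expansion of M^\<sigma> v.

  The exact eigenvector is obtained by projecting the Ritz vector onto the eigenspace and not the
  other way round: the eigenspace may contain vectors for which no rate of approximation is assumed,
  while the min-max arguments use approximations of u_1, ..., u_j only. All constants must depend on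
  j alone, since n grows.\<close>

lemma power2_norm_diff:
  "(norm (x - y))\<^sup>2 = (norm x)\<^sup>2 - 2 * inner x y + (norm (y::'a::real_inner))\<^sup>2"
  by (simp add: power2_norm_eq_inner inner_diff_left inner_diff_right inner_commute)

lemma power2_norm_add:
  "(norm (x + y))\<^sup>2 = (norm x)\<^sup>2 + 2 * inner x y + (norm (y::'a::real_inner))\<^sup>2"
  by (simp add: power2_norm_eq_inner inner_add_left inner_add_right inner_commute)

lemma subspace_closure:
  fixes W :: "'a::real_normed_vector set"
  assumes "subspace W"
  shows "subspace (closure W)"
proof (rule subspaceI)
  show "0 \<in> closure W" using subspace_0[OF assms] closure_subset by blast
  show "x + y \<in> closure W" if xy: "x \<in> closure W" "y \<in> closure W" for x y
  proof -
    obtain f g where "\<forall>n. f n \<in> W" "f \<longlonglongrightarrow> x" "\<forall>n. g n \<in> W" "g \<longlonglongrightarrow> y"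
      using xy unfolding closure_sequential by blast
    then have "\<forall>n. f n + g n \<in> W" "(\<lambda>n. f n + g n) \<longlonglongrightarrow> x + y"
      by (auto intro: subspace_add[OF assms] tendsto_add)
    then show ?thesis unfolding closure_sequential by (intro exI conjI)
  qed
  show "c *\<^sub>R x \<in> closure W" if x: "x \<in> closure W" for c x
  proof -
    obtain f where "\<forall>n. f n \<in> W" "f \<longlonglongrightarrow> x" using x unfolding closure_sequential by blast
    then have "\<forall>n. c *\<^sub>R f n \<in> W" "(\<lambda>n. c *\<^sub>R f n) \<longlonglongrightarrow> c *\<^sub>R x"
      by (auto intro: subspace_scale[OF assms] tendsto_scaleR)
    then show ?thesis unfolding closure_sequential by (intro exI conjI)
  qed
qed

lemma Cauchy_if_tail_bound:
  fixes f :: "nat \<Rightarrow> 'a::real_normed_vector"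
  assumes f: "\<And>m n. n \<le> m \<Longrightarrow> norm (f m - f n) \<le> h n" and h: "h \<longlonglongrightarrow> 0"
  shows "Cauchy f"
proof (rule CauchyI)
  fix e :: real assume "e > 0"
  then obtain M where M: "\<And>n. n \<ge> M \<Longrightarrow> h n < e"
    using order_tendstoD(2)[OF h] by (auto simp: eventually_sequentially)
  show "\<exists>M. \<forall>m\<ge>M. \<forall>n\<ge>M. norm (f m - f n) < e"
  proof (intro exI[of _ M] allI impI)
    fix m n assume mn: "M \<le> m" "M \<le> n"
    then have "norm (f (max m n) - f (min m n)) < e"
      using f[of "min m n" "max m n"] M[of "min m n"] by linarith
    then show "norm (f m - f n) < e"
      by (cases "m \<le> n") (simp_all add: norm_minus_commute max_def min_def split: if_splits)
  qed
qed

text \<open>A minimizing sequence for the distance is Cauchy by the parallelogram law, since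
  midpoints stay in W and are no closer than the infimum; first-order variation at the minimizer
  gives orthogonality.\<close>

lemma closed_subspace_projection:
  fixes W :: "'a::{real_inner,complete_space} set"
  assumes W: "subspace W" "closed W"
  obtains p where "p \<in> W" "\<And>w. w \<in> W \<Longrightarrow> inner (x - p) w = 0"
proof -
  define d where "d = (INF w\<in>W. (norm (x - w))\<^sup>2)"
  have W0: "0 \<in> W" using W(1) by (rule subspace_0)
  have bdd: "bdd_below ((\<lambda>w. (norm (x - w))\<^sup>2) ` W)"
    by (rule bdd_belowI[of _ 0]) auto
  have d_le: "d \<le> (norm (x - w))\<^sup>2" if "w \<in> W" for w
    unfolding d_def using bdd that by (rule cINF_lower)
  have "\<exists>w\<in>W. (norm (x - w))\<^sup>2 < d + 1 / real (Suc n)" for n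
  proof -
    have "d < d + 1 / real (Suc n)" by simp
    then show ?thesis unfolding d_def using bdd W0
      by (subst (asm) cINF_less_iff) auto
  qed
  then obtain w where w: "\<And>n. w n \<in> W" "\<And>n. (norm (x - w n))\<^sup>2 < d + 1 / real (Suc n)"
    by metis
  have dist: "(norm (w m - w n))\<^sup>2 \<le> 2 / real (Suc m) + 2 / real (Suc n)" for m n
  proof -
    have mid: "(1/2) *\<^sub>R (w m + w n) \<in> W"
      using W(1) w(1) by (simp add: subspace_add subspace_scale)
    have "(norm (w m - w n))\<^sup>2 + 4 * (norm (x - (1/2) *\<^sub>R (w m + w n)))\<^sup>2
        = 2 * (norm (x - w m))\<^sup>2 + 2 * (norm (x - w n))\<^sup>2"
      unfolding power2_norm_eq_inner
      by (simp add: inner_commute algebra_simps inner_diff_left inner_diff_right)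
    with d_le[OF mid] w(2)[of m] w(2)[of n] show ?thesis by simp
  qed
  have "Cauchy w"
  proof (rule Cauchy_if_tail_bound)
    show "norm (w m - w n) \<le> sqrt (4 / real (Suc n))" if "n \<le> m" for m n
    proof (rule real_le_rsqrt)
      have "2 / real (Suc m) \<le> 2 / real (Suc n)" using that by (simp add: frac_le)
      with dist[of m n] show "(norm (w m - w n))\<^sup>2 \<le> 4 / real (Suc n)" by simp
    qed
    have "(\<lambda>n. sqrt (4 * (1 / real (Suc n)))) \<longlonglongrightarrow> sqrt (4 * 0)"
      by (intro tendsto_intros LIMSEQ_Suc lim_1_over_n)
    then show "(\<lambda>n. sqrt (4 / real (Suc n))) \<longlonglongrightarrow> 0" by simp
  qed
  then obtain p where p: "w \<longlonglongrightarrow> p" using Cauchy_convergent convergent_def by blast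
  have pW: "p \<in> W" using W(2) w(1) p by (auto simp: closed_sequential_limits)
  have "(\<lambda>n. (norm (x - w n))\<^sup>2) \<longlonglongrightarrow> (norm (x - p))\<^sup>2"
    by (intro tendsto_intros p)
  moreover have "(\<lambda>n. d + 1 / real (Suc n)) \<longlonglongrightarrow> d + 0"
    by (intro tendsto_intros LIMSEQ_Suc lim_1_over_n)
  ultimately have p_le: "(norm (x - p))\<^sup>2 \<le> d"
    using w(2) by (intro LIMSEQ_le[of _ _ "\<lambda>n. d + 1 / real (Suc n)"]) (auto intro: less_imp_le)
  have "inner (x - p) v = 0" if v: "v \<in> W" for v
  proof (cases "v = 0")
    case False
    \<comment> \<open>This step length minimizes the distance along v.\<close>
    define s where "s = inner (x - p) v / inner v v"
    have "p + s *\<^sub>R v \<in> W" using W(1) pW v by (simp add: subspace_add subspace_scale)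
    then have "(norm (x - p))\<^sup>2 \<le> (norm (x - (p + s *\<^sub>R v)))\<^sup>2" using d_le[of "p + s *\<^sub>R v"] p_le by linarith
    also have "\<dots> = (norm (x - p))\<^sup>2 - 2 * s * inner (x - p) v + s\<^sup>2 * inner v v"
      unfolding power2_norm_eq_inner
      by (simp add: inner_commute algebra_simps inner_diff_left inner_diff_right power2_eq_square)
    also have "\<dots> = (norm (x - p))\<^sup>2 - (inner (x - p) v)\<^sup>2 / inner v v"
      using False by (simp add: s_def field_simps power2_eq_square)
    finally have "(inner (x - p) v)\<^sup>2 / inner v v \<le> 0" by simp
    then have "(inner (x - p) v)\<^sup>2 \<le> 0" using False inner_gt_zero_iff[of v]
      by (metis divide_le_0_iff linorder_not_le)
    then show ?thesis by simp
  qed simp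
  with pW that show ?thesis by blast
qed

section \<open>Bounded symmetric operators and spectral gaps\<close>

locale symmetric_op =
  fixes T :: "'a::{real_inner,complete_space} \<Rightarrow> 'a"
  assumes bounded_linear: "bounded_linear T"
    and symmetric: "inner (T x) y = inner x (T y)"
begin

lemmas add = linear_add[OF bounded_linear.linear[OF bounded_linear]]
lemmas diff = linear_diff[OF bounded_linear.linear[OF bounded_linear]]
lemmas scale = linear_scale[OF bounded_linear.linear[OF bounded_linear]]
lemmas zero = linear_0[OF bounded_linear.linear[OF bounded_linear]]
lemmas sum = linear_sum[OF bounded_linear.linear[OF bounded_linear]]
lemmas lin = add diff scale zero

lemma shift: "symmetric_op (\<lambda>x. T x - c *\<^sub>R x)"
proof (rule symmetric_op.intro)
  show "bounded_linear (\<lambda>x. T x - c *\<^sub>R x)"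
    by (intro bounded_linear_sub bounded_linear bounded_linear_scaleR_right)
  show "inner (T x - c *\<^sub>R x) y = inner x (T y - c *\<^sub>R y)" for x y
    using symmetric by (simp add: inner_diff_left inner_diff_right)
qed

text \<open>Test the nonnegative form at x - (1/b) T x, the descent step whose length matches the
  bound b. The restriction to an invariant subspace W matters later, where the form is nonnegative
  only on the complement of the lower eigenvectors.\<close>

lemma nonneg_norm_le:
  assumes W: "subspace W" "\<And>x. x \<in> W \<Longrightarrow> T x \<in> W"
    and nonneg: "\<And>x. x \<in> W \<Longrightarrow> 0 \<le> inner (T x) x"
    and b: "\<And>x. norm (T x) \<le> b * norm x" "b > 0" and x: "x \<in> W"
  shows "(norm (T x))\<^sup>2 \<le> b * inner (T x) x"
proof -
  let ?y = "T x"
  have "x - (1/b) *\<^sub>R ?y \<in> W" using W x by (simp add: subspace_diff subspace_scale)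
  then have "0 \<le> inner (T (x - (1/b) *\<^sub>R ?y)) (x - (1/b) *\<^sub>R ?y)" by (rule nonneg)
  also have "\<dots> = inner ?y x - 2 / b * (norm ?y)\<^sup>2 + (1/b)\<^sup>2 * inner (T ?y) ?y"
    using b(2) by (simp add: lin inner_diff_left inner_diff_right symmetric[of ?y x] dot_square_norm
        field_simps power2_eq_square)
  also have "inner (T ?y) ?y \<le> b * (norm ?y)\<^sup>2"
  proof -
    have "inner (T ?y) ?y \<le> norm (T ?y) * norm ?y" by (rule norm_cauchy_schwarz)
    also have "\<dots> \<le> (b * norm ?y) * norm ?y" by (intro mult_right_mono b) simp
    finally show ?thesis by (simp add: power2_eq_square)
  qed
  finally have "0 \<le> inner ?y x - 2 / b * (norm ?y)\<^sup>2 + (1/b)\<^sup>2 * (b * (norm ?y)\<^sup>2)"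
    by (simp add: mult_left_mono)
  then show ?thesis using b(2) by (simp add: field_simps power2_eq_square)
qed

lemma bound_obtain:
  obtains b where "b > 0" "\<And>x. norm (T x) \<le> b * norm x"
  using bounded_linear.pos_bounded[OF bounded_linear] by (metis mult.commute)

text \<open>If the infimum \<open>m\<close> of \<open>|(T - c) x| / |x|\<close> were less than \<open>r\<close>, then \<open>(T - c)\<^sup>2 - m\<^sup>2\<close>, which is
  the product of the bounded below operators \<open>T - (c \<plusminus> m)\<close>, would be nonnegative with infimum \<open>0\<close>.\<close>

lemma spectral_gap:
  assumes regular: "\<And>s. \<bar>s - c\<bar> < r \<Longrightarrow> \<exists>k>0. \<forall>x. k * norm x \<le> norm (T x - s *\<^sub>R x)"
  shows "r * norm x \<le> norm (T x - c *\<^sub>R x)"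
proof (rule ccontr)
  assume "\<not> ?thesis"
  then have x: "norm (T x - c *\<^sub>R x) < r * norm x" by simp
  then have x0: "x \<noteq> 0" using zero by auto
  interpret C: symmetric_op "\<lambda>x. T x - c *\<^sub>R x" by (rule shift)
  define C where "C = (\<lambda>x. T x - c *\<^sub>R x)"
  define m where "m = (INF x\<in>-{0}. norm (C x) / norm x)"
  have bdd: "bdd_below ((\<lambda>x. norm (C x) / norm x) ` (-{0}))"
    by (rule bdd_belowI[of _ 0]) auto
  have m_le: "m * norm x \<le> norm (C x)" for x
  proof (cases "x = 0")
    case False
    then have "m \<le> norm (C x) / norm x" unfolding m_def using bdd by (intro cINF_lower) auto
    with False show ?thesis by (simp add: field_simps)
  qed simp
  have "m \<le> norm (C x) / norm x" unfolding m_def using bdd x0 by (intro cINF_lower) auto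
  also have "\<dots> < r" using x x0 by (simp add: C_def field_simps)
  finally have "m < r" .
  have "0 \<le> m" unfolding m_def using x0 by (intro cINF_greatest) auto
  define K where "K = (\<lambda>x. C (C x) - m\<^sup>2 *\<^sub>R x)"
  have C: "symmetric_op C" using C.symmetric_op_axioms by (simp add: C_def)
  note Clin = symmetric_op.lin[OF C] and Csym = symmetric_op.symmetric[OF C]
    and C' = symmetric_op.bounded_linear[OF C]
  have "symmetric_op (\<lambda>x. C (C x))"
    by (intro symmetric_op.intro bounded_linear_compose[OF C' C']) (simp add: Csym)
  then interpret K: symmetric_op K unfolding K_def by (rule symmetric_op.shift)
  obtain b where b: "b > 0" "\<And>x. norm (K x) \<le> b * norm x" by (rule K.bound_obtain) blast
  have K_inner: "inner (K x) x = (norm (C x))\<^sup>2 - m\<^sup>2 * (norm x)\<^sup>2" for x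
    by (simp add: K_def inner_diff_left Csym power2_norm_eq_inner)
  have "0 \<le> inner (K x) x" for x
    using power_mono[OF m_le[of x], of 2] \<open>0 \<le> m\<close> by (simp add: K_inner power_mult_distrib)
  then have K_le: "(norm (K x))\<^sup>2 \<le> b * inner (K x) x" for x
    by (intro K.nonneg_norm_le[of UNIV]) (use b in auto)
  \<comment> \<open>Because m < r, both c - m and c + m lie in the regular interval.\<close>
  obtain k k' where k: "k > 0" "\<And>x. k * norm x \<le> norm (C x + m *\<^sub>R x)"
    "k' > 0" "\<And>x. k' * norm x \<le> norm (C x - m *\<^sub>R x)"
    using regular[of "c - m"] regular[of "c + m"] \<open>0 \<le> m\<close> \<open>m < r\<close>
    by (auto simp: C_def algebra_simps)
  have K_ge: "k' * k * norm x \<le> norm (K x)" for x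
  proof -
    have "k' * k * norm x \<le> k' * norm (C x + m *\<^sub>R x)" using k(2)[of x] k(3) by simp
    also have "\<dots> \<le> norm (C (C x + m *\<^sub>R x) - m *\<^sub>R (C x + m *\<^sub>R x))" by (rule k(4))
    also have "C (C x + m *\<^sub>R x) - m *\<^sub>R (C x + m *\<^sub>R x) = K x"
      by (simp add: K_def Clin algebra_simps power2_eq_square)
    finally show ?thesis .
  qed
  \<comment> \<open>\<open>K_ge\<close> bounds K from below in norm; through \<open>K_le\<close>
    this lifts its quadratic form by \<delta>, so the infimum m could be raised to sqrt (m^2 +
    \<delta>).\<close>
  define \<delta> where "\<delta> = (k' * k)\<^sup>2 / b"
  have "\<delta> > 0" using b k by (simp add: \<delta>_def)
  have sq: "(norm (C x))\<^sup>2 \<ge> (m\<^sup>2 + \<delta>) * (norm x)\<^sup>2" for x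
  proof -
    have "(k' * k * norm x)\<^sup>2 \<le> b * inner (K x) x"
    proof -
      have "(k' * k * norm x)\<^sup>2 \<le> (norm (K x))\<^sup>2"
        by (rule power_mono[OF K_ge]) (use k in simp)
      with K_le[of x] show ?thesis by linarith
    qed
    then show ?thesis using b(1) by (simp add: \<delta>_def K_inner field_simps power_mult_distrib)
  qed
  have "sqrt (m\<^sup>2 + \<delta>) \<le> norm (C y) / norm y" if "y \<noteq> 0" for y
  proof -
    have "m\<^sup>2 + \<delta> \<le> (norm (C y) / norm y)\<^sup>2" using sq[of y] that
      by (simp add: power_divide field_simps)
    then show ?thesis by (rule real_le_lsqrt[rotated -1]) (auto simp: \<open>\<delta> > 0\<close> less_imp_le)
  qed
  then have "sqrt (m\<^sup>2 + \<delta>) \<le> m" unfolding m_def using x0 by (intro cINF_greatest) auto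
  then have "m\<^sup>2 + \<delta> \<le> m\<^sup>2" by (rule sqrt_le_D)
  with \<open>\<delta> > 0\<close> show False by simp
qed

text \<open>The point c may itself be spectral, so no gap is available around c directly. Centered
  at c + e/2 and c - e/2 with radius e/2, \<open>spectral_gap\<close> meets regular points only, and
  the two results give the form inequalities \<open>gap\<close>. These yield the bound on the range
  of D, whose closure is the orthogonal complement of the kernel, and z lies there by
  hypothesis.\<close>

lemma isolated_gap:
  assumes e: "e > 0"
    and regular: "\<And>s. \<bar>s - c\<bar> < e \<Longrightarrow> s \<noteq> c \<Longrightarrow> \<exists>k>0. \<forall>x. k * norm x \<le> norm (T x - s *\<^sub>R x)"
    and z: "\<And>y. T y = c *\<^sub>R y \<Longrightarrow> inner y z = 0"
  shows "e * norm z \<le> norm (T z - c *\<^sub>R z)"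
proof -
  define D where "D = (\<lambda>x. T x - c *\<^sub>R x)"
  interpret D: symmetric_op D unfolding D_def by (rule shift)
  have gap1: "(e/2) * norm x \<le> norm (D x - (e/2) *\<^sub>R x)"
    "(e/2) * norm x \<le> norm (D x + (e/2) *\<^sub>R x)" for x
  proof -
    have "(e/2) * norm x \<le> norm (T x - (c + e/2) *\<^sub>R x)"
      by (intro spectral_gap regular) (auto simp: abs_if split: if_splits)
    then show "(e/2) * norm x \<le> norm (D x - (e/2) *\<^sub>R x)"
      by (simp add: D_def algebra_simps)
    have "(e/2) * norm x \<le> norm (T x - (c - e/2) *\<^sub>R x)"
      by (intro spectral_gap regular) (auto simp: abs_if split: if_splits)
    then show "(e/2) * norm x \<le> norm (D x + (e/2) *\<^sub>R x)"
      by (simp add: D_def algebra_simps)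
  qed
  have gap: "e * inner (D x) x \<le> (norm (D x))\<^sup>2" "- (e * inner (D x) x) \<le> (norm (D x))\<^sup>2" for x
  proof -
    have n: "norm ((e/2) *\<^sub>R x) = (e/2) * norm x" using e by simp
    have "((e/2) * norm x)\<^sup>2 \<le> (norm (D x - (e/2) *\<^sub>R x))\<^sup>2"
      using e by (intro power_mono gap1) simp
    then show "e * inner (D x) x \<le> (norm (D x))\<^sup>2"
      unfolding power2_norm_diff n by simp
    have "((e/2) * norm x)\<^sup>2 \<le> (norm (D x + (e/2) *\<^sub>R x))\<^sup>2"
      using e by (intro power_mono gap1) simp
    then show "- (e * inner (D x) x) \<le> (norm (D x))\<^sup>2"
      unfolding power2_norm_add n by simp
  qed
  txt \<open>\<open>D (D - e) (D + e)\<^sup>2 \<ge> 0\<close> and \<open>D (D + e) (D - e)\<^sup>2 \<ge> 0\<close> add up to \<open>2 D\<^sup>2 (D\<^sup>2 - e\<^sup>2) \<ge> 0\<close>.\<close>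
  have range: "e * norm (D y) \<le> norm (D (D y))" for y
  proof -
    have s: "inner (D (D (D y))) y = inner (D (D y)) (D y)"
      "inner (D (D (D y))) (D y) = inner (D (D y)) (D (D y))"
      "inner (D (D y)) y = inner (D y) (D y)" "inner y (D (D y)) = inner (D y) (D y)"
      by (simp_all add: D.symmetric)
    have "0 \<le> (norm (D (D y + e *\<^sub>R y)))\<^sup>2 - e * inner (D (D y + e *\<^sub>R y)) (D y + e *\<^sub>R y)
          + ((norm (D (D y - e *\<^sub>R y)))\<^sup>2 + e * inner (D (D y - e *\<^sub>R y)) (D y - e *\<^sub>R y))"
      using gap(1)[of "D y + e *\<^sub>R y"] gap(2)[of "D y - e *\<^sub>R y"] by linarith
    also have "\<dots> = 2 * ((norm (D (D y)))\<^sup>2 - e\<^sup>2 * (norm (D y))\<^sup>2)"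
      unfolding power2_norm_eq_inner
      by (simp add: D.lin inner_add_left inner_add_right inner_diff_left inner_diff_right s
          inner_commute algebra_simps power2_eq_square)
    finally have "(e * norm (D y))\<^sup>2 \<le> (norm (D (D y)))\<^sup>2" by (simp add: power_mult_distrib)
    then show ?thesis by (rule power2_le_imp_le) simp
  qed
  have sub: "subspace (range D)"
    by (rule linear_subspace_image[OF bounded_linear.linear[OF D.bounded_linear] subspace_UNIV])
  obtain p where p: "p \<in> closure (range D)"
    "\<And>w. w \<in> closure (range D) \<Longrightarrow> inner (z - p) w = 0"
    using closed_subspace_projection[of "closure (range D)"] subspace_closure[OF sub] by auto
  \<comment> \<open>The part of z orthogonal to the range is killed by D, hence lies in the
    eigenspace, to which z is orthogonal; so it vanishes.\<close>
  have "inner (D (z - p)) w = 0" for w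
    using p(2)[of "D w"] closure_subset[of "range D"] by (auto simp: D.symmetric)
  then have "D (z - p) = 0" using inner_eq_zero_iff by blast
  then have "inner (z - p) z = 0" by (intro z) (simp add: D_def)
  moreover have "inner (z - p) p = 0" using p by blast
  ultimately have "inner (z - p) (z - p) = 0" by (simp add: inner_diff_right)
  then have "z = p" by simp
  with p(1) have "z \<in> closure (range D)" by simp
  then obtain y where y: "\<And>n. y n \<in> range D" "y \<longlonglongrightarrow> z"
    by (auto simp: closure_sequential)
  have "e * norm z \<le> norm (D z)"
  proof (rule LIMSEQ_le)
    show "(\<lambda>n. e * norm (y n)) \<longlonglongrightarrow> e * norm z" by (intro tendsto_intros y)
    show "(\<lambda>n. norm (D (y n))) \<longlonglongrightarrow> norm (D z)"
      by (intro tendsto_norm bounded_linear.tendsto[OF D.bounded_linear] y)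
    show "\<exists>N. \<forall>n\<ge>N. e * norm (y n) \<le> norm (D (y n))" using range y(1) by (metis rangeE)
  qed
  then show ?thesis by (simp add: D_def)
qed

end

section \<open>Square roots of bounded positive operators\<close>

text \<open>Polynomials in B with nonnegative coefficients and no constant term, paired with their
  value at 1. The class is not closed under differences, which is why the increments of the
  iteration need their own derivation.\<close>

inductive pos_poly :: "('a::real_normed_vector \<Rightarrow> 'a) \<Rightarrow> ('a \<Rightarrow> 'a) \<Rightarrow> real \<Rightarrow> bool" for B where
  zero: "pos_poly B (\<lambda>x. 0) 0"
| base: "pos_poly B B 1"
| add: "pos_poly B X a \<Longrightarrow> pos_poly B Y b \<Longrightarrow> pos_poly B (\<lambda>x. X x + Y x) (a + b)"
| mult: "pos_poly B X a \<Longrightarrow> pos_poly B Y b \<Longrightarrow> pos_poly B (\<lambda>x. X (Y x)) (a * b)"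
| scale: "0 \<le> r \<Longrightarrow> pos_poly B X a \<Longrightarrow> pos_poly B (\<lambda>x. r *\<^sub>R X x) (r * a)"

text \<open>For a contraction every power has norm at most 1, so the value at 1 majorizes the
  operator.\<close>

lemma pos_poly_bound:
  assumes "pos_poly B X a" "\<And>x. norm (B x) \<le> norm x"
  shows "0 \<le> a" "norm (X x) \<le> a * norm x"
proof -
  have "0 \<le> a \<and> (\<forall>x. norm (X x) \<le> a * norm x)"
    using assms(1)
  proof induction
    case (add X a Y b)
    then show ?case by (auto simp: algebra_simps intro: norm_triangle_mono)
  next
    case (mult X a Y b)
    have "norm (X (Y x)) \<le> a * b * norm x" for x
    proof -
      have "norm (X (Y x)) \<le> a * norm (Y x)" using mult by blast
      also have "\<dots> \<le> a * (b * norm x)" using mult by (intro mult_left_mono) auto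
      finally show ?thesis by simp
    qed
    then show ?case using mult by simp
  next
    case (scale r X a)
    then show ?case by (simp add: mult.assoc mult_left_mono)
  qed (use assms(2) in auto)
  then show "0 \<le> a" "norm (X x) \<le> a * norm x" by auto
qed

lemma pos_poly_linear:
  assumes "pos_poly B X a" "linear B"
  shows "linear X"
  using assms(1)
proof induction
  case (mult X a Y b)
  then show ?case using linear_compose[of Y X] by (simp add: o_def)
qed (intro linear_zero assms(2) linear_compose_add linear_compose_scale_right; assumption)+

lemma pos_poly_commute:
  assumes "pos_poly B X a" "linear Q" "\<And>x. Q (B x) = B (Q x)"
  shows "Q (X x) = X (Q x)"
  using assms(1)
  by (induction arbitrary: x)
    (simp_all add: assms(3) linear_add linear_scale linear_0 assms(2))

text \<open>A product of symmetric operators is symmetric only if the factors commute, and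
  polynomials in the same B do.\<close>

lemma pos_poly_symmetric_op:
  assumes "pos_poly B X a" "symmetric_op B"
  shows "symmetric_op X"
  using assms(1)
proof induction
  case zero
  show ?case by (intro symmetric_op.intro) auto
next
  case base
  show ?case by (rule assms(2))
next
  case (add X a Y b)
  then show ?case unfolding symmetric_op_def
    by (auto intro: bounded_linear_add simp: inner_add_left inner_add_right)
next
  case (mult X a Y b)
  have lin: "linear B" by (rule bounded_linear.linear[OF symmetric_op.bounded_linear[OF assms(2)]])
  have "X (B x) = B (X x)" for x
    using pos_poly_commute[OF mult.hyps(1) lin] by simp
  then have comm: "X (Y x) = Y (X x)" for x
    by (rule pos_poly_commute[OF mult.hyps(2) pos_poly_linear[OF mult.hyps(1) lin]])
  show ?case
    by (rule symmetric_op.intro[OF bounded_linear_compose])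
      (use mult.IH in \<open>auto simp: symmetric_op_def comm\<close>)
next
  case (scale r X a)
  then show ?case unfolding symmetric_op_def by (auto intro: bounded_linear_const_scaleR)
qed

text \<open>The iteration \<open>Y \<leftarrow> (B + Y\<^sup>2) / 2\<close> for \<open>1 - sqrt (1 - B)\<close>, and its majorant for \<open>B = 1\<close>.\<close>

fun sqrt_iter :: "('a::real_vector \<Rightarrow> 'a) \<Rightarrow> nat \<Rightarrow> 'a \<Rightarrow> 'a" where
  "sqrt_iter B 0 x = 0"
| "sqrt_iter B (Suc n) x = (1/2) *\<^sub>R (B x + sqrt_iter B n (sqrt_iter B n x))"

fun sqrt_iter1 :: "nat \<Rightarrow> real" where
  "sqrt_iter1 0 = 0"
| "sqrt_iter1 (Suc n) = (1/2) * (1 + sqrt_iter1 n * sqrt_iter1 n)"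

lemma pos_poly_sqrt_iter: "pos_poly B (sqrt_iter B n) (sqrt_iter1 n)"
proof (induction n)
  case 0
  have "sqrt_iter B 0 = (\<lambda>x. 0)" by auto
  then show ?case using pos_poly.zero by simp
next
  case (Suc n)
  have "sqrt_iter B (Suc n) = (\<lambda>x. (1/2) *\<^sub>R (B x + sqrt_iter B n (sqrt_iter B n x)))"
    by auto
  then show ?case
    using pos_poly.scale[OF _ pos_poly.add[OF pos_poly.base pos_poly.mult[OF Suc Suc]], of "1/2"]
    by simp
qed

text \<open>A difference of squares factors as \<open>Y (Y - Z) + (Y - Z) Z\<close>, in which the
  only difference is the previous increment. By induction every increment has nonnegative
  coefficients, and \<open>sqrt_iter1\<close> dominates the increments in norm.\<close>

lemma pos_poly_sqrt_iter_step:
  assumes "linear B"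
  shows "pos_poly B (\<lambda>x. sqrt_iter B (Suc n) x - sqrt_iter B n x)
    (sqrt_iter1 (Suc n) - sqrt_iter1 n)"
proof (induction n)
  case 0
  have "(\<lambda>x. sqrt_iter B (Suc 0) x - sqrt_iter B 0 x) = (\<lambda>x. (1/2) *\<^sub>R B x)" by auto
  then show ?case using pos_poly.scale[OF _ pos_poly.base, of "1/2" B] by simp
next
  case (Suc n)
  let ?Y = "sqrt_iter B" and ?a = sqrt_iter1
  have lin: "linear (?Y n)" for n
  proof (induction n)
    case (Suc n)
    have "?Y (Suc n) = (\<lambda>x. (1/2) *\<^sub>R (B x + ?Y n (?Y n x)))" by auto
    then show ?case using Suc assms
      by (simp only:) (intro linear_compose_scale_right linear_compose_add linear_compose[of "?Y n" "?Y n", unfolded o_def])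
  qed (simp add: linear_iff)
  have "(\<lambda>x. ?Y (Suc (Suc n)) x - ?Y (Suc n) x)
      = (\<lambda>x. (1/2) *\<^sub>R (?Y (Suc n) (?Y (Suc n) x - ?Y n x) + (?Y (Suc n) (?Y n x) - ?Y n (?Y n x))))"
    (is "_ = ?Z")
  proof
    fix x
    show "?Y (Suc (Suc n)) x - ?Y (Suc n) x = ?Z x"
      unfolding linear_diff[OF lin[of "Suc n"]] sqrt_iter.simps(2)[of B "Suc n"]
      by (simp add: sqrt_iter.simps(2)[of B n x] algebra_simps)
  qed
  moreover have "pos_poly B ?Z (1/2 * (?a (Suc n) * (?a (Suc n) - ?a n) + (?a (Suc n) - ?a n) * ?a n))"
    by (intro pos_poly.scale pos_poly.add pos_poly.mult[OF pos_poly_sqrt_iter Suc]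
        pos_poly.mult[OF Suc pos_poly_sqrt_iter]) simp
  moreover have "1/2 * (?a (Suc n) * (?a (Suc n) - ?a n) + (?a (Suc n) - ?a n) * ?a n)
      = ?a (Suc (Suc n)) - ?a (Suc n)"
    unfolding sqrt_iter1.simps(2)[of "Suc n"]
    by (simp add: sqrt_iter1.simps(2)[of n] algebra_simps del: sqrt_iter1.simps(2))
  ultimately show ?case by (simp only:)
qed

lemma sqrt_iter_dist:
  assumes "linear B" "\<And>x. norm (B x) \<le> norm x" "n \<le> m"
  shows "norm (sqrt_iter B m x - sqrt_iter B n x) \<le> (sqrt_iter1 m - sqrt_iter1 n) * norm x"
  using assms(3)
proof (induction m rule: dec_induct)
  case (step m)
  have "norm (sqrt_iter B (Suc m) x - sqrt_iter B m x) \<le> (sqrt_iter1 (Suc m) - sqrt_iter1 m) * norm x"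
    using pos_poly_bound(2)[OF pos_poly_sqrt_iter_step[OF assms(1)] assms(2)] .
  with step.IH norm_triangle_ineq[of "sqrt_iter B (Suc m) x - sqrt_iter B m x"
      "sqrt_iter B m x - sqrt_iter B n x"]
  show ?case by (simp add: algebra_simps del: sqrt_iter.simps sqrt_iter1.simps)
qed simp

lemma sqrt_iter1_mono: "incseq sqrt_iter1"
  by (rule incseq_SucI)
    (use pos_poly_bound(1)[OF pos_poly_sqrt_iter_step[of "\<lambda>x::real. x"]] in
      \<open>force simp: linear_iff\<close>)

lemma sqrt_iter1_bounds: "0 \<le> sqrt_iter1 n" "sqrt_iter1 n \<le> 1"
proof -
  have "0 \<le> sqrt_iter1 n \<and> sqrt_iter1 n \<le> 1"
  proof (induction n)
    case (Suc n)
    then have "sqrt_iter1 n * sqrt_iter1 n \<le> 1" by (simp add: mult_le_one)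
    then show ?case by simp
  qed simp
  then show "0 \<le> sqrt_iter1 n" "sqrt_iter1 n \<le> 1" by auto
qed

text \<open>The scalar majorant increases and is bounded by 1, so the iterates converge; the limit
  satisfies 2 Y = B + Y^2, that is (1 - Y)^2 = 1 - B, written here with both signs reversed.
  Commutation passes to the limit because the iterates are polynomials in B.\<close>

lemma contraction_sqrt:
  fixes B :: "'a::{real_inner,complete_space} \<Rightarrow> 'a"
  assumes B: "symmetric_op B" "\<And>x. norm (B x) \<le> norm x"
  obtains Y where "symmetric_op Y" "\<And>x. norm (Y x) \<le> norm x"
    "\<And>x. (Y x - x) - Y (Y x - x) = B x - x"
    "\<And>Q x. bounded_linear Q \<Longrightarrow> (\<And>x. Q (B x) = B (Q x)) \<Longrightarrow> Q (Y x) = Y (Q x)"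
proof -
  let ?Y = "sqrt_iter B"
  note linB = bounded_linear.linear[OF symmetric_op.bounded_linear[OF B(1)]]
  have sym: "symmetric_op (?Y n)" for n
    by (rule pos_poly_symmetric_op[OF pos_poly_sqrt_iter B(1)])
  have bnd: "norm (?Y n x) \<le> norm x" for n x
  proof -
    have "norm (?Y n x) \<le> sqrt_iter1 n * norm x"
      by (rule pos_poly_bound(2)[OF pos_poly_sqrt_iter B(2)])
    also have "\<dots> \<le> 1 * norm x" by (intro mult_right_mono sqrt_iter1_bounds) simp
    finally show ?thesis by simp
  qed
  obtain L where L: "sqrt_iter1 \<longlonglongrightarrow> L" "\<And>n. sqrt_iter1 n \<le> L"
    using incseq_convergent[OF sqrt_iter1_mono, of 1] sqrt_iter1_bounds(2) by blast
  have Cauchy: "Cauchy (\<lambda>n. ?Y n x)" for x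
  proof (rule Cauchy_if_tail_bound)
    show "norm (?Y m x - ?Y n x) \<le> (L - sqrt_iter1 n) * norm x" if "n \<le> m" for m n
      by (rule order_trans[OF sqrt_iter_dist[OF linB B(2) that]])
        (simp add: L(2) mult_right_mono)
    have "(\<lambda>n. (L - sqrt_iter1 n) * norm x) \<longlonglongrightarrow> (L - L) * norm x"
      by (intro tendsto_intros L(1))
    then show "(\<lambda>n. (L - sqrt_iter1 n) * norm x) \<longlonglongrightarrow> 0" by simp
  qed
  define Y where "Y = (\<lambda>x. lim (\<lambda>n. ?Y n x))"
  have Y: "(\<lambda>n. ?Y n x) \<longlonglongrightarrow> Y x" for x
    using Cauchy[of x] unfolding Y_def Cauchy_convergent_iff convergent_LIMSEQ_iff .
  have Y_bnd: "norm (Y x) \<le> norm x" for x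
    by (rule LIMSEQ_le_const2[OF tendsto_norm[OF Y]]) (use bnd in blast)
  have linY: "linear Y"
  proof (rule linearI)
    show "Y (x + y) = Y x + Y y" for x y
      using LIMSEQ_unique[OF Y[of "x + y"]] tendsto_add[OF Y[of x] Y[of y]]
      by (simp add: symmetric_op.lin[OF sym])
    show "Y (c *\<^sub>R x) = c *\<^sub>R Y x" for c x
      using LIMSEQ_unique[OF Y[of "c *\<^sub>R x"]] tendsto_scaleR[OF tendsto_const Y[of x], of c]
      by (simp add: symmetric_op.lin[OF sym])
  qed
  have blY: "bounded_linear Y"
    using linY Y_bnd by (intro bounded_linear_intro[of _ 1]) (auto simp: linear_add linear_scale)
  have symY: "inner (Y x) y = inner x (Y y)" for x y
  proof (rule LIMSEQ_unique)
    show "(\<lambda>n. inner (?Y n x) y) \<longlonglongrightarrow> inner (Y x) y" by (intro tendsto_intros Y)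
    show "(\<lambda>n. inner (?Y n x) y) \<longlonglongrightarrow> inner x (Y y)"
      unfolding symmetric_op.symmetric[OF sym] by (intro tendsto_intros Y)
  qed
  have YY: "(\<lambda>n. ?Y n (?Y n x)) \<longlonglongrightarrow> Y (Y x)" for x
  proof -
    \<comment> \<open>Pointwise convergence suffices for the composition, because the iterates are
      contractions uniformly in n.\<close>
    have "(\<lambda>n. ?Y n (?Y n x - Y x)) \<longlonglongrightarrow> 0"
    proof (rule Lim_null_comparison)
      show "\<forall>\<^sub>F n in sequentially. norm (?Y n (?Y n x - Y x)) \<le> norm (?Y n x - Y x)"
        using bnd by simp
      show "(\<lambda>n. norm (?Y n x - Y x)) \<longlonglongrightarrow> 0"
        using Y[of x] by (simp add: LIM_zero_iff tendsto_norm_zero_iff)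
    qed
    from tendsto_add[OF this Y[of "Y x"]] show ?thesis
      by (simp add: symmetric_op.lin[OF sym])
  qed
  have fix_eq: "Y x = (1/2) *\<^sub>R (B x + Y (Y x))" for x
  proof (rule LIMSEQ_unique)
    show "(\<lambda>n. ?Y (Suc n) x) \<longlonglongrightarrow> Y x" using Y by (rule LIMSEQ_Suc)
    show "(\<lambda>n. ?Y (Suc n) x) \<longlonglongrightarrow> (1/2) *\<^sub>R (B x + Y (Y x))"
      unfolding sqrt_iter.simps by (intro tendsto_intros YY)
  qed
  show ?thesis
  proof (rule that[of Y])
    show "symmetric_op Y" using blY symY by (rule symmetric_op.intro)
    show "norm (Y x) \<le> norm x" for x by (rule Y_bnd)
    show "(Y x - x) - Y (Y x - x) = B x - x" for x
    proof -
      have "2 *\<^sub>R Y x = B x + Y (Y x)" by (subst fix_eq) simp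
      then have "B x = 2 *\<^sub>R Y x - Y (Y x)" by simp
      then show ?thesis by (simp add: linear_diff[OF linY] scaleR_2)
    qed
    show "Q (Y x) = Y (Q x)" if Q: "bounded_linear Q" "\<And>x. Q (B x) = B (Q x)" for Q x
    proof (rule LIMSEQ_unique)
      show "(\<lambda>n. Q (?Y n x)) \<longlonglongrightarrow> Q (Y x)" by (intro bounded_linear.tendsto[OF Q(1)] Y)
      show "(\<lambda>n. Q (?Y n x)) \<longlonglongrightarrow> Y (Q x)"
      proof -
        have "Q (?Y n x) = ?Y n (Q x)" for n
          using pos_poly_sqrt_iter[of B n] bounded_linear.linear[OF Q(1)] Q(2)
          by (rule pos_poly_commute)
        then show ?thesis using Y[of "Q x"] by simp
      qed
    qed
  qed
qed

locale positive_op = symmetric_op +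
  assumes nonneg: "0 \<le> inner (T x) x"
begin

lemma kernel: "inner (T x) x = 0 \<Longrightarrow> T x = 0"
proof -
  obtain b where b: "b > 0" "\<And>x. norm (T x) \<le> b * norm x" by (rule bound_obtain) blast
  assume "inner (T x) x = 0"
  with nonneg_norm_le[of UNIV b x] b nonneg show ?thesis by simp
qed

lemma sqrt_obtain:
  obtains R where "positive_op R" "\<And>x. R (R x) = T x"
    "\<And>Q x. bounded_linear Q \<Longrightarrow> (\<And>x. Q (T x) = T (Q x)) \<Longrightarrow> Q (R x) = R (Q x)"
proof -
  obtain b where b: "b > 0" "\<And>x. norm (T x) \<le> b * norm x" by (rule bound_obtain) blast
  \<comment> \<open>With b a bound of T, the operator 1 - T/b is a contraction by
    \<open>nonneg_norm_le\<close>, and T = b (1 - B) is the square of sqrt b (1 - Y).\<close>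
  define B where "B = (\<lambda>x. x - (1/b) *\<^sub>R T x)"
  have B: "symmetric_op B"
    unfolding B_def
  proof (rule symmetric_op.intro)
    show "bounded_linear (\<lambda>x. x - (1/b) *\<^sub>R T x)"
      by (intro bounded_linear_sub bounded_linear_ident bounded_linear_const_scaleR bounded_linear)
  qed (simp add: inner_diff_left inner_diff_right symmetric)
  have "norm (B x) \<le> norm x" for x
  proof -
    have le: "(norm (T x))\<^sup>2 \<le> b * inner (T x) x"
      by (rule nonneg_norm_le[of UNIV]) (use nonneg b in auto)
    have "(norm (B x))\<^sup>2 = (norm x)\<^sup>2 - 2 / b * inner (T x) x + (norm (T x))\<^sup>2 / b\<^sup>2"
      using b unfolding B_def power2_norm_diff by (simp add: inner_commute power_divide)
    also have "(norm (T x))\<^sup>2 / b\<^sup>2 \<le> b * inner (T x) x / b\<^sup>2" by (rule divide_right_mono[OF le]) simp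
    also have "\<dots> = 1 / b * inner (T x) x" using b(1) by (simp add: power2_eq_square)
    also have "(norm x)\<^sup>2 - 2 / b * inner (T x) x + 1 / b * inner (T x) x
        = (norm x)\<^sup>2 - 1 / b * inner (T x) x" by (simp add: algebra_simps)
    also have "\<dots> \<le> (norm x)\<^sup>2" using nonneg[of x] b(1) by simp
    finally have "(norm (B x))\<^sup>2 \<le> (norm x)\<^sup>2" by simp
    then show ?thesis by (rule power2_le_imp_le) simp
  qed
  from contraction_sqrt[OF B this] obtain Y where Y: "symmetric_op Y" "\<And>x. norm (Y x) \<le> norm x"
    "\<And>x. (Y x - x) - Y (Y x - x) = B x - x"
    "\<And>Q x. bounded_linear Q \<Longrightarrow> (\<And>x. Q (B x) = B (Q x)) \<Longrightarrow> Q (Y x) = Y (Q x)" by blast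
  note Ylin = symmetric_op.lin[OF Y(1)]
  define R where "R = (\<lambda>x. sqrt b *\<^sub>R (x - Y x))"
  show ?thesis
  proof (rule that[of R])
    show "positive_op R"
      unfolding R_def
    proof (intro positive_op.intro symmetric_op.intro positive_op_axioms.intro)
      show "bounded_linear (\<lambda>x. sqrt b *\<^sub>R (x - Y x))"
        by (intro bounded_linear_sub bounded_linear_ident bounded_linear_const_scaleR
            symmetric_op.bounded_linear[OF Y(1)])
      show "0 \<le> inner (sqrt b *\<^sub>R (x - Y x)) x" for x
      proof -
        have "inner (Y x) x \<le> norm (Y x) * norm x" by (rule norm_cauchy_schwarz)
        also have "\<dots> \<le> norm x * norm x" by (intro mult_right_mono Y) simp
        finally show ?thesis using b
          by (simp add: inner_diff_left power2_norm_eq_inner[symmetric] power2_eq_square)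
      qed
    qed (simp add: inner_diff_left inner_diff_right symmetric_op.symmetric[OF Y(1)])
    show "R (R x) = T x" for x
    proof -
      have "R (R x) = b *\<^sub>R ((x - Y x) - Y (x - Y x))"
        using b(1) by (simp add: R_def Ylin algebra_simps)
      also have "(x - Y x) - Y (x - Y x) = - ((Y x - x) - Y (Y x - x))"
        by (simp add: Ylin algebra_simps)
      also have "\<dots> = (1/b) *\<^sub>R T x" unfolding Y(3) by (simp add: B_def)
      finally show ?thesis using b(1) by simp
    qed
    show "Q (R x) = R (Q x)" if Q: "bounded_linear Q" "\<And>x. Q (T x) = T (Q x)" for Q x
    proof -
      note Qlin = linear_diff[OF bounded_linear.linear[OF Q(1)]]
        linear_scale[OF bounded_linear.linear[OF Q(1)]]
      have "Q (Y x) = Y (Q x)" by (rule Y(4)[OF Q(1)]) (simp add: B_def Qlin Q(2))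
      then show ?thesis by (simp add: R_def Qlin)
    qed
  qed
qed

text \<open>Two roots need not commute a priori, so both are compared with a root V that commutes
  with everything commuting with T. Then (V + Q) (V - Q) = 0, and positivity makes both forms vanish
  at y = V x - Q x.\<close>

lemma sqrt_unique:
  assumes Q: "positive_op Q" "\<And>x. Q (Q x) = T x" and R: "positive_op R" "\<And>x. R (R x) = T x"
    and inj: "\<And>x. T x = 0 \<Longrightarrow> x = 0"
  shows "Q = R"
proof -
  obtain V where V: "positive_op V" "\<And>x. V (V x) = T x"
    "\<And>Q x. bounded_linear Q \<Longrightarrow> (\<And>x. Q (T x) = T (Q x)) \<Longrightarrow> Q (V x) = V (Q x)"
    by (rule sqrt_obtain) blast
  have "Q x = V x" if Q: "positive_op Q" "\<And>x. Q (Q x) = T x" for Q x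
  proof -
    interpret Q: positive_op Q by (rule Q)
    interpret V: positive_op V by (rule V)
    have comm: "Q (V x) = V (Q x)" for x
      by (rule V(3)[OF Q.bounded_linear]) (simp flip: Q(2))
    define y where "y = V x - Q x"
    have "V y + Q y = 0" by (simp add: y_def V.lin Q.lin V(2) Q(2) comm)
    then have "inner (V y) y + inner (Q y) y = 0" by (simp flip: inner_add_left)
    with V.nonneg[of y] Q.nonneg[of y] have "inner (V y) y = 0" by linarith
    then have "V y = 0" by (rule V.kernel)
    then have "T y = 0" using V(2)[of y] by (simp add: V.lin)
    then have "y = 0" by (rule inj)
    then show ?thesis by (simp add: y_def)
  qed
  from this[OF Q] this[OF R] show ?thesis by auto
qed

end

section \<open>Inner products and orthonormal systems\<close>

locale ip =
  fixes g :: "'a::complex_hilbert \<Rightarrow> 'a \<Rightarrow> complex"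
  assumes inner_product: "inner_product g"
begin

lemma add_right: "g x (y + z) = g x y + g x z"
  and scaleC_right: "g x (a *\<^sub>C y) = a * g x y"
  and conj: "g x y = cnj (g y x)"
  and pos: "x \<noteq> 0 \<Longrightarrow> 0 < Re (g x x)"
  using inner_product unfolding inner_product_def by blast+

lemma add_left: "g (x + y) z = g x z + g y z"
  using add_right[of z x y] conj by (metis complex_cnj_add)

lemma scaleC_left: "g (a *\<^sub>C x) y = cnj a * g x y"
  using scaleC_right[of y a x] conj by (metis complex_cnj_mult)

lemma zero_right [simp]: "g x 0 = 0"
  using scaleC_right[of x 0 0] by simp

lemma zero_left [simp]: "g 0 x = 0"
  using scaleC_left[of 0 0 x] by simp

lemma minus_right: "g x (- y) = - g x y"
  using add_right[of x y "- y"] by (simp add: add_eq_0_iff)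

lemma minus_left: "g (- x) y = - g x y"
  using add_left[of x "- x" y] by (simp add: add_eq_0_iff)

lemma diff_right: "g x (y - z) = g x y - g x z"
  using add_right[of x y "- z"] by (simp add: minus_right)

lemma diff_left: "g (x - y) z = g x z - g y z"
  using add_left[of x "- y" z] by (simp add: minus_left)

lemma sum_right: "g x (sum f F) = (\<Sum>i\<in>F. g x (f i))"
  by (induction F rule: infinite_finite_induct) (auto simp: add_right)

lemma sum_left: "g (sum f F) x = (\<Sum>i\<in>F. g (f i) x)"
  by (induction F rule: infinite_finite_induct) (auto simp: add_left)

lemma self: "g x x = complex_of_real ((ip_norm g x)\<^sup>2)"
proof -
  have "Im (g x x) = 0" using arg_cong[OF conj[of x x], of Im] by simp
  moreover have "0 \<le> Re (g x x)" using pos[of x] by (cases "x = 0") auto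
  ultimately show ?thesis by (simp add: ip_norm_def complex_eq_iff)
qed

lemma norm_zero_iff: "ip_norm g x = 0 \<longleftrightarrow> x = 0"
  using pos[of x] by (cases "x = 0") (auto simp: ip_norm_def)

lemma norm_nonneg: "0 \<le> ip_norm g x"
  using pos[of x] by (cases "x = 0") (auto simp: ip_norm_def)

lemma orthonormal_coeff:
  assumes e: "orthonormal_on g I e" and F: "finite F" "F \<subseteq> I" and j: "j \<in> I"
  shows "g (e j) (\<Sum>k\<in>F. c k *\<^sub>C e k) = (if j \<in> F then c j else 0)"
proof -
  have "g (e j) (\<Sum>k\<in>F. c k *\<^sub>C e k) = (\<Sum>k\<in>F. if j = k then c k else 0)"
    unfolding sum_right
    by (intro sum.cong) (use e F j in \<open>auto simp: scaleC_right orthonormal_on_def\<close>)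
  then show ?thesis using F by simp
qed

lemma orthonormal_norm:
  assumes e: "orthonormal_on g I e" and F: "finite F" "F \<subseteq> I"
  shows "(ip_norm g (\<Sum>k\<in>F. c k *\<^sub>C e k))\<^sup>2 = (\<Sum>k\<in>F. (cmod (c k))\<^sup>2)"
proof -
  let ?s = "\<Sum>k\<in>F. c k *\<^sub>C e k"
  have "complex_of_real ((ip_norm g ?s)\<^sup>2) = (\<Sum>k\<in>F. g (c k *\<^sub>C e k) ?s)"
    unfolding self[symmetric] by (rule sum_left)
  also have "\<dots> = (\<Sum>k\<in>F. complex_of_real ((cmod (c k))\<^sup>2))"
    by (intro sum.cong refl, subst scaleC_left, subst orthonormal_coeff[OF e F])
      (use F in \<open>auto simp: complex_norm_square mult.commute simp del: of_real_power\<close>)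
  finally show ?thesis using of_real_eq_iff unfolding of_real_sum[symmetric] by blast
qed

lemma norm_diff_sq: "(ip_norm g (x - y))\<^sup>2 = (ip_norm g x)\<^sup>2 - 2 * Re (g y x) + (ip_norm g y)\<^sup>2"
proof -
  have "Re (g (x - y) (x - y)) = Re (g x x) - Re (g x y) - Re (g y x) + Re (g y y)"
    by (simp add: diff_left diff_right)
  moreover have "Re (g x y) = Re (g y x)" by (subst conj) simp
  ultimately show ?thesis by (simp add: self)
qed

lemma bessel:
  assumes e: "orthonormal_on g I e" and F: "finite F" "F \<subseteq> I"
  shows "(\<Sum>k\<in>F. (cmod (g (e k) x))\<^sup>2) \<le> (ip_norm g x)\<^sup>2"
proof -
  let ?s = "\<Sum>k\<in>F. g (e k) x *\<^sub>C e k"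
  have "g ?s x = complex_of_real (\<Sum>k\<in>F. (cmod (g (e k) x))\<^sup>2)"
    unfolding sum_left of_real_sum
    by (intro sum.cong) (auto simp: scaleC_left complex_norm_square mult.commute simp del: of_real_power)
  then have "(ip_norm g (x - ?s))\<^sup>2 = (ip_norm g x)\<^sup>2 - (\<Sum>k\<in>F. (cmod (g (e k) x))\<^sup>2)"
    by (simp add: norm_diff_sq orthonormal_norm[OF e F])
  then show ?thesis using zero_le_power2[of "ip_norm g (x - ?s)"] by linarith
qed

lemma orthonormal_cmod_le:
  assumes "orthonormal_on g I e" "k \<in> I"
  shows "cmod (g (e k) x) \<le> ip_norm g x"
  by (rule power2_le_imp_le) (use bessel[OF assms(1), of "{k}" x] assms(2) norm_nonneg in auto)

end

lemma inner_product_cinner: "inner_product (cinner :: 'a::complex_hilbert \<Rightarrow> _)"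
proof -
  have "0 < Re (cinner x x)" if "x \<noteq> 0" for x :: 'a
    using that by (simp add: Re_cinner)
  then show ?thesis unfolding inner_product_def
    using cinner_add_right cinner_scaleC_right cinner_commute by blast
qed

interpretation cinner: ip cinner
  by unfold_locales (rule inner_product_cinner)

lemma ip_norm_cinner [simp]: "ip_norm cinner x = norm x"
  by (simp add: ip_norm_def Re_cinner norm_eq_sqrt_inner)

lemma norm_scaleC: "norm (a *\<^sub>C x) = cmod a * norm x" for x :: "'a::complex_hilbert"
proof -
  have "complex_of_real ((norm (a *\<^sub>C x))\<^sup>2) = complex_of_real ((cmod a * norm x)\<^sup>2)"
    using cinner.self[of "a *\<^sub>C x"] cinner.self[of x] complex_norm_square[of a]
    by (simp add: cinner.scaleC_left cinner.scaleC_right power_mult_distrib mult_ac)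
  then have "(norm (a *\<^sub>C x))\<^sup>2 = (cmod a * norm x)\<^sup>2" by (simp only: of_real_eq_iff)
  then show ?thesis by (simp add: power2_eq_iff_nonneg)
qed

lemma scaleC_scaleR: "a *\<^sub>C (r *\<^sub>R x) = r *\<^sub>R (a *\<^sub>C x)" for x :: "'a::complex_hilbert"
  by (simp flip: scaleC_of_real add: complex_vector.scale_scale mult.commute)

lemma bounded_linear_scaleC: "bounded_linear (\<lambda>x :: 'a::complex_hilbert. a *\<^sub>C x)"
  by (rule bounded_linear_intro[of _ "cmod a"])
    (simp_all add: complex_vector.scale_right_distrib scaleC_scaleR norm_scaleC)

text \<open>Complex identities thus split into two real ones, the second with the left vector
  multiplied by \<i>; for operators commuting with \<i> the real theory suffices.\<close>

lemma Im_cinner: "Im (cinner x y) = inner (\<i> *\<^sub>C x) y"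
  by (simp add: cinner.scaleC_left flip: Re_cinner)

lemma cinner_eq_iff: "cinner x y = cinner v w \<longleftrightarrow>
    inner x y = inner v w \<and> inner (\<i> *\<^sub>C x) y = inner (\<i> *\<^sub>C v) w"
  by (simp add: complex_eq_iff Re_cinner Im_cinner)

text \<open>Bessel's inequality for the system consisting of the single vector x / |x|.\<close>

lemma cinner_norm_le: "cmod (cinner x y) \<le> norm x * norm y"
proof (cases "x = 0")
  case False
  let ?e = "\<lambda>_::nat. complex_of_real (1 / norm x) *\<^sub>C x"
  have "cinner x x = complex_of_real ((norm x)\<^sup>2)" using cinner.self[of x] by simp
  then have "orthonormal_on cinner {0} ?e" using False
    by (simp add: orthonormal_on_def cinner.scaleC_left cinner.scaleC_right power2_eq_square)
  from cinner.orthonormal_cmod_le[OF this, of 0 y] False show ?thesis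
    by (simp add: cinner.scaleC_left norm_mult norm_divide field_simps)
qed simp

lemma tendsto_cinner:
  assumes "(f \<longlongrightarrow> x) F" "(h \<longlongrightarrow> y) F"
  shows "((\<lambda>n. cinner (f n) (h n)) \<longlongrightarrow> cinner x y) F"
proof -
  have eq: "cinner x y = Complex (inner x y) (inner (\<i> *\<^sub>C x) y)" for x y :: 'b
    by (simp add: complex_eq_iff Re_cinner Im_cinner)
  show ?thesis unfolding eq
    by (intro tendsto_Complex tendsto_inner bounded_linear.tendsto[OF bounded_linear_scaleC] assms)
qed

section \<open>Positive definite selfadjoint operators and their square roots\<close>

lemma selfadjoint_iff:
  "selfadjoint g S \<Longrightarrow> (v, w) \<in> S \<longleftrightarrow> (\<forall>(x, y)\<in>S. g v y = g w x)"
  unfolding selfadjoint_def op_adjoint_def by blast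

lemma selfadjoint_linear:
  assumes S: "selfadjoint cinner S"
  shows "(0, 0) \<in> S"
    and "(x, y) \<in> S \<Longrightarrow> (x', y') \<in> S \<Longrightarrow> (x + x', y + y') \<in> S"
    and "(x, y) \<in> S \<Longrightarrow> (x', y') \<in> S \<Longrightarrow> (x - x', y - y') \<in> S"
    and "(x, y) \<in> S \<Longrightarrow> (a *\<^sub>C x, a *\<^sub>C y) \<in> S"
proof -
  have eq: "cinner v b = cinner w a" if "(v, w) \<in> S" "(a, b) \<in> S" for v w a b
    using that selfadjoint_iff[OF S, of v w] by blast
  have mem: "(v, w) \<in> S" if "\<And>a b. (a, b) \<in> S \<Longrightarrow> cinner v b = cinner w a" for v w
    using that selfadjoint_iff[OF S, of v w] by blast
  show "(0, 0) \<in> S" by (rule mem) simp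
  show "(x, y) \<in> S \<Longrightarrow> (x', y') \<in> S \<Longrightarrow> (x + x', y + y') \<in> S"
    by (rule mem) (simp add: cinner.add_left eq)
  show "(x, y) \<in> S \<Longrightarrow> (x', y') \<in> S \<Longrightarrow> (x - x', y - y') \<in> S"
    by (rule mem) (simp add: cinner.diff_left eq)
  show "(x, y) \<in> S \<Longrightarrow> (a *\<^sub>C x, a *\<^sub>C y) \<in> S"
    by (rule mem) (simp add: cinner.scaleC_left eq)
qed

lemma selfadjoint_closed:
  assumes S: "selfadjoint cinner S" and "\<And>n. (x n, y n) \<in> S" "x \<longlonglongrightarrow> v" "y \<longlonglongrightarrow> w"
  shows "(v, w) \<in> S"
  unfolding selfadjoint_iff[OF S]
proof clarify
  fix a b assume "(a, b) \<in> S"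
  then have "cinner (x n) b = cinner (y n) a" for n
    using assms(2)[of n] unfolding selfadjoint_iff[OF S, of "x n"] by blast
  moreover have "(\<lambda>n. cinner (x n) b) \<longlonglongrightarrow> cinner v b" "(\<lambda>n. cinner (y n) a) \<longlonglongrightarrow> cinner w a"
    by (intro tendsto_cinner tendsto_const assms)+
  ultimately show "cinner v b = cinner w a" by (simp add: LIMSEQ_unique)
qed

lemma op_app_graph:
  fixes F :: "'b::real_vector \<Rightarrow> 'b"
  assumes "\<And>y. F y = 0 \<Longrightarrow> y = 0" "\<And>x y. F (x - y) = F x - F y"
  shows "op_app {(F y, y) | y. True} (F x) = x"
  unfolding op_app_def
proof (rule the_equality)
  fix y assume "(F x, y) \<in> {(F y, y) | y. True}"
  then have "F (x - y) = 0" by (auto simp: assms(2))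
  then show "y = x" using assms(1) by fastforce
qed auto

locale pd_op =
  fixes A :: "'h::complex_hilbert operator"
  assumes selfadjoint: "selfadjoint cinner A" and positive_definite: "positive_definite cinner A"
begin

lemmas lin = selfadjoint_linear[OF selfadjoint]

lemma coercive: obtains \<alpha> where "\<alpha> > 0" "\<And>x y. (x, y) \<in> A \<Longrightarrow> \<alpha> * norm x \<le> norm y"
proof -
  obtain \<alpha> where \<alpha>: "\<alpha> > 0" "\<And>x y. (x, y) \<in> A \<Longrightarrow> \<alpha> * (norm x)\<^sup>2 \<le> inner x y"
    using positive_definite unfolding positive_definite_def by (auto simp: Re_cinner)
  have "\<alpha> * norm x \<le> norm y" if "(x, y) \<in> A" for x y
  proof (cases "x = 0")
    case False
    have "norm x * (\<alpha> * norm x) \<le> norm x * norm y"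
      using \<alpha>(2)[OF that] norm_cauchy_schwarz[of x y] by (simp add: power2_eq_square mult_ac)
    with False show ?thesis by simp
  qed simp
  with \<alpha>(1) that show ?thesis by blast
qed

lemma subspace_Range: "subspace (Range A)"
proof (rule subspaceI)
  show "0 \<in> Range A" using lin(1) by blast
  show "x + y \<in> Range A" if "x \<in> Range A" "y \<in> Range A" for x y
    using that lin(2) by blast
  show "c *\<^sub>R x \<in> Range A" if "x \<in> Range A" for c x
    using that lin(4)[of _ x "complex_of_real c"] by (auto simp: scaleC_of_real)
qed

text \<open>Coercivity turns convergence of images into convergence of preimages, and the graph is
  closed.\<close>

lemma closed_Range: "closed (Range A)"
proof -
  obtain \<alpha> where \<alpha>: "\<alpha> > 0" "\<And>x y. (x, y) \<in> A \<Longrightarrow> \<alpha> * norm x \<le> norm y" by (rule coercive) blast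
  have "w \<in> Range A" if y: "\<And>n. y n \<in> Range A" "y \<longlonglongrightarrow> w" for y w
  proof -
    have "\<forall>n. \<exists>x. (x, y n) \<in> A" using y(1) by blast
    then obtain x where x: "\<And>n. (x n, y n) \<in> A" by metis
    have "Cauchy x"
    proof (rule CauchyI)
      fix e :: real assume "e > 0"
      then have "\<alpha> * e > 0" using \<alpha>(1) by simp
      from CauchyD[OF LIMSEQ_imp_Cauchy[OF y(2)] this] obtain M where
        M: "\<forall>m\<ge>M. \<forall>n\<ge>M. norm (y m - y n) < \<alpha> * e" by blast
      have "norm (x m - x n) < e" if "m \<ge> M" "n \<ge> M" for m n
      proof -
        have "\<alpha> * norm (x m - x n) < \<alpha> * e"
          using \<alpha>(2)[OF lin(3)[OF x[of m] x[of n]]] M that by (meson order.strict_trans1)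
        with \<alpha>(1) show ?thesis by simp
      qed
      then show "\<exists>M. \<forall>m\<ge>M. \<forall>n\<ge>M. norm (x m - x n) < e" by blast
    qed
    then obtain v where "x \<longlonglongrightarrow> v" by (metis Cauchy_convergent convergent_def)
    then have "(v, w) \<in> A" using selfadjoint_closed[OF selfadjoint x _ y(2)] by blast
    then show ?thesis by blast
  qed
  then show ?thesis unfolding closed_sequential_limits by blast
qed

lemma injective: "(x, 0) \<in> A \<Longrightarrow> x = 0"
  by (rule coercive) (metis mult_le_0_iff norm_le_zero_iff norm_zero not_less)

text \<open>A vector orthogonal to the closed range belongs to the adjoint with value 0; as A is
  selfadjoint, it lies in the kernel, which is trivial. Testing also with \<i> times an image
  upgrades real to complex orthogonality.\<close>

lemma Range_UNIV: "Range A = UNIV"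
proof -
  have "w \<in> Range A" for w
  proof -
    obtain p where p: "p \<in> Range A" "\<And>y. y \<in> Range A \<Longrightarrow> inner (w - p) y = 0"
      using closed_subspace_projection[OF subspace_Range closed_Range] by blast
    have "cinner (w - p) y = cinner 0 x" if "(x, y) \<in> A" for x y
    proof -
      have "inner (w - p) y = 0" "inner (w - p) (\<i> *\<^sub>C y) = 0"
        using p(2) lin(4)[OF that, of \<i>] that by blast+
      then have "Re (cinner (w - p) y) = 0" "Re (\<i> * cinner (w - p) y) = 0"
        by (simp_all only: Re_cinner flip: cinner.scaleC_right)
      then show ?thesis by (simp add: complex_eq_iff)
    qed
    then have "(w - p, 0) \<in> A" unfolding selfadjoint_iff[OF selfadjoint, of "w - p"] by blast
    then show ?thesis using injective p(1) by fastforce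
  qed
  then show ?thesis by blast
qed

definition T :: "'h \<Rightarrow> 'h" where "T y = (THE x. (x, y) \<in> A)"

lemma mem_iff: "(x, y) \<in> A \<longleftrightarrow> x = T y"
proof -
  have uniq: "x = x'" if "(x, y) \<in> A" "(x', y) \<in> A" for x x'
    using injective[of "x - x'"] lin(3)[OF that] by simp
  have "\<exists>x. (x, y) \<in> A" using Range_UNIV by blast
  then have "\<exists>!x. (x, y) \<in> A" using uniq by blast
  then have "(T y, y) \<in> A" unfolding T_def by (rule theI')
  with uniq show ?thesis by blast
qed

lemma graph: "A = {(T y, y) | y. True}"
  using mem_iff by auto

lemma T_cinner: "cinner (T x) y = cinner x (T y)"
  using mem_iff[of "T x" x] mem_iff[of "T y" y] selfadjoint_iff[OF selfadjoint, of "T x" x] by blast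

lemma T_scaleC: "T (a *\<^sub>C x) = a *\<^sub>C T x"
  using lin(4) mem_iff by metis

lemma T_inj: "T x = 0 \<Longrightarrow> x = 0"
  using lin(1) mem_iff[of "T x" x] selfadjoint unfolding selfadjoint_def single_valued_def by metis

sublocale T: positive_op T
proof
  show "T (x + y) = T x + T y" for x y using lin(2) mem_iff by metis
  show "T (r *\<^sub>R x) = r *\<^sub>R T x" for r x using T_scaleC[of "complex_of_real r" x]
    by (simp add: scaleC_of_real)
  obtain \<alpha> where \<alpha>: "\<alpha> > 0" "\<And>x y. (x, y) \<in> A \<Longrightarrow> \<alpha> * norm x \<le> norm y" by (rule coercive) blast
  have "norm (T y) \<le> norm y * (1 / \<alpha>)" for y
    using \<alpha> mem_iff[of "T y" y] by (simp add: field_simps)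
  then show "\<exists>K. \<forall>x. norm (T x) \<le> norm x * K" by blast
  show "inner (T x) y = inner x (T y)" for x y
    using T_cinner[of x y] by (simp flip: Re_cinner)
  show "0 \<le> inner (T x) x" for x
  proof -
    obtain \<alpha> where \<alpha>: "\<alpha> > 0" "\<forall>(x, y)\<in>A. \<alpha> * (ip_norm cinner x)\<^sup>2 \<le> Re (cinner x y)"
      using positive_definite unfolding positive_definite_def by blast
    then have "\<alpha> * (norm (T x))\<^sup>2 \<le> inner (T x) x"
      using mem_iff[of "T x" x] by (auto simp: Re_cinner)
    moreover have "0 \<le> \<alpha> * (norm (T x))\<^sup>2" using \<alpha>(1) by simp
    ultimately show ?thesis by linarith
  qed
qed

text \<open>The commutation clause is kept because, applied to multiplication by a complex number,
  it makes R complex linear (\<open>R_scaleC\<close>).\<close>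

definition R :: "'h \<Rightarrow> 'h" where
  "R = (SOME R. positive_op R \<and> (\<forall>x. R (R x) = T x) \<and>
     (\<forall>Q. bounded_linear Q \<longrightarrow> (\<forall>x. Q (T x) = T (Q x)) \<longrightarrow> (\<forall>x. Q (R x) = R (Q x))))"

lemma R: "positive_op R \<and> (\<forall>x. R (R x) = T x) \<and>
     (\<forall>Q. bounded_linear Q \<longrightarrow> (\<forall>x. Q (T x) = T (Q x)) \<longrightarrow> (\<forall>x. Q (R x) = R (Q x)))"
  (is "?P R") unfolding R_def
proof (rule T.sqrt_obtain)
  fix R assume "positive_op R" "\<And>x. R (R x) = T x"
    "\<And>Q x. bounded_linear Q \<Longrightarrow> (\<And>x. Q (T x) = T (Q x)) \<Longrightarrow> Q (R x) = R (Q x)"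
  then have "?P R" by blast
  then show "?P (SOME R. ?P R)" by (rule someI[of ?P])
qed

lemma RR: "R (R x) = T x"
  using R by blast

sublocale R: positive_op R
  using R by blast

lemma R_T: "R (T x) = T (R x)"
  by (simp flip: RR)

lemma R_scaleC: "R (a *\<^sub>C x) = a *\<^sub>C R x"
  using R bounded_linear_scaleC T_scaleC by metis

lemma R_inj: "R x = 0 \<Longrightarrow> x = 0"
  using RR[of x] by (simp add: R.zero T_inj)

lemma R_cinner: "cinner (R x) y = cinner x (R y)"
  unfolding cinner_eq_iff by (simp add: R.symmetric flip: R_scaleC)

lemma norm_R_sq: "(norm (R x))\<^sup>2 = inner x (T x)"
  by (simp add: power2_norm_eq_inner R.symmetric RR)

lemma closure_range_T: "closure (range T) = UNIV"
proof -
  have "Domain A = range T" using mem_iff by auto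
  then show ?thesis using selfadjoint unfolding selfadjoint_def by simp
qed

text \<open>The graph is the inverse of R. It is densely defined since the range of R contains that
  of T, and selfadjoint since R is symmetric and everywhere defined. Uniqueness passes through
  inverses: the inverse of any competitor is a bounded positive root of T, so
  \<open>sqrt_unique\<close> applies.\<close>

lemma op_sqrt_eq: "op_sqrt A = {(R y, y) | y. True}"
  unfolding op_sqrt_def
proof (rule the_equality)
  let ?S = "{(R y, y) | y. True}"
  have "Domain ?S = range R" by auto
  moreover have "range T \<subseteq> range R" using RR by (metis image_subset_iff rangeI)
  ultimately have "closure (range T) \<subseteq> closure (Domain ?S)" by (intro closure_mono) simp
  then have "closure (Domain ?S) = UNIV" by (simp add: closure_range_T top.extremum_unique)
  moreover have "single_valued ?S"
  proof (rule single_valuedI)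
    fix x y z assume "(x, y) \<in> ?S" "(x, z) \<in> ?S"
    then have "R (y - z) = 0" by (auto simp: R.diff)
    then show "y = z" using R_inj by fastforce
  qed
  moreover have "op_adjoint cinner ?S = ?S"
  proof -
    have "v = R w" if "\<forall>y. cinner v y = cinner w (R y)" for v w
    proof -
      have "cinner (v - R w) y = 0" for y using that by (simp add: cinner.diff_left R_cinner)
      then have "inner (v - R w) (v - R w) = 0" by (simp flip: Re_cinner)
      then show ?thesis by simp
    qed
    then show ?thesis unfolding op_adjoint_def by (auto simp: R_cinner)
  qed
  moreover have "nonnegative_op cinner ?S"
    by (auto simp: nonnegative_op_def Re_cinner R.nonneg)
  moreover have "?S O ?S = A"
  proof -
    have "?S O ?S = {(T y, y) | y. True}" by (auto simp flip: RR)
    then show ?thesis by (rule trans[OF _ graph[symmetric]])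
  qed
  ultimately show "selfadjoint cinner ?S \<and> nonnegative_op cinner ?S \<and> ?S O ?S = A"
    unfolding selfadjoint_def by blast
next
  fix S assume S: "selfadjoint cinner S \<and> nonnegative_op cinner S \<and> S O S = A"
  note Slin = selfadjoint_linear[OF conjunct1[OF S]]
  have uniq: "x = x'" if "(x, y) \<in> S" "(x', y) \<in> S" for x x' y
  proof -
    have "(x - x', 0) \<in> S" using Slin(3)[OF that] by simp
    then have "(x - x', 0) \<in> A" using Slin(1) S by blast
    then show ?thesis using injective by fastforce
  qed
  \<comment> \<open>A is onto and ends with an application of S, so S is onto and its inverse Q is
    defined everywhere.\<close>
  have "\<exists>x. (x, y) \<in> S" for y using S mem_iff[of "T y" y] by blast
  then obtain Q where "\<And>y. (Q y, y) \<in> S" by metis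
  then have Q: "(x, y) \<in> S \<longleftrightarrow> x = Q y" for x y using uniq by blast
  have QQ: "Q (Q x) = T x" for x
    using S Q mem_iff by (metis relcomp.relcompI)
  have Q_cinner: "cinner (Q x) y = cinner x (Q y)" for x y
    using Q[of "Q x" x] Q[of "Q y" y] S selfadjoint_iff[of cinner S "Q x" x] by blast
  have Q_inner: "inner (Q x) y = inner x (Q y)" for x y
    using Q_cinner[of x y] by (simp flip: Re_cinner)
  obtain b where b: "b > 0" "\<And>x. norm (T x) \<le> b * norm x" by (rule T.bound_obtain) blast
  have "positive_op Q"
  proof
    show "Q (x + y) = Q x + Q y" for x y using Slin(2) Q by metis
    show "Q (r *\<^sub>R x) = r *\<^sub>R Q x" for r x using Slin(4)[of "Q x" x "complex_of_real r"] Q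
      by (simp add: scaleC_of_real)
    have "norm (Q x) \<le> norm x * sqrt b" for x
    proof (rule power2_le_imp_le)
      have "(norm (Q x))\<^sup>2 = inner (T x) x"
        by (simp add: power2_norm_eq_inner QQ Q_inner[of x "Q x"] inner_commute)
      also have "\<dots> \<le> norm (T x) * norm x" by (rule norm_cauchy_schwarz)
      also have "\<dots> \<le> (b * norm x) * norm x" by (intro mult_right_mono b) simp
      finally show "(norm (Q x))\<^sup>2 \<le> (norm x * sqrt b)\<^sup>2" using b(1)
        by (simp add: power_mult_distrib) (simp add: power2_eq_square mult_ac)
    qed (use b in simp)
    then show "\<exists>K. \<forall>x. norm (Q x) \<le> norm x * K" by blast
    show "inner (Q x) y = inner x (Q y)" for x y by (rule Q_inner)
    show "0 \<le> inner (Q x) x" for x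
      using S Q[of "Q x" x] unfolding nonnegative_op_def by (auto simp: Re_cinner)
  qed
  then have "Q = R"
    by (rule T.sqrt_unique) (auto simp: QQ RR R.positive_op_axioms T_inj)
  then show "S = {(R y, y) | y. True}" using Q by auto
qed

lemma half_power_eq:
  "half_power A 1 = {(R y, y) | y. True}"
  "half_power A 2 = {(T y, y) | y. True}"
  "half_power A 3 = {(R (T y), y) | y. True}"
  unfolding half_power_def op_sqrt_eq numeral_2_eq_2 numeral_3_eq_3
  by (auto simp: RR R_T) (auto simp: relcomp.simps simp flip: RR)

lemma op_app_half_power:
  "op_app (half_power A 1) (R f) = f"
  "op_app (half_power A 2) (T f) = f"
  "op_app (half_power A 3) (R (T f)) = f"
proof -
  show "op_app (half_power A 1) (R f) = f"
    unfolding half_power_eq by (rule op_app_graph[OF R_inj R.diff])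
  show "op_app (half_power A 2) (T f) = f"
    unfolding half_power_eq by (rule op_app_graph[OF T_inj T.diff])
  show "op_app (half_power A 3) (R (T f)) = f"
    unfolding half_power_eq
  proof (rule op_app_graph)
    show "y = 0" if "R (T y) = 0" for y using T_inj[OF R_inj[OF that]] .
    show "R (T (x - y)) = R (T x) - R (T y)" for x y by (simp add: T.diff R.diff)
  qed
qed

lemma H_norm_T: "H_norm A 1 (T f) = norm (R f)" "H_norm A 2 (T f) = norm f"
  using op_app_half_power(1)[of "R f"] op_app_half_power(2)[of f] by (simp_all add: H_norm_def RR)

lemma H_inner_T: "H_inner A 1 (T f) (T h) = cinner f (T h)" "H_inner A 2 (T f) (T h) = cinner f h"
  using op_app_half_power(1)[of "R f"] op_app_half_power(1)[of "R h"]
    op_app_half_power(2)[of f] op_app_half_power(2)[of h]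
  by (simp_all add: H_inner_def RR R_cinner)

lemma eigenspace_iff: "c \<noteq> 0 \<Longrightarrow> x \<in> eigenspace A (complex_of_real c) \<longleftrightarrow> T x = (1 / c) *\<^sub>R x"
proof -
  assume c: "c \<noteq> 0"
  have "x \<in> eigenspace A (complex_of_real c) \<longleftrightarrow> x = c *\<^sub>R T x"
    by (simp add: eigenspace_def mem_iff scaleC_of_real T.scale)
  also have "\<dots> \<longleftrightarrow> T x = (1 / c) *\<^sub>R x"
  proof
    assume "x = c *\<^sub>R T x"
    then have "(1 / c) *\<^sub>R x = (1 / c) *\<^sub>R (c *\<^sub>R T x)" by (rule arg_cong)
    then show "T x = (1 / c) *\<^sub>R x" using c by simp
  qed (use c in simp)
  finally show ?thesis .
qed

text \<open>Inversion takes the parameter s of A to 1/s for T, through z - s T z = -s (T - 1/s) z.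
  The resolvent bound controls T z, and z is recovered from z = (z - s T z) + s T z.\<close>

lemma regular_if_notin_spectrum:
  assumes s: "s \<noteq> 0" "complex_of_real s \<notin> op_spectrum A"
  shows "\<exists>k>0. \<forall>x. k * norm x \<le> norm (T x - (1 / s) *\<^sub>R x)"
proof -
  obtain C where "\<forall>(x, y)\<in>op_shift A (complex_of_real s). norm x \<le> C * norm y"
    using s(2) unfolding op_spectrum_def by blast
  moreover have "(T z, z - s *\<^sub>R T z) \<in> op_shift A (complex_of_real s)" for z
    using mem_iff[of "T z" z] unfolding op_shift_def by (force simp: scaleC_of_real)
  ultimately have C: "norm (T z) \<le> C * norm (z - s *\<^sub>R T z)" for z by blast
  define k where "k = \<bar>s\<bar> * (1 + \<bar>C\<bar> * \<bar>s\<bar>)"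
  have k: "k > 0" using s(1) by (simp add: k_def add_pos_nonneg)
  have "norm z \<le> k * norm (T z - (1 / s) *\<^sub>R z)" for z
  proof -
    let ?d = "T z - (1 / s) *\<^sub>R z"
    have "z - s *\<^sub>R T z = (- s) *\<^sub>R ?d" using s(1) by (simp add: algebra_simps)
    then have n: "norm (z - s *\<^sub>R T z) = \<bar>s\<bar> * norm ?d" by (simp only: norm_scaleR abs_minus_cancel)
    have "norm (T z) \<le> \<bar>C\<bar> * norm (z - s *\<^sub>R T z)"
      by (rule order_trans[OF C]) (simp add: mult_right_mono)
    then have T: "norm (T z) \<le> \<bar>C\<bar> * (\<bar>s\<bar> * norm ?d)" unfolding n .
    have "norm z = norm ((z - s *\<^sub>R T z) + s *\<^sub>R T z)" by simp
    also have "\<dots> \<le> \<bar>s\<bar> * norm ?d + \<bar>s\<bar> * norm (T z)"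
      using norm_triangle_ineq[of "z - s *\<^sub>R T z" "s *\<^sub>R T z"] unfolding n by simp
    also have "\<dots> \<le> \<bar>s\<bar> * norm ?d + \<bar>s\<bar> * (\<bar>C\<bar> * (\<bar>s\<bar> * norm ?d))"
      using T by (simp add: mult_left_mono)
    also have "\<dots> = k * norm ?d" by (simp add: k_def algebra_simps)
    finally show ?thesis .
  qed
  then show ?thesis using k by (intro exI[of _ "1 / k"]) (simp add: field_simps)
qed

text \<open>Below the essential spectrum \<open>t\<close> is either regular or isolated in the spectrum.\<close>

lemma eigenspace_gap:
  assumes t: "0 < t" "ereal t < lambda_inf A"
  obtains e where "e > 0" "\<And>z. (\<And>y. T y = (1 / t) *\<^sub>R y \<Longrightarrow> inner y z = 0) \<Longrightarrow>
    e * norm z \<le> norm (T z - (1 / t) *\<^sub>R z)"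
proof (cases "complex_of_real t \<in> op_spectrum A")
  case False
  with that regular_if_notin_spectrum[of t] t(1) show ?thesis by blast
next
  case True
  have "complex_of_real t \<notin> ess_spectrum A"
  proof
    assume "complex_of_real t \<in> ess_spectrum A"
    then have "lambda_inf A \<le> ereal t" unfolding lambda_inf_def by (intro Inf_lower) auto
    with t(2) show False by simp
  qed
  with True have "complex_of_real t isolated_in op_spectrum A" unfolding ess_spectrum_def by blast
  then obtain V where V: "open V" "V \<inter> op_spectrum A = {complex_of_real t}"
    unfolding isolated_in_def by blast
  then obtain d where d: "d > 0" "ball (complex_of_real t) d \<subseteq> V"
    by (metis Int_iff insertI1 open_contains_ball)
  have "isCont (\<lambda>s::real. 1 / s) (1 / t)" using t(1) by (intro continuous_intros) auto
  then obtain e1 where e1: "e1 > 0" "\<And>s. \<bar>s - 1 / t\<bar> < e1 \<Longrightarrow> \<bar>1 / s - t\<bar> < d"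
    using d(1) unfolding isCont_def LIM_def dist_real_def
    by (metis (no_types, lifting) d(1) divide_divide_eq_right div_by_1 mult_1 abs_zero diff_self)
  \<comment> \<open>The second entry keeps s positive, so that 1/s stays meaningful and
    nonzero.\<close>
  define e where "e = min e1 (1 / t)"
  have "e > 0" using e1(1) t(1) by (simp add: e_def)
  moreover have "e * norm z \<le> norm (T z - (1 / t) *\<^sub>R z)"
    if z: "\<And>y. T y = (1 / t) *\<^sub>R y \<Longrightarrow> inner y z = 0" for z
  proof (rule T.isolated_gap[OF \<open>e > 0\<close> _ z])
    fix s assume s: "\<bar>s - 1 / t\<bar> < e" "s \<noteq> 1 / t"
    then have s0: "s > 0" by (auto simp: e_def abs_if split: if_splits)
    have "\<bar>1 / s - t\<bar> < d" using e1(2) s(1) by (simp add: e_def)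
    then have "cmod (complex_of_real t - complex_of_real (1 / s)) < d"
      by (metis abs_minus_commute norm_of_real of_real_diff)
    then have "complex_of_real (1 / s) \<in> V"
      using d(2) by (auto simp: dist_norm)
    moreover have "1 / s \<noteq> t" using s(2) s0 by auto
    ultimately have "complex_of_real (1 / s) \<notin> op_spectrum A" using V(2)
      by (metis Int_iff of_real_eq_iff singletonD)
    from regular_if_notin_spectrum[OF _ this] s0
    show "\<exists>k>0. \<forall>x. k * norm x \<le> norm (T x - s *\<^sub>R x)" by simp
  qed
  ultimately show ?thesis by (rule that)
qed

end

section \<open>Rayleigh quotients below the essential spectrum\<close>

locale pd_op_eigen = pd_op A for A :: "'h::complex_hilbert operator" +
  fixes N :: enat and lam :: "nat \<Rightarrow> real" and u :: "nat \<Rightarrow> 'h"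
  assumes eigenpairs: "lower_eigenpairs A N lam u"
begin

abbreviation "I \<equiv> {k. 1 \<le> k \<and> enat k \<le> N}"

lemma lam_mono: "mono_on I lam"
  and lam_pos: "k \<in> I \<Longrightarrow> 0 < lam k"
  and lam_less: "k \<in> I \<Longrightarrow> ereal (lam k) < lambda_inf A"
  and u_orthonormal: "orthonormal_on cinner I u"
  and complete: "ereal t < lambda_inf A \<Longrightarrow>
    eigenspace A (complex_of_real t) \<subseteq> cspan {u k | k. k \<in> I \<and> lam k = t}"
  using eigenpairs unfolding lower_eigenpairs_def Let_def by blast+

lemma T_u: "k \<in> I \<Longrightarrow> T (u k) = (1 / lam k) *\<^sub>R u k"
proof -
  assume k: "k \<in> I"
  then have "u k \<in> eigenspace A (complex_of_real (lam k))"
    using eigenpairs unfolding lower_eigenpairs_def Let_def eigenspace_def by blast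
  with eigenspace_iff lam_pos[OF k] show ?thesis by simp
qed

lemma subspace_orthogonal: "subspace {x. \<forall>i\<in>J. cinner (u i) x = 0}"
  by (rule subspaceI)
    (auto simp: cinner.add_right cinner.scaleC_right simp flip: scaleC_of_real)

lemma orthogonal_eigenspace:
  assumes t: "ereal t < lambda_inf A" "0 < t" and T: "T y = (1 / t) *\<^sub>R y"
    and x: "\<And>i. i \<in> I \<Longrightarrow> lam i = t \<Longrightarrow> cinner (u i) x = 0"
  shows "inner y x = 0"
proof -
  have "y \<in> cspan {u k | k. k \<in> I \<and> lam k = t}" using complete[OF t(1)] t(2) T eigenspace_iff by auto
  then have "cinner y x = 0"
    by (induction rule: complex_vector.span_induct_alt)
      (auto simp: cinner.add_left cinner.scaleC_left x)
  then show ?thesis by (simp flip: Re_cinner)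
qed

lemma I_downward: "j \<in> I \<Longrightarrow> 1 \<le> i \<Longrightarrow> i \<le> j \<Longrightarrow> i \<in> I"
  by (auto intro: order_trans[of "enat i" "enat j"])

text \<open>The complement of the lower eigenvectors is invariant under T, and there the form of
  \<beta> - T is nonnegative; \<open>nonneg_norm_le\<close> converts a lower bound for the norm of
  (\<beta> - T) x into one for the form. It is applied with a hypothetical supremum \<beta> as well
  as with \<beta> = \<open>1 / lam j\<close>.\<close>

lemma coercive_if_bounded_below:
  assumes j: "j \<in> I"
    and le: "\<And>x. (\<And>i. 1 \<le> i \<Longrightarrow> i < j \<Longrightarrow> cinner (u i) x = 0) \<Longrightarrow> inner (T x) x \<le> \<beta> * (norm x)\<^sup>2"
  obtains d where "d > 0" "\<And>x e. (\<And>i. 1 \<le> i \<Longrightarrow> i < j \<Longrightarrow> cinner (u i) x = 0) \<Longrightarrow> 0 \<le> e \<Longrightarrow>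
    e * norm x \<le> norm (T x - \<beta> *\<^sub>R x) \<Longrightarrow> (e * norm x)\<^sup>2 \<le> d * (\<beta> * (norm x)\<^sup>2 - inner (T x) x)"
proof -
  define D where "D x = \<beta> *\<^sub>R x - T x" for x
  interpret D: symmetric_op D
    unfolding D_def
    by (intro symmetric_op.intro bounded_linear_sub T.bounded_linear bounded_linear_scaleR_right)
      (simp add: inner_diff_left inner_diff_right T.symmetric)
  obtain d where d: "d > 0" "\<And>x. norm (D x) \<le> d * norm x" by (rule D.bound_obtain) blast
  define W where "W = {x. \<forall>i\<in>{i. 1 \<le> i \<and> i < j}. cinner (u i) x = 0}"
  have subW: "subspace W" unfolding W_def by (rule subspace_orthogonal)
  have TW: "T z \<in> W" if "z \<in> W" for z
    using that I_downward[OF j]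
    by (auto simp: W_def T_u cinner.scaleC_left simp flip: T_cinner scaleC_of_real)
  have "(e * norm x)\<^sup>2 \<le> d * (\<beta> * (norm x)\<^sup>2 - inner (T x) x)"
    if x: "\<And>i. 1 \<le> i \<Longrightarrow> i < j \<Longrightarrow> cinner (u i) x = 0" and e: "0 \<le> e" "e * norm x \<le> norm (T x - \<beta> *\<^sub>R x)"
    for x e
  proof -
    have "(e * norm x)\<^sup>2 \<le> (norm (D x))\<^sup>2"
      using e by (intro power_mono) (auto simp: D_def norm_minus_commute)
    also have "\<dots> \<le> d * inner (D x) x"
    proof (rule D.nonneg_norm_le[OF subW _ _ d(2,1)])
      show "D y \<in> W" if "y \<in> W" for y
        unfolding D_def using TW[OF that] that subW by (intro subspace_diff subspace_scale)
      show "0 \<le> inner (D y) y" if "y \<in> W" for y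
        using le[of y] that by (simp add: D_def inner_diff_left power2_norm_eq_inner W_def)
      show "x \<in> W" using x by (simp add: W_def)
    qed
    finally show ?thesis by (simp add: D_def inner_diff_left power2_norm_eq_inner)
  qed
  with d(1) that show ?thesis by blast
qed

text \<open>If the supremum \<beta> of the quotient on the complement exceeded
  \<open>1 / lam j\<close>, then t = 1/\<beta> would lie below \<open>lam j\<close>. Eigenvectors
  for t are combinations of u_1, ..., u_(j-1), so the complement sees a gap at \<beta>, and
  coercivity would push the supremum strictly below \<beta>.\<close>

lemma rayleigh_le:
  assumes j: "j \<in> I" and x: "\<And>i. 1 \<le> i \<Longrightarrow> i < j \<Longrightarrow> cinner (u i) x = 0"
  shows "inner (T x) x \<le> (1 / lam j) * (norm x)\<^sup>2"
proof (rule ccontr)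
  assume "\<not> ?thesis"
  then have bad: "(1 / lam j) * (norm x)\<^sup>2 < inner (T x) x" by simp
  then have x0: "x \<noteq> 0" by auto
  define W where "W = {x. \<forall>i\<in>{i. 1 \<le> i \<and> i < j}. cinner (u i) x = 0}"
  have xW: "x \<in> W" using x by (simp add: W_def)
  obtain b where b: "b > 0" "\<And>x. norm (T x) \<le> b * norm x" by (rule T.bound_obtain) blast
  define S where "S = {inner (T z) z / (norm z)\<^sup>2 | z. z \<in> W \<and> z \<noteq> 0}"
  have S_bdd: "bdd_above S"
  proof (rule bdd_aboveI[of _ b])
    fix s assume "s \<in> S"
    then obtain z where z: "s = inner (T z) z / (norm z)\<^sup>2" "z \<noteq> 0" by (auto simp: S_def)
    have "inner (T z) z \<le> norm (T z) * norm z" by (rule norm_cauchy_schwarz)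
    also have "\<dots> \<le> (b * norm z) * norm z" by (intro mult_right_mono b) simp
    finally show "s \<le> b" using z by (simp add: pos_divide_le_eq power2_eq_square mult.assoc)
  qed
  define \<beta> where "\<beta> = Sup S"
  have le_\<beta>: "inner (T z) z \<le> \<beta> * (norm z)\<^sup>2" if "z \<in> W" for z
  proof (cases "z = 0")
    case False
    then have "inner (T z) z / (norm z)\<^sup>2 \<le> \<beta>"
      unfolding \<beta>_def using that S_bdd by (intro cSup_upper) (auto simp: S_def)
    with False show ?thesis by (simp add: field_simps)
  qed simp
  have "1 / lam j < inner (T x) x / (norm x)\<^sup>2" using bad x0 by (simp add: field_simps)
  also have "\<dots> \<le> \<beta>" using le_\<beta>[OF xW] x0 by (simp add: field_simps)
  finally have \<beta>: "1 / lam j < \<beta>" .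
  have lj: "0 < lam j" "ereal (lam j) < lambda_inf A" using lam_pos lam_less j by auto
  then have \<beta>0: "0 < \<beta>" using \<beta> by (meson divide_pos_pos less_trans zero_less_one)
  define t where "t = 1 / \<beta>"
  have t: "0 < t" "t < lam j" using \<beta> \<beta>0 lj by (auto simp: t_def field_simps)
  then have "ereal t < lambda_inf A" using lj by (meson ereal_less(2) less_ereal.simps(1) less_trans)
  note t = t this
  obtain e where e: "e > 0" "\<And>z. (\<And>y. T y = (1 / t) *\<^sub>R y \<Longrightarrow> inner y z = 0) \<Longrightarrow>
    e * norm z \<le> norm (T z - (1 / t) *\<^sub>R z)"
    using eigenspace_gap[OF t(1,3)] by blast
  have e_le: "e * norm z \<le> norm (T z - \<beta> *\<^sub>R z)" if z: "z \<in> W" for z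
  proof -
    have "inner y z = 0" if "T y = (1 / t) *\<^sub>R y" for y
    proof (rule orthogonal_eigenspace[OF t(3,1) that])
      fix i assume i: "i \<in> I" "lam i = t"
      have "i < j"
      proof (rule ccontr)
        assume "\<not> i < j"
        then have "lam j \<le> lam i" using mono_onD[OF lam_mono j i(1)] by simp
        with i t show False by simp
      qed
      with i z show "cinner (u i) z = 0" by (auto simp: W_def)
    qed
    from e(2)[OF this] show ?thesis by (simp add: t_def)
  qed
  obtain d where d: "d > 0" "\<And>x e. (\<And>i. 1 \<le> i \<Longrightarrow> i < j \<Longrightarrow> cinner (u i) x = 0) \<Longrightarrow> 0 \<le> e \<Longrightarrow>
    e * norm x \<le> norm (T x - \<beta> *\<^sub>R x) \<Longrightarrow> (e * norm x)\<^sup>2 \<le> d * (\<beta> * (norm x)\<^sup>2 - inner (T x) x)"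
    by (rule coercive_if_bounded_below[OF j, of \<beta>]) (use le_\<beta> in \<open>auto simp: W_def\<close>)
  have "inner (T z) z \<le> (\<beta> - e\<^sup>2 / d) * (norm z)\<^sup>2" if z: "z \<in> W" for z
    using d(2)[OF _ less_imp_le[OF e(1)] e_le[OF z]] z d(1)
    by (simp add: W_def power_mult_distrib field_simps)
  then have "s \<le> \<beta> - e\<^sup>2 / d" if "s \<in> S" for s
    using that by (auto simp: S_def field_simps)
  then have "\<beta> \<le> \<beta> - e\<^sup>2 / d" unfolding \<beta>_def using xW x0
    by (intro cSup_least) (auto simp: S_def)
  moreover have "e\<^sup>2 / d > 0" using e(1) d(1) by simp
  ultimately show False by linarith
qed

end

section \<open>Comparison of the norms of \<open>A\<close> and \<open>M\<close>\<close>

lemma sum_geometric_le: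
  fixes r :: real
  assumes "0 \<le> r" "r < 1"
  shows "(\<Sum>i<n. r ^ i) \<le> 1 / (1 - r)"
  using assms by (simp add: sum_gp_strict divide_right_mono)

text \<open>Schur test for the kernel r^|m - n|: the truncated subtractions add up to the absolute
  difference, and each row is dominated by two geometric series.\<close>

lemma sum_decay_le:
  fixes r :: real and \<beta> :: "nat \<Rightarrow> real"
  assumes r: "0 \<le> r" "r < 1"
  shows "(\<Sum>m<K. \<Sum>n<K. r ^ ((m - n) + (n - m)) * (\<beta> m * \<beta> n)) \<le> 2 / (1 - r) * (\<Sum>m<K. (\<beta> m)\<^sup>2)"
proof -
  have row: "(\<Sum>n<K. r ^ ((m - n) + (n - m))) \<le> 2 / (1 - r)" for m
  proof -
    have "(\<Sum>n<K. r ^ ((m - n) + (n - m))) \<le> (\<Sum>n\<in>{..<Suc m} \<union> {m..<m + K}. r ^ ((m - n) + (n - m)))"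
      by (rule sum_mono2) (use r in auto)
    also have "\<dots> \<le> (\<Sum>n<Suc m. r ^ ((m - n) + (n - m))) + (\<Sum>n\<in>{m..<m + K}. r ^ ((m - n) + (n - m)))"
      using sum_Un[of "{..<Suc m}" "{m..<m + K}" "\<lambda>n. r ^ ((m - n) + (n - m))"] r
      by (simp add: sum_nonneg)
    also have "(\<Sum>n<Suc m. r ^ ((m - n) + (n - m))) = (\<Sum>i<Suc m. r ^ i)"
      by (rule sum.reindex_bij_witness[of _ "\<lambda>i. m - i" "\<lambda>i. m - i"]) auto
    also have "(\<Sum>n\<in>{m..<m + K}. r ^ ((m - n) + (n - m))) = (\<Sum>i<K. r ^ i)"
      by (rule sum.reindex_bij_witness[of _ "\<lambda>i. m + i" "\<lambda>i. i - m"]) auto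
    also have "(\<Sum>i<Suc m. r ^ i) + (\<Sum>i<K. r ^ i) \<le> 1 / (1 - r) + 1 / (1 - r)"
      by (intro add_mono sum_geometric_le r)
    finally show ?thesis by simp
  qed
  have swap: "(\<Sum>m<K. \<Sum>n<K. r ^ ((m - n) + (n - m)) * (\<beta> n)\<^sup>2)
      = (\<Sum>m<K. \<Sum>n<K. r ^ ((m - n) + (n - m)) * (\<beta> m)\<^sup>2)"
    by (subst sum.swap) (simp add: add.commute)
  have "(\<Sum>m<K. \<Sum>n<K. r ^ ((m - n) + (n - m)) * (\<beta> m * \<beta> n))
      \<le> (\<Sum>m<K. \<Sum>n<K. r ^ ((m - n) + (n - m)) * (((\<beta> m)\<^sup>2 + (\<beta> n)\<^sup>2) / 2))"
  proof (intro sum_mono mult_left_mono)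
    show "\<beta> m * \<beta> n \<le> ((\<beta> m)\<^sup>2 + (\<beta> n)\<^sup>2) / 2" for m n
      using sum_squares_bound[of "\<beta> m" "\<beta> n"] by simp
  qed (use r in simp)
  also have "\<dots> = ((\<Sum>m<K. \<Sum>n<K. r ^ ((m - n) + (n - m)) * (\<beta> m)\<^sup>2)
      + (\<Sum>m<K. \<Sum>n<K. r ^ ((m - n) + (n - m)) * (\<beta> n)\<^sup>2)) / 2"
    by (simp add: sum.distrib sum_divide_distrib distrib_left add_divide_distrib)
  also have "\<dots> = (\<Sum>m<K. (\<Sum>n<K. r ^ ((m - n) + (n - m))) * (\<beta> m)\<^sup>2)"
    unfolding swap by (simp add: sum_distrib_right)
  also have "\<dots> \<le> (\<Sum>m<K. 2 / (1 - r) * (\<beta> m)\<^sup>2)"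
    by (intro sum_mono mult_right_mono row) simp
  finally show ?thesis by (simp add: sum_distrib_left)
qed

context pd_op
begin

text \<open>Logarithmic convexity of powers: with x = A^(-3/2) h it reads |A^(1/2) x|^3 <= |x|^2
  |A^(3/2) x|. Cauchy-Schwarz is used twice, for the pair R T h, R h and for the pair h, T
  h.\<close>

lemma moment_inequality: "norm (T h) ^ 3 \<le> (norm (R (T h)))\<^sup>2 * norm h"
proof (cases "T h = 0")
  case False
  have "(norm (T h))\<^sup>2 = inner (R (T h)) (R h)"
    by (simp add: power2_norm_eq_inner R.symmetric RR)
  also have "\<dots> \<le> norm (R (T h)) * norm (R h)" by (rule norm_cauchy_schwarz)
  finally have "((norm (T h))\<^sup>2)\<^sup>2 \<le> (norm (R (T h)) * norm (R h))\<^sup>2" by (rule power_mono) simp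
  also have "\<dots> = (norm (R (T h)))\<^sup>2 * inner h (T h)" by (simp add: power_mult_distrib norm_R_sq)
  also have "\<dots> \<le> (norm (R (T h)))\<^sup>2 * (norm h * norm (T h))"
    by (intro mult_left_mono norm_cauchy_schwarz) simp
  finally have "norm (T h) * norm (T h) ^ 3 \<le> norm (T h) * ((norm (R (T h)))\<^sup>2 * norm h)"
    by (simp add: power2_eq_square power3_eq_cube mult_ac)
  with False show ?thesis by simp
qed simp

end

locale comparison = pd_op A + ip g
  for A :: "'h::complex_hilbert operator" and g :: "'h \<Rightarrow> 'h \<Rightarrow> complex" +
  fixes mu :: "nat \<Rightarrow> real" and q :: "nat \<Rightarrow> 'h"
  assumes equiv_g: "equivalent_norms_on UNIV norm (ip_norm g)"
    and mu_mono: "mono_on {1..} mu" and mu_1: "0 < mu 1"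
    and q: "orthonormal_on g {1..} q"
    and same_domain: "Domain (half_power A 3) = Domain (eigen_power g mu q (3/2))"
    and equiv_norms: "equivalent_norms_on (Domain (half_power A 3))
      (\<lambda>v. ip_norm g (op_app (eigen_power g mu q (3/2)) v)) (\<lambda>v. norm (op_app (half_power A 3) v))"
begin

lemma norm_bound:
  obtains C where "C > 0" "\<And>x. norm x \<le> C * ip_norm g x" "\<And>x. ip_norm g x \<le> C * norm x"
proof -
  obtain c C where c: "c > 0" "C > 0" "\<And>x. c * norm x \<le> ip_norm g x" "\<And>x. ip_norm g x \<le> C * norm x"
    using equiv_g unfolding equivalent_norms_on_def by auto
  have "norm x \<le> max (1 / c) C * ip_norm g x" for x
  proof -
    have "norm x \<le> 1 / c * ip_norm g x" using c(1) c(3)[of x] by (simp add: field_simps)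
    also have "\<dots> \<le> max (1 / c) C * ip_norm g x" by (rule mult_right_mono) (auto simp: norm_nonneg)
    finally show ?thesis .
  qed
  moreover have "ip_norm g x \<le> max (1 / c) C * norm x" for x
    by (rule order_trans[OF c(4)]) (simp add: mult_right_mono)
  ultimately show ?thesis using that[of "max (1 / c) C"] c(2) by auto
qed

text \<open>The square of |M x| in the norm of g, for x with coefficients c on F.\<close>

abbreviation msum :: "nat set \<Rightarrow> (nat \<Rightarrow> complex) \<Rightarrow> real" where
  "msum F c \<equiv> \<Sum>k\<in>F. (mu k)\<^sup>2 * (cmod (c k))\<^sup>2"

lemma bounded_linear_coeff: "k \<ge> 1 \<Longrightarrow> bounded_linear (\<lambda>x. g (q k) x)"
proof -
  assume k: "k \<ge> 1"
  obtain C where C: "C > 0" "\<And>x. ip_norm g x \<le> C * norm x" by (rule norm_bound) blast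
  show ?thesis
  proof (rule bounded_linear_intro[of _ C])
    show "g (q k) (x + y) = g (q k) x + g (q k) y" for x y by (rule add_right)
    show "g (q k) (r *\<^sub>R x) = r *\<^sub>R g (q k) x" for r x
      using scaleC_right[of "q k" "complex_of_real r" x] by (simp add: scaleC_of_real scaleR_conv_of_real)
    show "norm (g (q k) x) \<le> norm x * C" for x
      using orthonormal_cmod_le[OF q, of k x] C(2)[of x] k by (simp add: mult.commute)
  qed
qed

lemma mu_le: "1 \<le> k \<Longrightarrow> k \<le> m \<Longrightarrow> mu k \<le> mu m"
  using mu_mono by (auto simp: mono_on_def)

lemma mu_pos: "1 \<le> k \<Longrightarrow> 0 < mu k"
  using mu_le[of 1 k] mu_1 by simp

lemma eigen_power_coeff:
  assumes "(x, y) \<in> eigen_power g mu q s" "k \<ge> 1"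
  shows "g (q k) y = complex_of_real (mu k powr s) * g (q k) x"
proof -
  let ?a = "\<lambda>k. complex_of_real (mu k powr s) * g (q k) x"
  have "((\<lambda>j. ?a j *\<^sub>C q j) has_sum y) {1..}" using assms(1) by (simp add: eigen_power_def)
  then have "((\<lambda>j. g (q k) (?a j *\<^sub>C q j)) has_sum g (q k) y) {1..}"
    by (rule has_sum_bounded_linear[OF bounded_linear_coeff[OF assms(2)]])
  moreover have "((\<lambda>j. g (q k) (?a j *\<^sub>C q j)) has_sum ?a k) {1..}"
  proof -
    have "((\<lambda>j. g (q k) (?a j *\<^sub>C q j)) has_sum (\<Sum>j\<in>{k}. g (q k) (?a j *\<^sub>C q j))) {k}"
      by (rule has_sum_finite) simp
    then have "((\<lambda>j. g (q k) (?a j *\<^sub>C q j)) has_sum ?a k) {k}"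
      using q assms(2) by (simp add: scaleC_right orthonormal_on_def)
    then show ?thesis
      by (rule has_sum_cong_neutral[THEN iffD1, rotated -1])
        (use q assms(2) in \<open>auto simp: scaleC_right orthonormal_on_def\<close>)
  qed
  ultimately show ?thesis by (rule has_sum_unique)
qed

lemma op_app_eigen_power: "(x, y) \<in> eigen_power g mu q s \<Longrightarrow> op_app (eigen_power g mu q s) x = y"
  unfolding op_app_def eigen_power_def by (auto intro: has_sum_unique)

lemma eigen_power_finite:
  assumes F: "finite F" "F \<subseteq> {1..}"
  shows "((\<Sum>k\<in>F. c k *\<^sub>C q k), (\<Sum>k\<in>F. (complex_of_real (mu k powr s) * c k) *\<^sub>C q k))
    \<in> eigen_power g mu q s"
proof -
  let ?x = "\<Sum>k\<in>F. c k *\<^sub>C q k"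
  let ?f = "\<lambda>k. (complex_of_real (mu k powr s) * g (q k) ?x) *\<^sub>C q k"
  have coeff: "g (q k) ?x = (if k \<in> F then c k else 0)" if "k \<ge> 1" for k
    using orthonormal_coeff[OF q F] that by simp
  have "(?f has_sum (\<Sum>k\<in>F. ?f k)) F" by (rule has_sum_finite[OF F(1)])
  then have "(?f has_sum (\<Sum>k\<in>F. ?f k)) {1..}"
    by (rule has_sum_cong_neutral[THEN iffD1, rotated -1]) (use F coeff in auto)
  moreover have "(\<Sum>k\<in>F. ?f k) = (\<Sum>k\<in>F. (complex_of_real (mu k powr s) * c k) *\<^sub>C q k)"
    by (rule sum.cong) (use F coeff in auto)
  ultimately show ?thesis by (simp add: eigen_power_def)
qed

text \<open>\<open>R (T h)\<close> is A^(-3/2) h, so h stands for A^(3/2) x; the two halves are the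
  two directions of the norm equivalence.\<close>

lemma preimage_bound:
  obtains C where "C > 0" "\<And>x y. (x, y) \<in> eigen_power g mu q (3/2) \<Longrightarrow>
    \<exists>h. x = R (T h) \<and> norm h \<le> C * ip_norm g y"
    "\<And>h. \<exists>y. (R (T h), y) \<in> eigen_power g mu q (3/2) \<and> ip_norm g y \<le> C * norm h"
proof -
  obtain c C where c: "c > 0" "C > 0" "\<And>x. x \<in> Domain (half_power A 3) \<Longrightarrow>
      c * ip_norm g (op_app (eigen_power g mu q (3/2)) x) \<le> norm (op_app (half_power A 3) x) \<and>
      norm (op_app (half_power A 3) x) \<le> C * ip_norm g (op_app (eigen_power g mu q (3/2)) x)"
    using equiv_norms unfolding equivalent_norms_on_def by auto
  define K where "K = max C (1 / c)"
  have "\<exists>h. x = R (T h) \<and> norm h \<le> K * ip_norm g y" if xy: "(x, y) \<in> eigen_power g mu q (3/2)" for x y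
  proof -
    have dom: "x \<in> Domain (half_power A 3)" unfolding same_domain using xy by blast
    then obtain h where h: "x = R (T h)" unfolding half_power_eq by blast
    from c(3)[OF dom] have "norm h \<le> C * ip_norm g y"
      by (simp add: op_app_eigen_power[OF xy[unfolded h]] h op_app_half_power)
    also have "\<dots> \<le> K * ip_norm g y" by (intro mult_right_mono) (auto simp: K_def norm_nonneg)
    finally show ?thesis using h by blast
  qed
  moreover have "\<exists>y. (R (T h), y) \<in> eigen_power g mu q (3/2) \<and> ip_norm g y \<le> K * norm h" for h
  proof -
    have dom: "R (T h) \<in> Domain (half_power A 3)" unfolding half_power_eq by blast
    then obtain y where y: "(R (T h), y) \<in> eigen_power g mu q (3/2)" unfolding same_domain by blast
    from c(3)[OF dom] have "c * ip_norm g y \<le> norm h"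
      by (simp add: op_app_eigen_power[OF y] op_app_half_power)
    then have "ip_norm g y \<le> 1 / c * norm h" using c(1) by (simp add: field_simps)
    also have "\<dots> \<le> K * norm h" by (intro mult_right_mono) (auto simp: K_def)
    finally show ?thesis using y by blast
  qed
  ultimately show ?thesis using that[of K] c(2) by (auto simp: K_def)
qed

text \<open>Completeness of the q_k: if all coefficients vanish, the series for M^(3/2) x is zero,
  so (x, 0) lies in the graph, and the norm comparison forces A^(3/2) x = 0.\<close>

lemma coeff_zero:
  assumes "\<And>k. k \<ge> 1 \<Longrightarrow> g (q k) x = 0"
  shows "x = 0"
proof -
  obtain C where C: "C > 0" "\<And>x y. (x, y) \<in> eigen_power g mu q (3/2) \<Longrightarrow>
    \<exists>h. x = R (T h) \<and> norm h \<le> C * ip_norm g y" by (rule preimage_bound) blast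
  have "((\<lambda>k. (complex_of_real (mu k powr (3/2)) * g (q k) x) *\<^sub>C q k) has_sum 0) {1..}"
    by (rule has_sum_0) (simp add: assms)
  then have "(x, 0) \<in> eigen_power g mu q (3/2)" by (simp add: eigen_power_def)
  from C(2)[OF this] obtain h where "x = R (T h)" "norm h \<le> C * ip_norm g 0" by blast
  moreover have "ip_norm g 0 = 0" by (simp add: norm_zero_iff)
  ultimately show ?thesis by (simp add: T.zero R.zero)
qed

section \<open>Dyadic blocks and interpolation between powers\<close>

definition level :: "nat \<Rightarrow> nat" where "level k = nat \<lfloor>log 2 (mu k / mu 1)\<rfloor>"

lemma level:
  assumes "k \<ge> 1"
  shows "mu 1 * 2 ^ level k \<le> mu k" "mu k \<le> 2 * (mu 1 * 2 ^ level k)"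
proof -
  define x where "x = mu k / mu 1"
  have x: "1 \<le> x" using mu_le[of 1 k] assms mu_1 by (simp add: x_def)
  then have l: "0 \<le> \<lfloor>log 2 x\<rfloor>" by simp
  have p: "(2::real) ^ level k = 2 powr real_of_int \<lfloor>log 2 x\<rfloor>"
    using l unfolding level_def x_def[symmetric] by (simp flip: powr_realpow)
  have "2 powr real_of_int \<lfloor>log 2 x\<rfloor> \<le> 2 powr log 2 x" by (intro powr_mono) auto
  then have "2 ^ level k \<le> x" using x by (simp add: p)
  then show "mu 1 * 2 ^ level k \<le> mu k" using mu_1 by (simp add: x_def field_simps)
  have "2 powr log 2 x \<le> 2 powr (real_of_int \<lfloor>log 2 x\<rfloor> + 1)" by (intro powr_mono) linarith+
  then have "x \<le> 2 * 2 ^ level k" using x by (simp add: p powr_add)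
  then show "mu k \<le> 2 * (mu 1 * 2 ^ level k)" using mu_1 by (simp add: x_def field_simps)
qed

text \<open>On a block all \<open>mu k\<close> are comparable to s, so M^(3/2) and the identity
  differ from M by factors s^(1/2) and s^(-1). The first bounds |A^(3/2) x|, the second |x|, and the
  moment inequality interpolates to |A^(1/2) x| with factor s^(-1/2). Here h = A^(3/2) x and T h =
  A^(1/2) x.\<close>

lemma block_bounds:
  obtains C where "C > 0" "\<And>F c s. finite F \<Longrightarrow> F \<subseteq> {1..} \<Longrightarrow> s > 0 \<Longrightarrow>
      (\<And>k. k \<in> F \<Longrightarrow> s \<le> mu k \<and> mu k \<le> 2 * s) \<Longrightarrow>
      \<exists>h. R (T h) = (\<Sum>k\<in>F. c k *\<^sub>C q k) \<and>
        norm h \<le> C * sqrt s * sqrt (msum F c) \<and>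
        norm (T h) \<le> C / sqrt s * sqrt (msum F c)"
proof -
  obtain C0 where C0: "C0 > 0" "\<And>x. norm x \<le> C0 * ip_norm g x" by (rule norm_bound) blast
  obtain C1 where C1: "C1 > 0" "\<And>x y. (x, y) \<in> eigen_power g mu q (3/2) \<Longrightarrow>
    \<exists>h. x = R (T h) \<and> norm h \<le> C1 * ip_norm g y" by (rule preimage_bound) blast
  \<comment> \<open>\<open>C0\<close> compares the two base norms; sqrt 2 stems from
    \<open>mu k\<close> <= 2 s inside a block.\<close>
  define C where "C = max C0 (C1 * sqrt 2)"
  have C: "C > 0" "C0 \<le> C" "C1 * sqrt 2 \<le> C" using C0(1) by (auto simp: C_def)
  have "\<exists>h. R (T h) = (\<Sum>k\<in>F. c k *\<^sub>C q k) \<and>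
        norm h \<le> C * sqrt s * sqrt (msum F c) \<and>
        norm (T h) \<le> C / sqrt s * sqrt (msum F c)"
    if F: "finite F" "F \<subseteq> {1..}" and s: "s > 0" "\<And>k. k \<in> F \<Longrightarrow> s \<le> mu k \<and> mu k \<le> 2 * s" for F c s
  proof -
    let ?S = "msum F c"
    define \<beta> where "\<beta> = sqrt ?S"
    have S0: "0 \<le> ?S" by (intro sum_nonneg) simp
    have \<beta>: "0 \<le> \<beta>" "\<beta>\<^sup>2 = ?S" using S0 by (auto simp: \<beta>_def)
    let ?x = "\<Sum>k\<in>F. c k *\<^sub>C q k" and ?y = "\<Sum>k\<in>F. (complex_of_real (mu k powr (3/2)) * c k) *\<^sub>C q k"
    obtain h where h: "?x = R (T h)" "norm h \<le> C1 * ip_norm g ?y"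
      using C1(2)[OF eigen_power_finite[OF F]] by blast
    have "(ip_norm g ?y)\<^sup>2 = (\<Sum>k\<in>F. mu k * ((mu k)\<^sup>2 * (cmod (c k))\<^sup>2))"
      unfolding orthonormal_norm[OF q F]
    proof (rule sum.cong)
      fix k assume "k \<in> F"
      then have "mu k > 0" using F(2) mu_pos by auto
      then have "(mu k powr (3/2))\<^sup>2 = mu k ^ 3"
        by (simp add: power2_eq_square flip: powr_add)
      then show "(cmod (complex_of_real (mu k powr (3/2)) * c k))\<^sup>2 = mu k * ((mu k)\<^sup>2 * (cmod (c k))\<^sup>2)"
        by (simp add: norm_mult power_mult_distrib power3_eq_cube power2_eq_square)
    qed simp
    also have "\<dots> \<le> (\<Sum>k\<in>F. (2 * s) * ((mu k)\<^sup>2 * (cmod (c k))\<^sup>2))"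
      by (intro sum_mono mult_right_mono) (use s in auto)
    also have "\<dots> = (sqrt 2 * sqrt s * \<beta>)\<^sup>2"
      using s(1) by (simp add: sum_distrib_left power_mult_distrib \<beta>)
    finally have "ip_norm g ?y \<le> sqrt 2 * sqrt s * \<beta>"
      by (rule power2_le_imp_le) (use s \<beta> in auto)
    then have "norm h \<le> C1 * (sqrt 2 * sqrt s * \<beta>)" using h(2) C1(1)
      by (meson mult_left_mono less_imp_le order_trans)
    also have "\<dots> = (C1 * sqrt 2) * (sqrt s * \<beta>)" by simp
    also have "\<dots> \<le> C * (sqrt s * \<beta>)" using s(1) \<beta>(1) by (intro mult_right_mono C) auto
    finally have h_le: "norm h \<le> C * sqrt s * \<beta>" by simp
    have "(ip_norm g ?x)\<^sup>2 = (\<Sum>k\<in>F. (cmod (c k))\<^sup>2)" by (rule orthonormal_norm[OF q F])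
    also have "\<dots> \<le> (\<Sum>k\<in>F. ((mu k)\<^sup>2 * (cmod (c k))\<^sup>2) / s\<^sup>2)"
    proof (rule sum_mono)
      fix k assume "k \<in> F"
      then have "s\<^sup>2 \<le> (mu k)\<^sup>2" using s by (intro power_mono) auto
      then have "s\<^sup>2 * (cmod (c k))\<^sup>2 \<le> (mu k)\<^sup>2 * (cmod (c k))\<^sup>2" by (rule mult_right_mono) simp
      with s(1) show "(cmod (c k))\<^sup>2 \<le> ((mu k)\<^sup>2 * (cmod (c k))\<^sup>2) / s\<^sup>2" by (simp add: field_simps)
    qed
    also have "\<dots> = (\<beta> / s)\<^sup>2" by (simp add: power_divide \<beta> sum_divide_distrib)
    finally have "ip_norm g ?x \<le> \<beta> / s"
      by (rule power2_le_imp_le) (use s \<beta> in auto)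
    then have "norm ?x \<le> C0 * (\<beta> / s)" using C0 by (meson mult_left_mono less_imp_le order_trans)
    also have "\<dots> \<le> C * (\<beta> / s)" using s(1) \<beta>(1) by (intro mult_right_mono C) auto
    finally have x_le: "norm (R (T h)) \<le> C * (\<beta> / s)" unfolding h(1) .
    have "norm (T h) ^ 3 \<le> (norm (R (T h)))\<^sup>2 * norm h" by (rule moment_inequality)
    also have "\<dots> \<le> (C * (\<beta> / s))\<^sup>2 * (C * sqrt s * \<beta>)"
      by (intro mult_mono power_mono x_le h_le) auto
    also have "\<dots> = (C / sqrt s * \<beta>) ^ 3"
    proof -
      define w where "w = sqrt s"
      have w: "w > 0" "s = w\<^sup>2" using s(1) by (auto simp: w_def)
      show ?thesis unfolding w_def[symmetric] unfolding w(2) using w(1)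
        by (simp add: field_simps power2_eq_square power3_eq_cube)
    qed
    finally have "norm (T h) \<le> C / sqrt s * \<beta>"
      unfolding numeral_3_eq_3
      by (rule power_le_imp_le_base) (use C(1) s(1) \<beta>(1) in simp)
    with h_le h(1)[symmetric] show ?thesis unfolding \<beta>_def by (intro exI[of _ h] conjI)
  qed
  with C(1) that show ?thesis by blast
qed

text \<open>The case of the Heinz inequality that interpolates between the powers \<open>0\<close> and \<open>3/2\<close>.\<close>

lemma interpolation:
  obtains C where "C > 0" "\<And>F c. finite F \<Longrightarrow> F \<subseteq> {1..} \<Longrightarrow>
    \<exists>f. T f = (\<Sum>k\<in>F. c k *\<^sub>C q k) \<and> (norm f)\<^sup>2 \<le> C * (msum F c)"
proof -
  obtain C where C: "C > 0" "\<And>F c s. finite F \<Longrightarrow> F \<subseteq> {1..} \<Longrightarrow> s > 0 \<Longrightarrow>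
      (\<And>k. k \<in> F \<Longrightarrow> s \<le> mu k \<and> mu k \<le> 2 * s) \<Longrightarrow>
      \<exists>h. R (T h) = (\<Sum>k\<in>F. c k *\<^sub>C q k) \<and>
        norm h \<le> C * sqrt s * sqrt (msum F c) \<and>
        norm (T h) \<le> C / sqrt s * sqrt (msum F c)"
    by (rule block_bounds) blast
  \<comment> \<open>The ratio of 1 / sqrt s between neighbouring dyadic levels, hence the decay rate
    of the interaction of blocks.\<close>
  define r where "r = 1 / sqrt 2"
  have r: "0 \<le> r" "r < 1" by (auto simp: r_def)
  define D where "D = C\<^sup>2 * (2 / (1 - r))"
  have "D > 0" using C(1) r by (simp add: D_def)
  moreover have "\<exists>f. T f = (\<Sum>k\<in>F. c k *\<^sub>C q k) \<and> (norm f)\<^sup>2 \<le> D * (msum F c)"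
    if F: "finite F" "F \<subseteq> {1..}" for F c
  proof -
    define B where "B m = {k \<in> F. level k = m}" for m
    define s where "s m = mu 1 * 2 ^ m" for m :: nat
    define \<beta> where "\<beta> m = sqrt (\<Sum>k\<in>B m. (mu k)\<^sup>2 * (cmod (c k))\<^sup>2)" for m
    have s0: "s m > 0" for m using mu_1 by (simp add: s_def)
    have "\<exists>h. R (T h) = (\<Sum>k\<in>B m. c k *\<^sub>C q k) \<and>
        norm h \<le> C * sqrt (s m) * \<beta> m \<and> norm (T h) \<le> C / sqrt (s m) * \<beta> m" for m
      unfolding \<beta>_def
      by (rule C(2)) (use F s0 level in \<open>auto simp: B_def s_def\<close>)
    then obtain h where h: "\<And>m. R (T (h m)) = (\<Sum>k\<in>B m. c k *\<^sub>C q k)"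
      "\<And>m. norm (h m) \<le> C * sqrt (s m) * \<beta> m" "\<And>m. norm (T (h m)) \<le> C / sqrt (s m) * \<beta> m"
      by metis
    have \<beta>0: "0 \<le> \<beta> m" for m unfolding \<beta>_def by (intro real_sqrt_ge_zero sum_nonneg) simp
    \<comment> \<open>\<open>R (h m)\<close> is A applied to block m. Moving half a power of A
      across gives A^(3/2) on block m against A^(1/2) on block n; the higher power must fall on the
      lower level, so that sqrt (s m) / sqrt (s n) decays.\<close>
    have cross_le: "inner (R (h m)) (R (h n)) \<le> C\<^sup>2 * (r ^ (n - m) * (\<beta> m * \<beta> n))" if "m \<le> n" for m n
    proof -
      have "inner (R (h m)) (R (h n)) = inner (h m) (T (h n))" by (simp add: R.symmetric RR)
      also have "\<dots> \<le> norm (h m) * norm (T (h n))" by (rule norm_cauchy_schwarz)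
      also have "\<dots> \<le> (C * sqrt (s m) * \<beta> m) * (C / sqrt (s n) * \<beta> n)"
        using C(1) s0 \<beta>0 by (intro mult_mono h) (auto simp: less_imp_le)
      also have "\<dots> = C\<^sup>2 * ((sqrt (s m) / sqrt (s n)) * (\<beta> m * \<beta> n))"
        by (simp add: power2_eq_square)
      also have "sqrt (s m) / sqrt (s n) = r ^ (n - m)"
      proof -
        have "s n = s m * 2 ^ (n - m)" using that by (simp add: s_def flip: power_add)
        then have "sqrt (s n) = sqrt (s m) * sqrt 2 ^ (n - m)"
          by (simp add: real_sqrt_mult real_sqrt_power)
        then show ?thesis using s0[of m] by (simp add: r_def power_one_over)
      qed
      finally show ?thesis .
    qed
    have cross: "inner (R (h m)) (R (h n)) \<le> C\<^sup>2 * (r ^ ((m - n) + (n - m)) * (\<beta> m * \<beta> n))" for m n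
      using cross_le[of m n] cross_le[of n m]
      by (cases "m \<le> n") (auto simp: inner_commute mult_ac)
    define K where "K = Suc (Max (level ` F))"
    have lv: "level ` F \<subseteq> {..<K}" using F(1) by (auto simp: K_def less_Suc_eq_le)
    define f where "f = (\<Sum>m<K. R (h m))"
    have "T f = (\<Sum>m<K. R (T (h m)))"
      unfolding f_def T.sum by (simp add: R_T)
    also have "\<dots> = (\<Sum>k\<in>F. c k *\<^sub>C q k)"
      unfolding h(1) B_def by (rule sum.group[OF F(1) _ lv]) simp
    finally have Tf: "T f = (\<Sum>k\<in>F. c k *\<^sub>C q k)" .
    have "(norm f)\<^sup>2 = (\<Sum>m<K. \<Sum>n<K. inner (R (h m)) (R (h n)))"
      unfolding power2_norm_eq_inner f_def by (simp add: inner_sum_left inner_sum_right) (rule sum.swap)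
    also have "\<dots> \<le> (\<Sum>m<K. \<Sum>n<K. C\<^sup>2 * (r ^ ((m - n) + (n - m)) * (\<beta> m * \<beta> n)))"
      by (intro sum_mono cross)
    also have "\<dots> \<le> C\<^sup>2 * (2 / (1 - r) * (\<Sum>m<K. (\<beta> m)\<^sup>2))"
      unfolding sum_distrib_left[symmetric] by (intro mult_left_mono sum_decay_le r) simp
    also have "(\<Sum>m<K. (\<beta> m)\<^sup>2) = (\<Sum>m<K. \<Sum>k\<in>{k \<in> F. level k = m}. (mu k)\<^sup>2 * (cmod (c k))\<^sup>2)"
      unfolding \<beta>_def B_def by (intro sum.cong refl real_sqrt_pow2 sum_nonneg) simp
    also have "\<dots> = msum F c" by (rule sum.group[OF F(1) _ lv]) simp
    finally show ?thesis using Tf by (auto simp: D_def)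
  qed
  ultimately show ?thesis by (rule that)
qed

section \<open>Approximation by the trial spaces\<close>

abbreviation trial :: "nat \<Rightarrow> 'h set" where "trial n \<equiv> cspan (q ` {1..n})"

text \<open>f stands for A x and p for A applied to an approximant, so the error is measured in
  \<open>H_norm A 2\<close>. Both properties of \<tau> are used: its decay makes the rates little o,
  its bound by |y| makes \<open>approximation_R\<close> uniform.\<close>

abbreviation approximable :: "real \<Rightarrow> real \<Rightarrow> 'h \<Rightarrow> 'h \<Rightarrow> bool" where
  "approximable C \<sigma> x y \<equiv> \<exists>f \<tau>. x = T f \<and> \<tau> \<longlonglongrightarrow> 0 \<and> (\<forall>n. 0 \<le> \<tau> n \<and> \<tau> n \<le> ip_norm g y \<and>
      (\<exists>p. T p \<in> trial n \<and> norm (f - p) \<le> C * mu (n + 1) powr (1 - \<sigma>) * \<tau> n))"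

text \<open>Beyond index n the weight mu splits as mu^(1 - \<sigma>) mu^\<sigma>, where the first
  factor is largest at n + 1 because \<sigma> >= 1, and the second produces the tail \<tau> of y.
  That x has the form T f is part of the claim: the preimages of the truncations form a Cauchy
  sequence, and \<open>coeff_zero\<close> identifies the image of its limit with x.\<close>

lemma approximation:
  obtains C where "C > 0" "\<And>\<sigma> x y. 1 \<le> \<sigma> \<Longrightarrow> (x, y) \<in> eigen_power g mu q \<sigma> \<Longrightarrow>
    approximable C \<sigma> x y"
proof -
  obtain C0 where C0: "C0 > 0" "\<And>F c. finite F \<Longrightarrow> F \<subseteq> {1..} \<Longrightarrow>
    \<exists>f. T f = (\<Sum>k\<in>F. c k *\<^sub>C q k) \<and> (norm f)\<^sup>2 \<le> C0 * (msum F c)"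
    by (rule interpolation) blast
  have main: "approximable (sqrt C0) \<sigma> x y"
    if \<sigma>: "1 \<le> \<sigma>" and xy: "(x, y) \<in> eigen_power g mu q \<sigma>" for \<sigma> x y
  proof -
    \<comment> \<open>Index shift: the sum of \<open>a\<close> over k < n belongs to q_1, ...,
      q_n.\<close>
    define a where "a k = (cmod (g (q (Suc k)) y))\<^sup>2" for k
    have a_sum: "(\<Sum>k\<in>{n<..m}. (cmod (g (q k) y))\<^sup>2) = (\<Sum>k\<in>{n..<m}. a k)" for n m
      unfolding a_def by (rule sum.reindex_bij_witness[of _ Suc "\<lambda>k. k - 1"]) auto
    have a_le: "(\<Sum>k<n. a k) \<le> (ip_norm g y)\<^sup>2" for n
    proof -
      have "{0<..n} \<subseteq> {1..}" by auto
      from bessel[OF q _ this, of y] show ?thesis by (simp add: a_sum atLeast0LessThan)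
    qed
    have a_summable: "summable a"
      by (rule summableI_nonneg_bounded[OF _ a_le]) (simp add: a_def)
    have a0: "0 \<le> a k" for k by (simp add: a_def)
    define \<tau> where "\<tau> n = sqrt (suminf a - (\<Sum>k<n. a k))" for n
    have tail: "(\<Sum>k\<in>{n..<m}. a k) \<le> suminf a - (\<Sum>k<n. a k)" if "n \<le> m" for n m
    proof -
      have "(\<Sum>k<n. a k) + (\<Sum>k\<in>{n..<m}. a k) = (\<Sum>k<m. a k)"
        using sum.atLeastLessThan_concat[of 0 n m a] that by (simp add: atLeast0LessThan)
      also have "\<dots> \<le> suminf a" by (rule sum_le_suminf[OF a_summable]) (use a0 in auto)
      finally show ?thesis by simp
    qed
    have \<tau>0: "0 \<le> suminf a - (\<Sum>k<n. a k)" for n using tail[of n n] by simp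
    have \<tau>_le: "\<tau> n \<le> ip_norm g y" for n
    proof -
      have "suminf a - (\<Sum>k<n. a k) \<le> suminf a" using a0 by (simp add: sum_nonneg)
      also have "suminf a \<le> (ip_norm g y)\<^sup>2" using a_summable a_le by (rule suminf_le_const)
      finally show ?thesis unfolding \<tau>_def by (simp add: real_le_lsqrt norm_nonneg)
    qed
    have \<tau>_lim: "\<tau> \<longlonglongrightarrow> 0"
    proof -
      have "\<tau> \<longlonglongrightarrow> sqrt (suminf a - suminf a)"
        unfolding \<tau>_def by (intro tendsto_intros summable_LIMSEQ a_summable)
      then show ?thesis by simp
    qed
    define c where "c k = g (q k) x" for k
    have "\<exists>f. T f = (\<Sum>k=1..n. c k *\<^sub>C q k)" for n using C0(2)[of "{1..n}" c] by auto
    then obtain f where f: "\<And>n. T (f n) = (\<Sum>k=1..n. c k *\<^sub>C q k)" by metis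
    have dist: "norm (f m - f n) \<le> sqrt C0 * mu (n + 1) powr (1 - \<sigma>) * \<tau> n" if "n \<le> m" for m n
    proof -
      obtain f' where f': "T f' = (\<Sum>k\<in>{n<..m}. c k *\<^sub>C q k)"
        "(norm f')\<^sup>2 \<le> C0 * (msum {n<..m} c)"
      proof -
        have "{n<..m} \<subseteq> {1..}" by auto
        from C0(2)[OF _ this, of c] that show ?thesis by blast
      qed
      have "{1..m} = {1..n} \<union> {n<..m}" using that by auto
      then have "T (f m) = T (f n) + T f'"
        unfolding f f'(1) by (simp only:) (rule sum.union_disjoint, auto)
      then have "T (f m - f n - f') = 0" by (simp add: T.diff)
      then have f'_eq: "f' = f m - f n" using T_inj by fastforce
      have "(mu k)\<^sup>2 * (cmod (c k))\<^sup>2 \<le> (mu (n + 1) powr (1 - \<sigma>))\<^sup>2 * (cmod (g (q k) y))\<^sup>2"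
        if k: "k \<in> {n<..m}" for k
      proof -
        have mu: "0 < mu (n + 1)" "mu (n + 1) \<le> mu k" "0 < mu k"
          using k mu_le[of "n + 1" k] mu_pos[of "n + 1"] mu_pos[of k] by auto
        have "mu k = mu k powr (1 - \<sigma>) * mu k powr \<sigma>" using mu(3) by (simp flip: powr_add)
        then have "mu k * cmod (c k) = mu k powr (1 - \<sigma>) * (mu k powr \<sigma> * cmod (c k))"
          by (metis mult.assoc)
        also have "mu k powr \<sigma> * cmod (c k) = cmod (g (q k) y)"
          using eigen_power_coeff[OF xy, of k] k by (simp add: norm_mult c_def)
        also have "mu k powr (1 - \<sigma>) * cmod (g (q k) y) \<le> mu (n + 1) powr (1 - \<sigma>) * cmod (g (q k) y)"
          by (intro mult_right_mono powr_mono2') (use \<sigma> mu in auto)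
        finally have "(mu k * cmod (c k))\<^sup>2 \<le> (mu (n + 1) powr (1 - \<sigma>) * cmod (g (q k) y))\<^sup>2"
          by (rule power_mono) (use mu in simp)
        then show ?thesis by (simp add: power_mult_distrib)
      qed
      then have "msum {n<..m} c
          \<le> (mu (n + 1) powr (1 - \<sigma>))\<^sup>2 * (\<Sum>k\<in>{n<..m}. (cmod (g (q k) y))\<^sup>2)"
        unfolding sum_distrib_left by (rule sum_mono)
      also have "\<dots> \<le> (mu (n + 1) powr (1 - \<sigma>))\<^sup>2 * (suminf a - (\<Sum>k<n. a k))"
        unfolding a_sum by (intro mult_left_mono tail that) simp
      finally have "(norm (f m - f n))\<^sup>2
          \<le> C0 * ((mu (n + 1) powr (1 - \<sigma>))\<^sup>2 * (suminf a - (\<Sum>k<n. a k)))"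
        using f'(2) C0(1) unfolding f'_eq by (meson mult_left_mono less_imp_le order_trans)
      also have "\<dots> = (sqrt C0 * mu (n + 1) powr (1 - \<sigma>) * \<tau> n)\<^sup>2"
        using C0(1) \<tau>0[of n] by (simp add: \<tau>_def power_mult_distrib)
      finally show ?thesis
        by (rule power2_le_imp_le) (use C0(1) \<tau>0[of n] in \<open>simp add: \<tau>_def\<close>)
    qed
    have "Cauchy f"
    proof (rule Cauchy_if_tail_bound)
      fix m n :: nat assume "n \<le> m"
      then have "norm (f m - f n) \<le> sqrt C0 * mu (n + 1) powr (1 - \<sigma>) * \<tau> n" by (rule dist)
      also have "\<dots> \<le> sqrt C0 * mu 1 powr (1 - \<sigma>) * \<tau> n"
        by (intro mult_right_mono mult_left_mono powr_mono2')
          (use \<sigma> mu_1 mu_le[of 1 "n + 1"] C0(1) \<tau>0[of n] in \<open>auto simp: \<tau>_def\<close>)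
      finally show "norm (f m - f n) \<le> sqrt C0 * mu 1 powr (1 - \<sigma>) * \<tau> n" .
    qed (rule tendsto_mult_right_zero[OF \<tau>_lim])
    then obtain \<phi> where \<phi>: "f \<longlonglongrightarrow> \<phi>" by (auto simp: Cauchy_convergent_iff convergent_def)
    have T\<phi>: "(\<lambda>n. T (f n)) \<longlonglongrightarrow> T \<phi>" by (rule bounded_linear.tendsto[OF T.bounded_linear \<phi>])
    have "g (q k) (T \<phi>) = c k" if k: "k \<ge> 1" for k
    proof (rule LIMSEQ_unique)
      show "(\<lambda>n. g (q k) (T (f n))) \<longlonglongrightarrow> g (q k) (T \<phi>)"
        by (rule bounded_linear.tendsto[OF bounded_linear_coeff[OF k] T\<phi>])
      have "g (q k) (T (f n)) = c k" if "n \<ge> k" for n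
        unfolding f using orthonormal_coeff[OF q, of "{1..n}" k c] that k by auto
      then show "(\<lambda>n. g (q k) (T (f n))) \<longlonglongrightarrow> c k"
        by (intro tendsto_eventually eventually_sequentiallyI[of k])
    qed
    then have "x - T \<phi> = 0" by (intro coeff_zero) (simp add: diff_right c_def)
    moreover have "T (f n) \<in> trial n" for n
      unfolding f by (intro complex_vector.span_sum complex_vector.span_scale complex_vector.span_base) auto
    moreover have "norm (\<phi> - f n) \<le> sqrt C0 * mu (n + 1) powr (1 - \<sigma>) * \<tau> n" for n
    proof (rule LIMSEQ_le_const2)
      show "(\<lambda>m. norm (f m - f n)) \<longlonglongrightarrow> norm (\<phi> - f n)" by (intro tendsto_intros \<phi>)
    qed (use dist in blast)
    ultimately show ?thesis
      using \<tau>_lim \<tau>_le \<tau>0 by (intro exI[of _ \<phi>] exI[of _ \<tau>]) (auto simp: \<tau>_def)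
  qed
  have "sqrt C0 > 0" using C0(1) by simp
  then show ?thesis using main by (rule that)
qed

text \<open>The case \<sigma> = 3/2 of \<open>approximation\<close> at x = \<open>R (T h)\<close>.
  The bound of \<tau> by |y| is used and not its decay, since one constant must serve all h.\<close>

lemma approximation_R:
  obtains C where "C > 0" "\<And>h n. \<exists>p. T p \<in> trial n \<and>
    norm (R h - p) \<le> C * mu (n + 1) powr (- 1/2) * norm h"
proof -
  obtain C where C: "C > 0" "\<And>\<sigma> x y. 1 \<le> \<sigma> \<Longrightarrow> (x, y) \<in> eigen_power g mu q \<sigma> \<Longrightarrow>
    approximable C \<sigma> x y"
    by (rule approximation) blast
  obtain C1 where C1: "C1 > 0"
    "\<And>h. \<exists>y. (R (T h), y) \<in> eigen_power g mu q (3/2) \<and> ip_norm g y \<le> C1 * norm h"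
    by (rule preimage_bound) blast
  have "\<exists>p. T p \<in> trial n \<and> norm (R h - p) \<le> (C * C1) * mu (n + 1) powr (- 1/2) * norm h"
    for h n
  proof -
    obtain y where y: "(R (T h), y) \<in> eigen_power g mu q (3/2)" "ip_norm g y \<le> C1 * norm h"
      using C1(2) by blast
    obtain f \<tau> where f: "R (T h) = T f" "\<And>n. 0 \<le> \<tau> n \<and> \<tau> n \<le> ip_norm g y \<and>
      (\<exists>p. T p \<in> trial n \<and> norm (f - p) \<le> C * mu (n + 1) powr (1 - 3/2) * \<tau> n)"
      using C(2)[OF _ y(1)] by auto
    have "T (f - R h) = 0" using f(1) by (simp add: R_T T.diff)
    then have "f = R h" using T_inj by fastforce
    with f(2)[of n] obtain p where p: "T p \<in> trial n"
      "norm (R h - p) \<le> C * mu (n + 1) powr (- 1/2) * \<tau> n" by auto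
    note p(2)
    also have "C * mu (n + 1) powr (- 1/2) * \<tau> n \<le> C * mu (n + 1) powr (- 1/2) * (C1 * norm h)"
      using f(2)[of n] y(2) C(1) by (intro mult_left_mono) auto
    finally show ?thesis using p(1) by (auto simp: mult_ac)
  qed
  moreover have "C * C1 > 0" using C(1) C1(1) by simp
  ultimately show ?thesis using that by blast
qed

text \<open>Every q_k lies in the domain of A: apply \<open>interpolation\<close> to a single
  index.\<close>

lemma cspan_range:
  assumes "v \<in> trial n"
  shows "\<exists>f. v = T f"
proof -
  obtain C where C: "\<And>F c. finite F \<Longrightarrow> F \<subseteq> {1..} \<Longrightarrow>
    \<exists>f. T f = (\<Sum>k\<in>F. c k *\<^sub>C q k) \<and> (norm f)\<^sup>2 \<le> C * (msum F c)"
    by (rule interpolation) blast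
  have q_range: "\<exists>f. T f = q k" if "k \<ge> 1" for k using C[of "{k}" "\<lambda>_. 1"] that by auto
  from assms show ?thesis
  proof (induction rule: complex_vector.span_induct_alt)
    case base
    then show ?case using T.zero by metis
  next
    case (step c x y)
    then obtain f h where "T f = x" "T h = y" using q_range by force
    then have "c *\<^sub>C x + y = T (c *\<^sub>C f + h)" by (simp add: T.add T_scaleC)
    then show ?case by blast
  qed
qed

end

section \<open>Ritz approximation of a bounded operator\<close>

text \<open>Gaussian elimination: a nonzero pivot in the last equation removes one unknown and
  leaves a Schur complement with one equation fewer. It supplies the dimension counts of the min-max
  arguments.\<close>

lemma underdetermined_system:
  fixes M :: "nat \<Rightarrow> nat \<Rightarrow> complex"
  assumes "finite K" "m < card K"
  shows "\<exists>a. (\<exists>k\<in>K. a k \<noteq> 0) \<and> (\<forall>i<m. (\<Sum>k\<in>K. M i k * a k) = 0)"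
  using assms
proof (induction m arbitrary: K M)
  case 0
  then have "K \<noteq> {}" by auto
  then show ?case by (intro exI[of _ "\<lambda>_. 1"]) auto
next
  case (Suc m)
  show ?case
  proof (cases "\<forall>k\<in>K. M m k = 0")
    case True
    obtain a where "\<exists>k\<in>K. a k \<noteq> 0" "\<forall>i<m. (\<Sum>k\<in>K. M i k * a k) = 0"
      using Suc.IH[of K M] Suc.prems by auto
    then show ?thesis using True by (intro exI[of _ a]) (auto simp: less_Suc_eq)
  next
    case False
    then obtain l where l: "l \<in> K" "M m l \<noteq> 0" by blast
    define K' where "K' = K - {l}"
    have K': "finite K'" "m < card K'" "K = insert l K'" "l \<notin> K'"
      using Suc.prems l by (auto simp: K'_def)
    obtain b where b: "\<exists>k\<in>K'. b k \<noteq> 0"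
      "\<forall>i<m. (\<Sum>k\<in>K'. (M i k - M i l * M m k / M m l) * b k) = 0"
      using Suc.IH[of K' "\<lambda>i k. M i k - M i l * M m k / M m l"] K' by blast
    define a where "a = b(l := - (\<Sum>k\<in>K'. M m k * b k) / M m l)"
    have "(\<Sum>k\<in>K. M i k * a k) = (\<Sum>k\<in>K'. (M i k - M i l * M m k / M m l) * b k)" for i
    proof -
      have "(\<Sum>k\<in>K. M i k * a k) = M i l * a l + (\<Sum>k\<in>K'. M i k * a k)"
        unfolding K'(3) using K'(1,4) by simp
      also have "(\<Sum>k\<in>K'. M i k * a k) = (\<Sum>k\<in>K'. M i k * b k)"
        using K'(4) by (intro sum.cong) (auto simp: a_def)
      also have "M i l * a l = - (\<Sum>k\<in>K'. M i l * M m k / M m l * b k)"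
        by (simp add: a_def sum_distrib_left sum_divide_distrib mult.assoc)
      finally show ?thesis by (simp add: left_diff_distrib sum_subtractf)
    qed
    moreover have "(\<Sum>k\<in>K'. (M m k - M m l * M m k / M m l) * b k) = 0"
      using l(2) by simp
    moreover have "\<exists>k\<in>K. a k \<noteq> 0" using b(1) K'(3,4) by (auto simp: a_def)
    ultimately show ?thesis using b(2) by (intro exI[of _ a]) (auto simp: less_Suc_eq)
  qed
qed

context pd_op_eigen
begin

lemma cinner_eigenvectors:
  assumes "i \<in> I" "T y = (1 / lam j) *\<^sub>R y" "lam i \<noteq> lam j" "0 < lam j"
  shows "cinner (u i) y = 0"
proof -
  have "complex_of_real (1 / lam i) * cinner (u i) y = cinner (T (u i)) y"
    using T_u[OF assms(1)] by (simp add: cinner.scaleC_left flip: scaleC_of_real)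
  also have "\<dots> = complex_of_real (1 / lam j) * cinner (u i) y"
    using assms(2) by (simp add: T_cinner cinner.scaleC_right flip: scaleC_of_real)
  finally have "complex_of_real (1 / lam i - 1 / lam j) * cinner (u i) y = 0"
    by (simp add: left_diff_distrib)
  moreover have "1 / lam i - 1 / lam j \<noteq> 0"
    using assms(3,4) lam_pos[OF assms(1)] by simp
  ultimately show ?thesis by (simp only: mult_eq_0_iff of_real_eq_0_iff) blast
qed

lemma lam_le: "j \<in> I \<Longrightarrow> 1 \<le> i \<Longrightarrow> i \<le> j \<Longrightarrow> lam i \<le> lam j"
  using lam_mono I_downward by (auto simp: mono_on_def)

text \<open>On this complement \<open>1 / \<lambda>\<^sub>j - T\<close> is nonnegative, and bounded below by the gap; hence it is coercive.\<close>

lemma coercive_complement: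
  assumes j: "j \<in> I"
  obtains K where "K > 0" "\<And>x. (\<And>i. 1 \<le> i \<Longrightarrow> i < j \<Longrightarrow> cinner (u i) x = 0) \<Longrightarrow>
    (\<And>y. T y = (1 / lam j) *\<^sub>R y \<Longrightarrow> inner y x = 0) \<Longrightarrow>
    (norm x)\<^sup>2 \<le> K * ((1 / lam j) * (norm x)\<^sup>2 - inner (T x) x)"
proof -
  obtain e where e: "e > 0" "\<And>z. (\<And>y. T y = (1 / lam j) *\<^sub>R y \<Longrightarrow> inner y z = 0) \<Longrightarrow>
    e * norm z \<le> norm (T z - (1 / lam j) *\<^sub>R z)"
    using eigenspace_gap[OF lam_pos[OF j] lam_less[OF j]] by blast
  obtain d where d: "d > 0" "\<And>x e. (\<And>i. 1 \<le> i \<Longrightarrow> i < j \<Longrightarrow> cinner (u i) x = 0) \<Longrightarrow> 0 \<le> e \<Longrightarrow>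
    e * norm x \<le> norm (T x - (1 / lam j) *\<^sub>R x) \<Longrightarrow>
    (e * norm x)\<^sup>2 \<le> d * ((1 / lam j) * (norm x)\<^sup>2 - inner (T x) x)"
    by (rule coercive_if_bounded_below[OF j rayleigh_le[OF j]]) blast+
  have "(norm x)\<^sup>2 \<le> d / e\<^sup>2 * ((1 / lam j) * (norm x)\<^sup>2 - inner (T x) x)"
    if x: "\<And>i. 1 \<le> i \<Longrightarrow> i < j \<Longrightarrow> cinner (u i) x = 0"
      "\<And>y. T y = (1 / lam j) *\<^sub>R y \<Longrightarrow> inner y x = 0" for x
    using d(2)[OF x(1) less_imp_le[OF e(1)] e(2)[OF x(2)]] e(1)
    by (simp add: power_mult_distrib field_simps)
  moreover have "d / e\<^sup>2 > 0" using d(1) e(1) by simp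
  ultimately show ?thesis using that by blast
qed

end

text \<open>Orthonormal vectors that diagonalize the compression of T, with the Ritz values in
  nonincreasing order, as reciprocals of the harmonic ones. The trial space appears here as the span
  of the \<open>\<phi> i\<close>.\<close>

locale ritz = pd_op_eigen A N lam u
  for A :: "'h::complex_hilbert operator" and N lam u +
  fixes n :: nat and \<phi> :: "nat \<Rightarrow> 'h" and t :: "nat \<Rightarrow> real"
  assumes \<phi>: "orthonormal_on cinner {1..n} \<phi>"
    and T\<phi>: "i \<in> {1..n} \<Longrightarrow> k \<in> {1..n} \<Longrightarrow>
      cinner (\<phi> i) (T (\<phi> k)) = (if i = k then complex_of_real (t i) else 0)"
    and t_antimono: "1 \<le> i \<Longrightarrow> i \<le> k \<Longrightarrow> k \<le> n \<Longrightarrow> t k \<le> t i"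
begin

definition P :: "'h \<Rightarrow> 'h" where "P x = (\<Sum>i=1..n. cinner (\<phi> i) x *\<^sub>C \<phi> i)"

lemma cinner_P: "i \<in> {1..n} \<Longrightarrow> cinner (\<phi> i) (P x) = cinner (\<phi> i) x"
  unfolding P_def using cinner.orthonormal_coeff[OF \<phi>, of "{1..n}" i] by simp

lemma cinner_P_left: "cinner (P x) (P y) = cinner (P x) y"
  unfolding P_def[of x] cinner.sum_left
  by (intro sum.cong) (auto simp: cinner.scaleC_left cinner_P)

lemma P_add: "P (x + y) = P x + P y"
  by (simp add: P_def cinner.add_right complex_vector.scale_left_distrib sum.distrib)

lemma P_scaleC: "P (a *\<^sub>C x) = a *\<^sub>C P x"
  by (simp add: P_def cinner.scaleC_right complex_vector.scale_sum_right complex_vector.scale_scale)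

lemma P_zero: "P 0 = 0"
  by (simp add: P_def)

lemma P_sum: "P (sum f F) = (\<Sum>i\<in>F. P (f i))"
  by (induction F rule: infinite_finite_induct) (auto simp: P_add P_zero)

lemma norm_P_sq: "(norm (P x))\<^sup>2 = (\<Sum>i=1..n. (cmod (cinner (\<phi> i) x))\<^sup>2)"
  unfolding P_def using cinner.orthonormal_norm[OF \<phi>, of "{1..n}"] by simp

lemma norm_P_le: "norm (P x) \<le> norm x"
  by (rule power2_le_imp_le)
    (use cinner.bessel[OF \<phi>, of "{1..n}" x] in \<open>simp_all add: norm_P_sq\<close>)

lemma P_\<phi>: "j \<in> {1..n} \<Longrightarrow> P (\<phi> j) = \<phi> j"
proof -
  assume j: "j \<in> {1..n}"
  have "P (\<phi> j) = (\<Sum>i=1..n. if i = j then \<phi> i else 0)"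
    unfolding P_def by (rule sum.cong) (use \<phi> j in \<open>auto simp: orthonormal_on_def\<close>)
  then show ?thesis using j by simp
qed

lemma inner_P: "inner (P x) (y - P y) = 0"
  using cinner_P_left[of x y] by (simp add: cinner.diff_right flip: Re_cinner)

lemma best_approximation:
  assumes "P p = p"
  shows "norm (x - P x) \<le> norm (x - p)"
proof (rule power2_le_imp_le)
  have "P (P x - p) = P x - p"
  proof -
    have "P (P x) = P x"
      unfolding P_def[of "P x"] by (simp add: cinner_P) (simp add: P_def)
    then have "P (P x - p) + p = P x" using assms P_add[of "P x - p" p] by simp
    then show ?thesis by (simp only: eq_diff_eq)
  qed
  then have "inner (P x - p) (x - P x) = 0" using inner_P[of "P x - p" x] by simp
  then have "(norm (x - p))\<^sup>2 = (norm (x - P x))\<^sup>2 + (norm (P x - p))\<^sup>2"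
    using power2_norm_add[of "x - P x" "P x - p"] by (simp add: inner_commute)
  then show "(norm (x - P x))\<^sup>2 \<le> (norm (x - p))\<^sup>2" by simp
qed simp

text \<open>The Galerkin equation: the projection of \<open>T (\<phi> j)\<close> is
  \<open>t j\<close> times \<open>\<phi> j\<close>, with P moved to the other factor.\<close>

lemma ritz_equation: "j \<in> {1..n} \<Longrightarrow> cinner (T (\<phi> j)) (P x) = complex_of_real (t j) * cinner (\<phi> j) x"
proof -
  assume j: "j \<in> {1..n}"
  have "cinner (T (\<phi> j)) (P x) = (\<Sum>i=1..n. if i = j then complex_of_real (t j) * cinner (\<phi> i) x else 0)"
    unfolding P_def cinner.sum_right
    by (rule sum.cong) (use T\<phi>[OF j] j in \<open>auto simp: cinner.scaleC_right T_cinner\<close>)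
  then show ?thesis using j by simp
qed

lemma rayleigh_sum:
  assumes "F \<subseteq> {1..n}" and x: "x = (\<Sum>i\<in>F. c i *\<^sub>C \<phi> i)"
  shows "inner (T x) x = (\<Sum>i\<in>F. t i * (cmod (c i))\<^sup>2)"
proof -
  have fin: "finite F" using assms(1) finite_subset by blast
  have coeff: "cinner (\<phi> i) (T x) = complex_of_real (t i) * c i" if i: "i \<in> F" for i
  proof -
    have "cinner (\<phi> i) (T x) = (\<Sum>k\<in>F. if i = k then complex_of_real (t i) * c i else 0)"
      unfolding x T.sum T_scaleC
        cinner.sum_right cinner.scaleC_right
      by (intro sum.cong) (use T\<phi> assms(1) i in \<open>auto simp: subset_iff\<close>)
    then show ?thesis using fin i by simp
  qed
  have "cinner x y = (\<Sum>i\<in>F. cnj (c i) * cinner (\<phi> i) y)" for y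
    unfolding x cinner.sum_left cinner.scaleC_left ..
  then have "cinner (T x) x = (\<Sum>i\<in>F. complex_of_real (t i * (cmod (c i))\<^sup>2))"
    unfolding T_cinner
    by (simp add: coeff complex_norm_square mult_ac del: of_real_power)
  also have "\<dots> = complex_of_real (\<Sum>i\<in>F. t i * (cmod (c i))\<^sup>2)" by simp
  finally show ?thesis by (simp flip: Re_cinner)
qed

lemma norm_\<phi>: "j \<in> {1..n} \<Longrightarrow> norm (\<phi> j) = 1"
proof -
  assume "j \<in> {1..n}"
  then have "cinner (\<phi> j) (\<phi> j) = 1" using \<phi> by (simp add: orthonormal_on_def)
  then have "inner (\<phi> j) (\<phi> j) = 1" by (simp flip: Re_cinner)
  then show ?thesis by (simp add: norm_eq_sqrt_inner)
qed

lemma t_pos: "j \<in> {1..n} \<Longrightarrow> 0 < t j"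
proof -
  assume j: "j \<in> {1..n}"
  have "t j = (norm (R (\<phi> j)))\<^sup>2" using T\<phi>[OF j j] by (simp add: norm_R_sq flip: Re_cinner)
  moreover have "\<phi> j \<noteq> 0" using norm_\<phi>[OF j] by auto
  ultimately show ?thesis using R_inj by auto
qed

text \<open>Min-max: some nonzero x in the span of the first j Ritz vectors is orthogonal to u_1,
  ..., u_(j-1). Its Rayleigh quotient is at least \<open>t j\<close> and, by
  \<open>rayleigh_le\<close>, at most \<open>1 / lam j\<close>.\<close>

lemma ritz_le:
  assumes j: "j \<in> I" "j \<le> n"
  shows "t j \<le> 1 / lam j"
proof -
  have j1: "1 \<le> j" using j(1) by simp
  obtain a where a: "\<exists>k\<in>{1..j}. a k \<noteq> 0"
    "\<forall>i<j - 1. (\<Sum>k=1..j. cinner (u (Suc i)) (\<phi> k) * a k) = 0"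
    using underdetermined_system[of "{1..j}" "j - 1" "\<lambda>i k. cinner (u (Suc i)) (\<phi> k)"] j1 by auto
  define x where "x = (\<Sum>k=1..j. a k *\<^sub>C \<phi> k)"
  have sub: "{1..j} \<subseteq> {1..n}" using j(2) by auto
  have norm_x: "(norm x)\<^sup>2 = (\<Sum>k=1..j. (cmod (a k))\<^sup>2)"
    using cinner.orthonormal_norm[OF \<phi> _ sub] by (simp add: x_def)
  have "0 < (norm x)\<^sup>2" unfolding norm_x using a(1) by (auto intro: sum_pos2)
  have "cinner (u i) x = 0" if "1 \<le> i" "i < j" for i
    using a(2)[rule_format, of "i - 1"] that
    by (simp add: x_def cinner.sum_right cinner.scaleC_right mult.commute)
  then have "inner (T x) x \<le> (1 / lam j) * (norm x)\<^sup>2" by (rule rayleigh_le[OF j(1)])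
  moreover have "t j * (norm x)\<^sup>2 \<le> inner (T x) x"
    unfolding rayleigh_sum[OF sub x_def] norm_x sum_distrib_left
    by (intro sum_mono mult_right_mono t_antimono) (use j in auto)
  ultimately have "t j * (norm x)\<^sup>2 \<le> (1 / lam j) * (norm x)\<^sup>2" by simp
  then show ?thesis using \<open>0 < (norm x)\<^sup>2\<close> by (rule mult_right_le_imp_le)
qed

text \<open>The dual choice: x in the span of u_1, ..., u_j orthogonal to the first j - 1 Ritz
  vectors. The form at x is at least |x|^2 / \<open>lam j\<close>, the form at P x at most
  \<open>t j\<close> |x|^2. The loss is at most twice the product of T x with d = x - P x, and it is
  quadratic in \<eta>: T x stays in the span of the u_k, and of each u_k only the error u_k - P u_k
  meets d.\<close>

lemma ritz_ge:
  assumes j: "j \<in> I" "j \<le> n" and \<eta>: "\<And>i. 1 \<le> i \<Longrightarrow> i \<le> j \<Longrightarrow> norm (u i - P (u i)) \<le> \<eta>"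
  shows "1 / lam j - 2 * (real j)\<^sup>2 / lam 1 * \<eta>\<^sup>2 \<le> t j"
proof -
  have j1: "1 \<le> j" using j(1) by simp
  have \<eta>0: "0 \<le> \<eta>" using \<eta>[of 1] j1 by (meson norm_ge_zero order_refl order_trans)
  obtain a where a: "\<exists>k\<in>{1..j}. a k \<noteq> 0"
    "\<forall>i<j - 1. (\<Sum>k=1..j. cinner (\<phi> (Suc i)) (u k) * a k) = 0"
    using underdetermined_system[of "{1..j}" "j - 1" "\<lambda>i k. cinner (\<phi> (Suc i)) (u k)"] j1 by auto
  define x where "x = (\<Sum>k=1..j. a k *\<^sub>C u k)"
  have sub: "{1..j} \<subseteq> I" using I_downward[OF j(1)] by auto
  have norm_x: "(norm x)\<^sup>2 = (\<Sum>k=1..j. (cmod (a k))\<^sup>2)"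
    using cinner.orthonormal_norm[OF u_orthonormal _ sub] by (simp add: x_def)
  have x0: "0 < (norm x)\<^sup>2" unfolding norm_x using a(1) by (auto intro: sum_pos2)
  have a_le: "cmod (a k) \<le> norm x" if "k \<in> {1..j}" for k
  proof (rule power2_le_imp_le)
    show "(cmod (a k))\<^sup>2 \<le> (norm x)\<^sup>2" unfolding norm_x using that
      by (intro member_le_sum) auto
  qed simp
  have coeff: "cinner (\<phi> i) x = 0" if "1 \<le> i" "i < j" for i
    using a(2)[rule_format, of "i - 1"] that
    by (simp add: x_def cinner.sum_right cinner.scaleC_right mult.commute)
  define d where "d = x - P x"
  have "P x = (\<Sum>i=j..n. cinner (\<phi> i) x *\<^sub>C \<phi> i)"
    unfolding P_def by (rule sum.mono_neutral_right) (use coeff j1 in auto)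
  from rayleigh_sum[OF _ this] have "inner (T (P x)) (P x) = (\<Sum>i=j..n. t i * (cmod (cinner (\<phi> i) x))\<^sup>2)"
    using j1 by auto
  also have "\<dots> \<le> (\<Sum>i=j..n. t j * (cmod (cinner (\<phi> i) x))\<^sup>2)"
    by (intro sum_mono mult_right_mono t_antimono) (use j1 in auto)
  also have "\<dots> \<le> (\<Sum>i=1..n. t j * (cmod (cinner (\<phi> i) x))\<^sup>2)"
    by (rule sum_mono2) (use j1 t_pos[of j] j(2) in auto)
  also have "\<dots> = t j * (norm (P x))\<^sup>2" by (simp add: norm_P_sq sum_distrib_left)
  also have "\<dots> \<le> t j * (norm x)\<^sup>2"
    using t_pos[of j] j1 j(2) by (intro mult_left_mono power_mono norm_P_le) auto
  finally have upper: "inner (T (P x)) (P x) \<le> t j * (norm x)\<^sup>2" .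
  have d_eq: "d = (\<Sum>k=1..j. a k *\<^sub>C (u k - P (u k)))"
    by (simp add: d_def x_def P_sum P_scaleC complex_vector.scale_right_diff_distrib sum_subtractf)
  \<comment> \<open>One factor j for the summands of d; the summands of T x give a second one,
    whence j^2 in the constant.\<close>
  have d_le: "norm d \<le> real j * (norm x * \<eta>)"
  proof -
    have "norm d \<le> (\<Sum>k=1..j. norm x * \<eta>)"
      unfolding d_eq by (rule sum_norm_le)
        (use a_le \<eta> \<eta>0 in \<open>auto simp: norm_scaleC intro!: mult_mono\<close>)
    then show ?thesis by simp
  qed
  have u_d: "cmod (cinner (u k) d) \<le> \<eta> * norm d" if "k \<in> {1..j}" for k
  proof -
    have "cinner (P (u k)) d = 0" using cinner_P_left[of "u k" x] by (simp add: d_def cinner.diff_right)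
    then have "cinner (u k) d = cinner (u k - P (u k)) d" by (simp add: cinner.diff_left)
    also have "cmod \<dots> \<le> norm (u k - P (u k)) * norm d" by (rule cinner_norm_le)
    also have "\<dots> \<le> \<eta> * norm d" using \<eta> that by (intro mult_right_mono) auto
    finally show ?thesis .
  qed
  have Tx: "T x = (\<Sum>k=1..j. (complex_of_real (1 / lam k) * a k) *\<^sub>C u k)"
    unfolding x_def T.sum T_scaleC
    by (intro sum.cong) (use sub T_u in \<open>auto simp: mult.commute simp flip: scaleC_of_real\<close>)
  have lam1: "0 < lam 1" using lam_pos[OF I_downward[OF j(1), of 1]] j1 by simp
  have "inner (T x) d \<le> cmod (cinner (T x) d)" by (metis Re_cinner complex_Re_le_cmod)
  also have "\<dots> \<le> (\<Sum>k=1..j. 1 / lam 1 * (norm x * (\<eta> * norm d)))"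
    unfolding Tx cinner.sum_left
  proof (rule sum_norm_le)
    fix k assume k: "k \<in> {1..j}"
    have lam: "0 < lam k" "lam 1 \<le> lam k"
      using k sub lam_pos lam_le[of k 1] by auto
    have "1 / lam k * (cmod (a k) * cmod (cinner (u k) d)) \<le> 1 / lam 1 * (norm x * (\<eta> * norm d))"
      using lam lam1 \<eta>0 a_le[OF k] u_d[OF k]
      by (intro mult_mono) (auto simp: frac_le)
    then show "cmod (cinner ((complex_of_real (1 / lam k) * a k) *\<^sub>C u k) d)
        \<le> 1 / lam 1 * (norm x * (\<eta> * norm d))"
      using lam by (simp add: cinner.scaleC_left norm_mult norm_divide mult.assoc)
  qed
  also have "\<dots> = real j / lam 1 * (norm x * (\<eta> * norm d))" by simp
  also have "\<dots> \<le> real j / lam 1 * (norm x * (\<eta> * (real j * (norm x * \<eta>))))"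
    using lam1 \<eta>0 by (intro mult_left_mono d_le) auto
  also have "\<dots> = (real j)\<^sup>2 / lam 1 * \<eta>\<^sup>2 * (norm x)\<^sup>2" by (simp add: power2_eq_square)
  finally have Txd: "inner (T x) d \<le> (real j)\<^sup>2 / lam 1 * \<eta>\<^sup>2 * (norm x)\<^sup>2" .
  have "inner (T x) x = Re (\<Sum>k=1..j. complex_of_real (1 / lam k * (cmod (a k))\<^sup>2))"
    unfolding Re_cinner[symmetric] Tx cinner.sum_left
  proof (intro arg_cong[of _ _ Re] sum.cong)
    fix k assume k: "k \<in> {1..j}"
    have "cinner (u k) x = a k"
      unfolding x_def using cinner.orthonormal_coeff[OF u_orthonormal _ sub, of k a] k sub by auto
    then show "cinner ((complex_of_real (1 / lam k) * a k) *\<^sub>C u k) x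
        = complex_of_real (1 / lam k * (cmod (a k))\<^sup>2)"
      by (simp add: cinner.scaleC_left complex_norm_square mult_ac del: of_real_power)
  qed simp
  also have "\<dots> = (\<Sum>k=1..j. 1 / lam k * (cmod (a k))\<^sup>2)" by simp
  also have "\<dots> \<ge> (\<Sum>k=1..j. 1 / lam j * (cmod (a k))\<^sup>2)"
  proof (intro sum_mono mult_right_mono)
    fix k assume k: "k \<in> {1..j}"
    then have "0 < lam k" "lam k \<le> lam j" using sub lam_pos lam_le[OF j(1)] by auto
    then show "1 / lam j \<le> 1 / lam k" by (simp add: frac_le)
  qed simp
  finally have lower: "1 / lam j * (norm x)\<^sup>2 \<le> inner (T x) x"
    by (simp add: norm_x sum_distrib_left)
  have "inner (T (P x)) (P x) = inner (T x) x - 2 * inner (T x) d + inner (T d) d"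
  proof -
    have "inner (T d) x = inner (T x) d" by (metis T.symmetric inner_commute)
    moreover have "P x = x - d" by (simp add: d_def)
    ultimately show ?thesis by (simp add: T.diff inner_diff_left inner_diff_right)
  qed
  with upper lower Txd T.nonneg[of d]
  have "1 / lam j * (norm x)\<^sup>2 - 2 * ((real j)\<^sup>2 / lam 1 * \<eta>\<^sup>2 * (norm x)\<^sup>2) \<le> t j * (norm x)\<^sup>2"
    by linarith
  then have "(1 / lam j - 2 * (real j)\<^sup>2 / lam 1 * \<eta>\<^sup>2) * (norm x)\<^sup>2 \<le> t j * (norm x)\<^sup>2"
    by (simp add: algebra_simps)
  then show ?thesis using x0 by (rule mult_right_le_imp_le)
qed

text \<open>Pairing the eigenvalue equation of u_i with the Galerkin equation bounds the coefficient
  times \<open>1 / lam i - t j\<close> by the error of u_i. By \<open>ritz_le\<close> this factor is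
  at least \<open>1 / lam i - 1 / lam j\<close>, so convergence of \<open>t j\<close> is not
  presupposed.\<close>

lemma lower_coefficient:
  assumes j: "j \<in> I" "j \<le> n" and i: "1 \<le> i" "i < j" "lam i < lam j"
    and \<eta>: "norm (u i - P (u i)) \<le> \<eta>" and b: "\<And>x. norm (T x) \<le> b * norm x" "b > 0"
  shows "cmod (cinner (u i) (\<phi> j)) \<le> b / (1 / lam i - 1 / lam j) * \<eta>"
proof -
  have jn: "j \<in> {1..n}" using j by auto
  have iI: "i \<in> I" using I_downward[OF j(1)] i by auto
  have pos: "0 < lam i" by (rule lam_pos[OF iI])
  have gap: "0 < 1 / lam i - 1 / lam j" "1 / lam i - 1 / lam j \<le> 1 / lam i - t j"
    using pos i(3) ritz_le[OF j] by (auto simp: frac_less2)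
  have "complex_of_real (1 / lam i - t j) * cinner (\<phi> j) (u i)
      = cinner (\<phi> j) (T (u i)) - complex_of_real (t j) * cinner (\<phi> j) (u i)"
    using T_u[OF iI] by (simp add: cinner.scaleC_right left_diff_distrib flip: scaleC_of_real)
  also have "\<dots> = cinner (T (\<phi> j)) (u i - P (u i))"
    by (simp add: cinner.diff_right ritz_equation[OF jn]) (simp add: T_cinner)
  finally have "complex_of_real (1 / lam i - t j) * cinner (\<phi> j) (u i)
      = cinner (T (\<phi> j)) (u i - P (u i))" .
  then have "\<bar>1 / lam i - t j\<bar> * cmod (cinner (\<phi> j) (u i)) = cmod (cinner (T (\<phi> j)) (u i - P (u i)))"
    by (metis norm_mult norm_of_real)
  also have "\<dots> \<le> norm (T (\<phi> j)) * norm (u i - P (u i))" by (rule cinner_norm_le)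
  also have "\<dots> \<le> b * \<eta>"
    using b(1)[of "\<phi> j"] b(2) norm_\<phi>[OF jn] \<eta> by (intro mult_mono) auto
  finally have "\<bar>1 / lam i - t j\<bar> * cmod (cinner (\<phi> j) (u i)) \<le> b * \<eta>" .
  moreover have "(1 / lam i - 1 / lam j) * cmod (cinner (\<phi> j) (u i))
      \<le> \<bar>1 / lam i - t j\<bar> * cmod (cinner (\<phi> j) (u i))"
    using gap by (intro mult_right_mono) auto
  ultimately have "(1 / lam i - 1 / lam j) * cmod (cinner (\<phi> j) (u i)) \<le> b * \<eta>" by linarith
  then have "cmod (cinner (\<phi> j) (u i)) \<le> b / (1 / lam i - 1 / lam j) * \<eta>"
    using gap(1) by (simp add: pos_le_divide_eq mult.commute)
  moreover have "cmod (cinner (u i) (\<phi> j)) = cmod (cinner (\<phi> j) (u i))"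
    by (subst cinner_commute) simp
  ultimately show ?thesis by simp
qed

lemma P_le: "norm (x - P x) \<le> norm (x - (\<Sum>k=1..n. c k *\<^sub>C \<phi> k))"
  by (rule best_approximation) (simp add: P_sum P_scaleC P_\<phi>)

text \<open>The residual splits into a part \<open>L\<close> along the lower eigenvectors, controlled by
  the lemma \<open>lower_coefficient\<close>, and a part \<open>X\<close> controlled by the coercivity of \<open>1 / \<lambda>\<^sub>j - T\<close>.\<close>

lemma ritz_vector:
  fixes \<eta> b K :: real and j :: nat
  defines "K1 \<equiv> \<Sum>i\<in>{i. 1 \<le> i \<and> i < j \<and> lam i < lam j}. b / (1 / lam i - 1 / lam j)"
  assumes j: "j \<in> I" "j \<le> n" and \<eta>: "\<And>i. 1 \<le> i \<Longrightarrow> i \<le> j \<Longrightarrow> norm (u i - P (u i)) \<le> \<eta>"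
    and b: "\<And>x. norm (T x) \<le> b * norm x" "b > 0"
    and K: "K > 0" "\<And>x. (\<And>i. 1 \<le> i \<Longrightarrow> i < j \<Longrightarrow> cinner (u i) x = 0) \<Longrightarrow>
      (\<And>y. T y = (1 / lam j) *\<^sub>R y \<Longrightarrow> inner y x = 0) \<Longrightarrow>
      (norm x)\<^sup>2 \<le> K * ((1 / lam j) * (norm x)\<^sup>2 - inner (T x) x)"
  obtains p where "T p = (1 / lam j) *\<^sub>R p"
    "\<forall>y. T y = (1 / lam j) *\<^sub>R y \<longrightarrow> inner y (\<phi> j - p) = 0"
    "norm (\<phi> j - p) \<le> (K1 + sqrt (K * (2 * (real j)\<^sup>2 / lam 1 + b * K1\<^sup>2))) * \<eta>"
proof -
  let ?\<theta> = "1 / lam j"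
  have jn: "j \<in> {1..n}" using j by auto
  have lj: "0 < lam j" by (rule lam_pos[OF j(1)])
  have \<eta>0: "0 \<le> \<eta>" using \<eta>[of j] jn by (meson norm_ge_zero order_refl order_trans atLeastAtMost_iff)
  \<comment> \<open>The entire eigenspace, which may contain u_i with i > j; projecting onto it
    requires no approximation of those vectors.\<close>
  define E where "E = {y. T y = ?\<theta> *\<^sub>R y}"
  have "subspace E" by (rule subspaceI) (auto simp: E_def T.lin scaleR_add_right)
  moreover have "closed E" unfolding E_def
    by (intro closed_Collect_eq continuous_intros
        bounded_linear.continuous_on[OF T.bounded_linear])
  ultimately obtain p where p: "p \<in> E" "\<And>y. y \<in> E \<Longrightarrow> inner (\<phi> j - p) y = 0"
    by (rule closed_subspace_projection[of E "\<phi> j"]) blast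
  have Tp: "T p = ?\<theta> *\<^sub>R p" using p(1) by (simp add: E_def)
  define e where "e = \<phi> j - p"
  have e_orth: "inner y e = 0" if "T y = ?\<theta> *\<^sub>R y" for y
    using p(2)[of y] that by (simp add: E_def e_def inner_commute)
  define J where "J = {i. 1 \<le> i \<and> i < j \<and> lam i < lam j}"
  have J: "finite J" "J \<subseteq> I" using I_downward[OF j(1)] by (auto simp: J_def)
  define c where "c i = cinner (u i) (\<phi> j)" for i
  define L where "L = (\<Sum>i\<in>J. c i *\<^sub>C u i)"
  define X where "X = e - L"
  have K10: "0 \<le> K1" unfolding K1_def J_def[symmetric]
  proof (rule sum_nonneg)
    fix i assume "i \<in> J"
    then have "0 < lam i" "lam i < lam j" using J lam_pos by (auto simp: J_def)
    then show "0 \<le> b / (1 / lam i - ?\<theta>)" using b(2) by (intro divide_nonneg_nonneg) (auto simp: frac_le)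
  qed
  have L_le: "norm L \<le> K1 * \<eta>"
    unfolding L_def K1_def J_def[symmetric] sum_distrib_right
  proof (rule sum_norm_le)
    fix i assume i: "i \<in> J"
    have "cinner (u i) (u i) = 1" using u_orthonormal i J(2) by (auto simp: orthonormal_on_def)
    then have "inner (u i) (u i) = 1" by (simp flip: Re_cinner)
    then have "norm (u i) = 1" by (simp add: norm_eq_sqrt_inner)
    then have "norm (c i *\<^sub>C u i) = cmod (c i)" by (simp add: norm_scaleC)
    also have "\<dots> \<le> b / (1 / lam i - ?\<theta>) * \<eta>"
      unfolding c_def using i by (intro lower_coefficient j \<eta> b) (auto simp: J_def)
    finally show "norm (c i *\<^sub>C u i) \<le> b / (1 / lam i - ?\<theta>) * \<eta>" .
  qed
  have cX: "cinner (u i) X = 0" if i: "1 \<le> i" "i < j" for i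
  proof -
    have iI: "i \<in> I" using I_downward[OF j(1)] i by auto
    have L: "cinner (u i) L = (if i \<in> J then c i else 0)"
      unfolding L_def by (rule cinner.orthonormal_coeff[OF u_orthonormal J iI])
    show ?thesis
    proof (cases "lam i < lam j")
      case True
      then have "cinner (u i) p = 0" using cinner_eigenvectors[OF iI Tp _ lj] by simp
      with True i L show ?thesis by (simp add: X_def e_def c_def J_def cinner.diff_right)
    next
      case False
      then have "lam i = lam j" using lam_le[OF j(1), of i] i by simp
      then have Tu: "T (u i) = ?\<theta> *\<^sub>R u i" using T_u[OF iI] by simp
      \<comment> \<open>e is orthogonal to the eigenspace for the real inner product; as the
        eigenspace is closed under \<i>, complex orthogonality follows.\<close>
      then have "T (\<i> *\<^sub>C u i) = ?\<theta> *\<^sub>R (\<i> *\<^sub>C u i)" by (simp add: T_scaleC scaleC_scaleR)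
      from e_orth[OF this] e_orth[OF Tu] have "cinner (u i) e = 0"
        by (simp add: complex_eq_iff Re_cinner Im_cinner)
      with False L show ?thesis by (simp add: X_def J_def cinner.diff_right)
    qed
  qed
  have yL: "inner y L = 0" if "T y = ?\<theta> *\<^sub>R y" for y
  proof -
    have "cinner y (u i) = 0" if "i \<in> J" for i
      using cinner_eigenvectors[of i y j] \<open>T y = _\<close> that J(2) lj cinner_commute[of y "u i"]
      by (auto simp: J_def)
    then have "cinner y L = 0" by (simp add: L_def cinner.sum_right cinner.scaleC_right)
    then show ?thesis by (simp flip: Re_cinner)
  qed
  have yX: "inner y X = 0" if "T y = ?\<theta> *\<^sub>R y" for y
    using e_orth[OF that] yL[OF that] by (simp add: X_def inner_diff_right)
  have LX: "inner L X = 0"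
  proof -
    have "cinner L X = 0"
      unfolding L_def cinner.sum_left by (rule sum.neutral) (use cX in \<open>auto simp: cinner.scaleC_left J_def\<close>)
    then show ?thesis by (simp flip: Re_cinner)
  qed
  have TLX: "inner (T L) X = 0"
  proof -
    have "cinner (T L) X = 0"
      unfolding L_def T.sum cinner.sum_left T_scaleC
    proof (rule sum.neutral, rule ballI)
      fix i assume i: "i \<in> J"
      then have "T (u i) = complex_of_real (1 / lam i) *\<^sub>C u i"
        using T_u[of i] J(2) by (auto simp only: scaleC_of_real)
      then have "cinner (T (u i)) X = 0"
        using i cX[of i] by (simp add: J_def cinner.scaleC_left)
      then show "cinner (c i *\<^sub>C T (u i)) X = 0" by (simp add: cinner.scaleC_left)
    qed
    then show ?thesis by (simp flip: Re_cinner)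
  qed
  have split: "\<phi> j = p + (L + X)" by (simp add: X_def e_def)
  \<comment> \<open>p, L and X are orthogonal also for the form of T, so \<open>t j\<close> and 1
    both split into three parts. Subtracting the first splitting from \<theta> times the second
    cancels p and leaves the coercive form at X, with \<theta> - \<open>t j\<close> bounded by
    \<open>ritz_ge\<close>.\<close>
  have "inner (T (\<phi> j)) (\<phi> j) = ?\<theta> * (norm p)\<^sup>2 + inner (T L) L + inner (T X) X"
  proof -
    have "inner (T L) p = ?\<theta> * inner L p" "inner (T X) p = ?\<theta> * inner X p" "inner (T X) L = inner (T L) X"
      using Tp T.symmetric[of L p] T.symmetric[of X p] T.symmetric[of X L] by (simp_all add: inner_commute)
    then show ?thesis unfolding split
      using TLX yL[OF Tp] yX[OF Tp]
      by (simp only: T.add inner_add_left inner_add_right Tp inner_scaleR_left power2_norm_eq_inner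
          inner_commute[of L p] inner_commute[of X p])
  qed
  moreover have "inner (T (\<phi> j)) (\<phi> j) = t j"
    using T\<phi>[OF jn jn] Re_cinner[of "\<phi> j" "T (\<phi> j)"] by (simp add: T.symmetric)
  moreover have "1 = (norm p)\<^sup>2 + (norm L)\<^sup>2 + (norm X)\<^sup>2"
  proof -
    have "1 = (norm (p + (L + X)))\<^sup>2" using norm_\<phi>[OF jn] split by simp
    also have "\<dots> = (norm p)\<^sup>2 + (norm L)\<^sup>2 + (norm X)\<^sup>2"
      unfolding power2_norm_add inner_add_right using LX yL[OF Tp] yX[OF Tp] by simp
    finally show ?thesis .
  qed
  then have "?\<theta> = ?\<theta> * ((norm p)\<^sup>2 + (norm L)\<^sup>2 + (norm X)\<^sup>2)" by simp
  ultimately have "?\<theta> * (norm X)\<^sup>2 - inner (T X) X = (?\<theta> - t j) + (inner (T L) L - ?\<theta> * (norm L)\<^sup>2)"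
    by (simp only: distrib_left)
  also have "inner (T L) L - ?\<theta> * (norm L)\<^sup>2 \<le> b * (norm L)\<^sup>2"
  proof -
    have "inner (T L) L \<le> norm (T L) * norm L" by (rule norm_cauchy_schwarz)
    also have "\<dots> \<le> (b * norm L) * norm L" by (intro mult_right_mono b) simp
    moreover have "0 \<le> ?\<theta> * (norm L)\<^sup>2" using lj by simp
    ultimately show ?thesis by (simp add: power2_eq_square)
  qed
  also have "b * (norm L)\<^sup>2 \<le> b * (K1 * \<eta>)\<^sup>2"
    using b(2) by (intro mult_left_mono power_mono L_le) auto
  also have "?\<theta> - t j \<le> 2 * (real j)\<^sup>2 / lam 1 * \<eta>\<^sup>2" using ritz_ge[OF j \<eta>] by simp
  finally have "?\<theta> * (norm X)\<^sup>2 - inner (T X) X \<le> (2 * (real j)\<^sup>2 / lam 1 + b * K1\<^sup>2) * \<eta>\<^sup>2"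
    by (simp add: power_mult_distrib algebra_simps)
  moreover have "(norm X)\<^sup>2 \<le> K * (?\<theta> * (norm X)\<^sup>2 - inner (T X) X)"
    by (rule K(2)[OF cX yX])
  ultimately have "(norm X)\<^sup>2 \<le> K * ((2 * (real j)\<^sup>2 / lam 1 + b * K1\<^sup>2) * \<eta>\<^sup>2)"
    using K(1) by (meson mult_left_mono less_imp_le order_trans)
  then have "norm X \<le> sqrt (K * ((2 * (real j)\<^sup>2 / lam 1 + b * K1\<^sup>2) * \<eta>\<^sup>2))"
    by (rule real_le_rsqrt)
  also have "\<dots> = sqrt (K * (2 * (real j)\<^sup>2 / lam 1 + b * K1\<^sup>2)) * \<eta>"
    using \<eta>0 by (simp add: real_sqrt_mult)
  finally have "norm e \<le> K1 * \<eta> + sqrt (K * (2 * (real j)\<^sup>2 / lam 1 + b * K1\<^sup>2)) * \<eta>"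
    using L_le norm_triangle_ineq[of L X] by (simp add: X_def)
  then show ?thesis using that[OF Tp] e_orth by (simp add: e_def distrib_right)
qed

text \<open>Duality: with \<open>D = T - 1 / \<lambda>\<^sub>j\<close> the residual \<open>D e\<close> is tested against \<open>T D e\<close>, which lies in the
  range of \<open>R\<close> and is therefore well approximated by the trial space.\<close>

lemma ritz_vector_R:
  assumes j: "j \<in> I" "j \<le> n" and p: "T p = (1 / lam j) *\<^sub>R p"
    and e: "\<And>y. T y = (1 / lam j) *\<^sub>R y \<Longrightarrow> inner y (\<phi> j - p) = 0"
    and gap: "\<And>z. (\<And>y. T y = (1 / lam j) *\<^sub>R y \<Longrightarrow> inner y z = 0) \<Longrightarrow>
      \<epsilon> * norm z \<le> norm (T z - (1 / lam j) *\<^sub>R z)"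
    and d: "\<And>x. norm (T x - (1 / lam j) *\<^sub>R x) \<le> d * norm x"
    and \<kappa>: "\<And>h. norm (R h - P (R h)) \<le> \<kappa> * norm h" "0 \<le> \<kappa>"
  shows "(\<epsilon> - (1 / lam j - t j)) * norm (R (\<phi> j - p)) \<le> \<kappa> * (d * norm (\<phi> j - p))"
proof -
  let ?\<theta> = "1 / lam j"
  have jn: "j \<in> {1..n}" using j by auto
  define D where "D x = T x - ?\<theta> *\<^sub>R x" for x
  define v where "v = \<phi> j - p"
  have Dv: "D v = D (\<phi> j)" by (simp add: D_def v_def T.diff p scaleR_diff_right)
  have D_sym: "inner (D x) y = inner x (D y)" for x y
    by (simp add: D_def inner_diff_left inner_diff_right T.symmetric)
  have DR: "D (R x) = R (D x)" and DT: "D (T x) = T (D x)" for x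
    by (simp_all add: D_def R_T R.diff R.scale T.diff T.scale)
  \<comment> \<open>R maps the eigenspace into itself, hence also its complement, so the gap may be
    applied to R v in place of v.\<close>
  have low: "\<epsilon> * norm (R v) \<le> norm (R (D v))"
  proof -
    have "\<epsilon> * norm (R v) \<le> norm (D (R v))"
      unfolding D_def
    proof (rule gap)
      fix y assume "T y = ?\<theta> *\<^sub>R y"
      then have "T (R y) = ?\<theta> *\<^sub>R R y" by (simp add: R_T[symmetric] R.scale)
      then have "inner (R y) v = 0" unfolding v_def by (rule e)
      then show "inner y (R v) = 0" by (simp add: R.symmetric)
    qed
    then show ?thesis by (simp only: DR)
  qed
  define z where "z = T (D v)"
  have z: "z = R (R (D v))" by (simp add: z_def RR)
  have t: "t j \<le> ?\<theta>" by (rule ritz_le[OF j])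
  \<comment> \<open>The residual does not vanish on the trial space, because \<open>\<phi> j\<close>
    satisfies the Galerkin equation with \<open>t j\<close> in place of \<theta>. The defect carries
    the factor \<open>t j\<close> - \<theta>, which is finally absorbed into the gap.\<close>
  have proj: "inner (D v) (P z) = (t j - ?\<theta>) * inner (R (D v)) (R v)"
  proof -
    have "cinner (\<phi> j) (P z) = cinner (\<phi> j) z" by (rule cinner_P[OF jn])
    then have Pz: "inner (\<phi> j) (P z) = inner (\<phi> j) z" by (simp flip: Re_cinner)
    have "inner (T (\<phi> j)) (P z) = t j * inner (\<phi> j) z"
      using ritz_equation[OF jn, of z] by (simp flip: Re_cinner)
    then have "inner (D v) (P z) = (t j - ?\<theta>) * inner (\<phi> j) z"
      unfolding Dv by (simp add: D_def inner_diff_left Pz left_diff_distrib)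
    also have "inner (\<phi> j) z = inner (D (\<phi> j)) (T v)"
      unfolding z_def by (simp add: D_sym DT)
    also have "\<dots> = inner (R (D v)) (R v)" by (simp add: Dv R.symmetric RR)
    finally show ?thesis .
  qed
  have "(norm (R (D v)))\<^sup>2 = inner (D v) z" by (simp add: norm_R_sq z_def)
  also have "\<dots> = inner (D v) (z - P z) + inner (D v) (P z)" by (simp flip: inner_add_right)
  also have "inner (D v) (z - P z) \<le> norm (D v) * norm (z - P z)" by (rule norm_cauchy_schwarz)
  also have "norm (D v) * norm (z - P z) \<le> (d * norm v) * (\<kappa> * norm (R (D v)))"
  proof (rule mult_mono)
    show "norm (D v) \<le> d * norm v" unfolding D_def by (rule d)
    then show "0 \<le> d * norm v" by (meson norm_ge_zero order_trans)
    show "norm (z - P z) \<le> \<kappa> * norm (R (D v))" unfolding z by (rule \<kappa>)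
  qed simp
  also have "inner (D v) (P z) \<le> (?\<theta> - t j) * (norm (R (D v)) * norm (R v))"
  proof -
    have "inner (D v) (P z) = (?\<theta> - t j) * (- inner (R (D v)) (R v))" by (simp add: proj algebra_simps)
    also have "\<dots> \<le> (?\<theta> - t j) * (norm (R (D v)) * norm (R v))"
      using t Cauchy_Schwarz_ineq2[of "R (D v)" "R v"] by (intro mult_left_mono) auto
    finally show ?thesis .
  qed
  finally have "norm (R (D v)) * norm (R (D v))
      \<le> norm (R (D v)) * (\<kappa> * (d * norm v) + (?\<theta> - t j) * norm (R v))"
    by (simp add: power2_eq_square algebra_simps)
  moreover have "0 \<le> \<kappa> * (d * norm v) + (?\<theta> - t j) * norm (R v)"
  proof -
    have "0 \<le> d * norm v" using d[of v] by (meson norm_ge_zero order_trans)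
    then show ?thesis using \<kappa>(2) t by simp
  qed
  ultimately have "norm (R (D v)) \<le> \<kappa> * (d * norm v) + (?\<theta> - t j) * norm (R v)"
    by (cases "norm (R (D v)) = 0") (simp_all add: mult_le_cancel_left)
  with low show ?thesis by (simp add: v_def algebra_simps)
qed

end

section \<open>Ritz estimates uniform in the trial space\<close>

context pd_op_eigen
begin

text \<open>T p will be the exact eigenvector and T maps x / sqrt t to the harmonic Ritz vector; the
  last two bounds are then the errors in \<open>H_norm A 2\<close> and
  \<open>H_norm A 1\<close>.\<close>

abbreviation ritz_estimate :: "nat \<Rightarrow> real \<Rightarrow> real \<Rightarrow> real \<Rightarrow> real \<Rightarrow> 'h \<Rightarrow> bool" where
  "ritz_estimate j K \<eta> \<kappa> t x \<equiv> 1 / (2 * lam j) \<le> t \<and> t \<le> 1 / lam j \<and> 1 / lam j - K * \<eta>\<^sup>2 \<le> t \<and>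
    (\<exists>p. T p = (1 / lam j) *\<^sub>R p \<and> norm (R p) = 1 \<and>
      norm (p - (1 / sqrt t) *\<^sub>R x) \<le> K * \<eta> \<and>
      norm (R (p - (1 / sqrt t) *\<^sub>R x)) \<le> K * (\<kappa> * \<eta>))"

text \<open>K and \<delta> are fixed before n, \<phi>, \<eta> and \<kappa>, which makes the estimate
  uniform. The rate \<eta> comes from \<open>ritz_vector\<close>, the extra factor \<kappa> from the
  duality in \<open>ritz_vector_R\<close>; what remains is to normalize p without losing
  either.\<close>

lemma ritz_convergence:
  assumes j: "j \<in> I"
  obtains K \<delta> where "K > 0" "\<delta> > 0" "\<And>n \<phi> t \<eta> \<kappa>. ritz A N lam u n \<phi> t \<Longrightarrow> j \<le> n \<Longrightarrow>
    (\<And>i. 1 \<le> i \<Longrightarrow> i \<le> j \<Longrightarrow> \<exists>c. norm (u i - (\<Sum>k=1..n. c k *\<^sub>C \<phi> k)) \<le> \<eta>) \<Longrightarrow> 0 \<le> \<eta> \<Longrightarrow> \<eta> \<le> \<delta> \<Longrightarrow>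
    (\<And>h. \<exists>c. norm (R h - (\<Sum>k=1..n. c k *\<^sub>C \<phi> k)) \<le> \<kappa> * norm h) \<Longrightarrow> 0 \<le> \<kappa> \<Longrightarrow>
    ritz_estimate j K \<eta> \<kappa> (t j) (\<phi> j)"
proof -
  define \<theta> where "\<theta> = 1 / lam j"
  have \<theta>: "\<theta> > 0" using lam_pos[OF j] by (simp add: \<theta>_def)
  have lam1: "0 < lam 1" using lam_pos[OF I_downward[OF j, of 1]] j by simp
  have j1: "1 \<le> j" using j by simp
  obtain b where b: "b > 0" "\<And>x. norm (T x) \<le> b * norm x" by (rule T.bound_obtain) blast
  obtain rb where rb: "rb > 0" "\<And>x. norm (R x) \<le> rb * norm x" by (rule R.bound_obtain) blast
  interpret D: symmetric_op "\<lambda>x. T x - (1 / lam j) *\<^sub>R x" by (rule T.shift)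
  obtain d where d: "d > 0" "\<And>x. norm (T x - (1 / lam j) *\<^sub>R x) \<le> d * norm x"
    by (rule D.bound_obtain) blast
  obtain Kc where Kc: "Kc > 0" "\<And>x. (\<And>i. 1 \<le> i \<Longrightarrow> i < j \<Longrightarrow> cinner (u i) x = 0) \<Longrightarrow>
    (\<And>y. T y = (1 / lam j) *\<^sub>R y \<Longrightarrow> inner y x = 0) \<Longrightarrow>
    (norm x)\<^sup>2 \<le> Kc * ((1 / lam j) * (norm x)\<^sup>2 - inner (T x) x)"
    by (rule coercive_complement[OF j]) blast
  obtain \<epsilon> where \<epsilon>: "\<epsilon> > 0" "\<And>z. (\<And>y. T y = (1 / lam j) *\<^sub>R y \<Longrightarrow> inner y z = 0) \<Longrightarrow>
    \<epsilon> * norm z \<le> norm (T z - (1 / lam j) *\<^sub>R z)"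
    using eigenspace_gap[OF lam_pos[OF j] lam_less[OF j]] by blast
  define K0 where "K0 = 2 * (real j)\<^sup>2 / lam 1"
  define K1 where "K1 = (\<Sum>i\<in>{i. 1 \<le> i \<and> i < j \<and> lam i < lam j}. b / (1 / lam i - 1 / lam j))"
  define K2 where "K2 = \<bar>K1 + sqrt (Kc * (K0 + b * K1\<^sup>2))\<bar>"
  define K3 where "K3 = 2 * d / \<epsilon> * K2"
  \<comment> \<open>An upper bound for 1 / sqrt (\<open>t j\<close>), valid once \<open>t j\<close>
    >= \<theta> / 2.\<close>
  define s where "s = sqrt (2 / \<theta>)"
  have K0: "K0 > 0" using j1 lam1 by (simp add: K0_def)
  have K2: "0 \<le> K2" and K3: "0 \<le> K3" using d(1) \<epsilon>(1) by (auto simp: K2_def K3_def)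
  have s: "s > 0" using \<theta> by (simp add: s_def)
  \<comment> \<open>The first summand serves the Ritz value, the second the strong norm, the third
    the weak norm.\<close>
  define K where "K = K0 + s * (1 + rb / sqrt \<theta>) * K2 + 2 * s * K3"
  have K_terms: "0 \<le> s * (1 + rb / sqrt \<theta>) * K2" "0 \<le> 2 * s * K3"
    using s rb(1) \<theta> K2 K3 by (auto intro!: mult_nonneg_nonneg add_nonneg_nonneg)
  \<comment> \<open>The first entry makes \<theta> - \<open>t j\<close> at most \<theta> / 2 and
    \<epsilon> / 2, so \<open>t j\<close> stays away from 0 and half of the gap survives; the second
    makes |\<open>\<phi> j\<close> - p| < 1, hence p nonzero.\<close>
  define \<delta> where "\<delta> = min (sqrt (min \<theta> \<epsilon> / (2 * K0))) (1 / (2 * (K2 + 1)))"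
  have "\<delta> > 0" using \<theta> \<epsilon>(1) K0 K2 by (simp add: \<delta>_def)
  moreover have "K > 0" unfolding K_def using K0 K_terms by linarith
  moreover have "ritz_estimate j K \<eta> \<kappa> (t j) (\<phi> j)"
    if ritz: "ritz A N lam u n \<phi> t" and jn: "j \<le> n"
      and \<eta>: "\<And>i. 1 \<le> i \<Longrightarrow> i \<le> j \<Longrightarrow> \<exists>c. norm (u i - (\<Sum>k=1..n. c k *\<^sub>C \<phi> k)) \<le> \<eta>" "0 \<le> \<eta>" "\<eta> \<le> \<delta>"
      and \<kappa>: "\<And>h. \<exists>c. norm (R h - (\<Sum>k=1..n. c k *\<^sub>C \<phi> k)) \<le> \<kappa> * norm h" "0 \<le> \<kappa>"
    for n \<phi> t \<eta> \<kappa>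
  proof -
    interpret ritz A N lam u n \<phi> t by (rule ritz)
    have j': "j \<in> {1..n}" using jn j1 by simp
    have \<eta>': "norm (u i - P (u i)) \<le> \<eta>" if "1 \<le> i" "i \<le> j" for i
      using \<eta>(1)[OF that] P_le[of "u i"] by (meson order_trans)
    have \<kappa>': "norm (R h - P (R h)) \<le> \<kappa> * norm h" for h
      using \<kappa>(1)[of h] P_le[of "R h"] by (meson order_trans)
    have "\<eta>\<^sup>2 \<le> (sqrt (min \<theta> \<epsilon> / (2 * K0)))\<^sup>2"
      using \<eta>(2,3) by (intro power_mono) (auto simp: \<delta>_def)
    also have "\<dots> = min \<theta> \<epsilon> / (2 * K0)" using \<theta> \<epsilon>(1) K0 by simp
    finally have "K0 * \<eta>\<^sup>2 \<le> min \<theta> \<epsilon> / 2" using K0 by (simp add: field_simps)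
    then have K0\<eta>: "K0 * \<eta>\<^sup>2 \<le> \<theta> / 2" "K0 * \<eta>\<^sup>2 \<le> \<epsilon> / 2" by auto
    have t_le: "t j \<le> \<theta>" using ritz_le[OF j jn] by (simp add: \<theta>_def)
    have t_ge: "\<theta> - K0 * \<eta>\<^sup>2 \<le> t j" using ritz_ge[OF j jn \<eta>'] by (simp add: K0_def \<theta>_def)
    then have t_half: "\<theta> / 2 \<le> t j" using K0\<eta>(1) by simp
    obtain p where p: "T p = (1 / lam j) *\<^sub>R p"
      "\<forall>y. T y = (1 / lam j) *\<^sub>R y \<longrightarrow> inner y (\<phi> j - p) = 0"
      "norm (\<phi> j - p) \<le> (K1 + sqrt (Kc * (K0 + b * K1\<^sup>2))) * \<eta>"
      unfolding K0_def K1_def by (rule ritz_vector[OF j jn \<eta>' b(2,1) Kc]) blast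
    define v where "v = \<phi> j - p"
    have v_le: "norm v \<le> K2 * \<eta>" unfolding v_def K2_def
      by (rule order_trans[OF p(3)]) (use \<eta>(2) in \<open>auto intro: mult_right_mono\<close>)
    have Rv_le: "norm (R v) \<le> K3 * (\<kappa> * \<eta>)"
    proof -
      have "\<epsilon> / 2 * norm (R v) \<le> (\<epsilon> - (1 / lam j - t j)) * norm (R v)"
        using K0\<eta>(2) t_ge by (intro mult_right_mono) (auto simp: \<theta>_def)
      also have "\<dots> \<le> \<kappa> * (d * norm v)"
        unfolding v_def by (rule ritz_vector_R[OF j jn p(1) p(2)[rule_format] \<epsilon>(2) d(2) \<kappa>' \<kappa>(2)])
      also have "\<dots> \<le> \<kappa> * (d * (K2 * \<eta>))" using \<kappa>(2) d(1) v_le by (intro mult_left_mono) auto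
      finally show ?thesis using \<epsilon>(1) by (simp add: K3_def field_simps)
    qed
    have "K2 * \<eta> \<le> K2 * (1 / (2 * (K2 + 1)))"
      using \<eta>(3) K2 by (intro mult_left_mono) (auto simp: \<delta>_def)
    also have "\<dots> < 1" using K2 by (simp add: field_simps)
    finally have "norm v < 1" using v_le by simp
    then have p0: "p \<noteq> 0" using norm_\<phi>[OF j'] by (auto simp: v_def)
    define r where "r = norm (R p)"
    define \<rho> where "\<rho> = sqrt (t j)"
    have r0: "r > 0" using p0 R_inj by (auto simp: r_def)
    have "r\<^sup>2 = \<theta> * (norm p)\<^sup>2" using p(1) norm_R_sq[of p]
      by (simp add: r_def \<theta>_def power2_norm_eq_inner[of p])
    then have r: "norm p / r = 1 / sqrt \<theta>"
    proof -
      have "r = sqrt (\<theta> * (norm p)\<^sup>2)" using \<open>r\<^sup>2 = _\<close> r0 by (metis real_sqrt_unique less_imp_le)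
      then have "r = sqrt \<theta> * norm p" by (simp add: real_sqrt_mult)
      then show ?thesis using p0 by simp
    qed
    have \<rho>: "\<rho> > 0" "1 / \<rho> \<le> s"
    proof -
      have "sqrt (\<theta> / 2) \<le> \<rho>" unfolding \<rho>_def using t_half by (rule real_sqrt_le_mono)
      moreover have "sqrt (\<theta> / 2) > 0" using \<theta> by simp
      ultimately have "\<rho> > 0" "1 / \<rho> \<le> 1 / sqrt (\<theta> / 2)"
        by (rule less_le_trans[rotated], intro frac_le) auto
      then show "\<rho> > 0" "1 / \<rho> \<le> s" by (simp_all add: s_def real_sqrt_divide)
    qed
    have "\<rho> = norm (R (\<phi> j))"
    proof -
      have "(norm (R (\<phi> j)))\<^sup>2 = t j" using T\<phi>[OF j' j'] by (simp add: norm_R_sq flip: Re_cinner)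
      then show ?thesis unfolding \<rho>_def by (metis norm_ge_zero real_sqrt_unique)
    qed
    \<comment> \<open>The two normalizing factors differ by no more than the weak error itself, so
      rescaling p keeps the rate \<kappa> \<eta>.\<close>
    then have \<rho>r: "\<bar>\<rho> - r\<bar> \<le> norm (R v)"
      using norm_triangle_ineq3[of "R (\<phi> j)" "R p"] by (simp add: r_def v_def R.diff)
    define p' where "p' = (1 / r) *\<^sub>R p"
    have diff: "p' - (1 / \<rho>) *\<^sub>R \<phi> j = ((\<rho> - r) / (r * \<rho>)) *\<^sub>R p - (1 / \<rho>) *\<^sub>R v"
    proof -
      have "(\<rho> - r) / (r * \<rho>) = 1 / r - 1 / \<rho>" using r0 \<rho>(1) by (simp add: field_simps)
      then show ?thesis by (simp add: p'_def v_def scaleR_diff_left scaleR_diff_right)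
    qed
    have "norm (p' - (1 / \<rho>) *\<^sub>R \<phi> j) \<le> \<bar>\<rho> - r\<bar> / (r * \<rho>) * norm p + 1 / \<rho> * norm v"
      unfolding diff using norm_triangle_ineq4[of "((\<rho> - r) / (r * \<rho>)) *\<^sub>R p" "(1 / \<rho>) *\<^sub>R v"] r0 \<rho>(1)
      by simp
    also have "\<bar>\<rho> - r\<bar> / (r * \<rho>) * norm p = 1 / \<rho> * (\<bar>\<rho> - r\<bar> * (norm p / r))" by simp
    also have "\<dots> + 1 / \<rho> * norm v = 1 / \<rho> * (\<bar>\<rho> - r\<bar> * (norm p / r) + norm v)"
      by (simp add: distrib_left)
    also have "\<dots> \<le> s * (rb * norm v * (1 / sqrt \<theta>) + norm v)"
      unfolding r using \<rho> s \<theta> order_trans[OF \<rho>r rb(2)]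
      by (intro mult_mono add_mono mult_right_mono add_nonneg_nonneg mult_nonneg_nonneg) auto
    also have "\<dots> = s * (1 + rb / sqrt \<theta>) * norm v" by (simp add: algebra_simps)
    also have "\<dots> \<le> s * (1 + rb / sqrt \<theta>) * (K2 * \<eta>)"
      using s rb(1) \<theta> by (intro mult_left_mono v_le) (auto intro!: mult_nonneg_nonneg add_nonneg_nonneg)
    also have "\<dots> \<le> K * \<eta>"
      using K0 K_terms \<eta>(2) unfolding K_def mult.assoc[symmetric] by (intro mult_right_mono) auto
    finally have e1: "norm (p' - (1 / \<rho>) *\<^sub>R \<phi> j) \<le> K * \<eta>" .
    have "norm (R (p' - (1 / \<rho>) *\<^sub>R \<phi> j)) \<le> \<bar>\<rho> - r\<bar> / (r * \<rho>) * r + 1 / \<rho> * norm (R v)"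
      unfolding diff R.diff R.scale
      using norm_triangle_ineq4[of "((\<rho> - r) / (r * \<rho>)) *\<^sub>R R p" "(1 / \<rho>) *\<^sub>R R v"] r0 \<rho>(1)
      by (simp add: r_def)
    also have "\<dots> = 1 / \<rho> * (\<bar>\<rho> - r\<bar> + norm (R v))" using r0 by (simp add: add_divide_distrib)
    also have "\<dots> \<le> s * (norm (R v) + norm (R v))"
      using \<rho> s \<rho>r by (intro mult_mono add_mono) auto
    also have "\<dots> \<le> 2 * s * (K3 * (\<kappa> * \<eta>))" using Rv_le s by simp
    also have "\<dots> \<le> K * (\<kappa> * \<eta>)"
      using K0 K_terms \<eta>(2) \<kappa>(2) unfolding K_def mult.assoc[symmetric]
      by (intro mult_right_mono) auto
    finally have e2: "norm (R (p' - (1 / \<rho>) *\<^sub>R \<phi> j)) \<le> K * (\<kappa> * \<eta>)" .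
    have "T p' = (1 / lam j) *\<^sub>R p'" by (simp add: p'_def T.scale p(1))
    moreover have "norm (R p') = 1" using r0 by (simp add: p'_def R.scale r_def)
    moreover have "1 / lam j - K * \<eta>\<^sup>2 \<le> t j"
    proof -
      have "K0 * \<eta>\<^sup>2 \<le> K * \<eta>\<^sup>2" using K_terms by (intro mult_right_mono) (auto simp: K_def)
      with t_ge show ?thesis by (simp add: \<theta>_def)
    qed
    moreover have "1 / (2 * lam j) \<le> t j" using t_half by (simp add: \<theta>_def)
    ultimately show ?thesis using t_le e1 e2 unfolding \<rho>_def \<theta>_def by blast
  qed
  ultimately show ?thesis using that by blast
qed

end

section \<open>The harmonic Ritz method\<close>

lemma cspan_image_sum:
  fixes q :: "nat \<Rightarrow> 'a::complex_hilbert"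
  assumes "v \<in> cspan (q ` {1..n})"
  shows "\<exists>c. v = (\<Sum>k=1..n. c k *\<^sub>C q k)"
  using assms
proof (induction rule: complex_vector.span_induct_alt)
  case base
  show ?case by (intro exI[of _ "\<lambda>_. 0"]) simp
next
  case (step a x y)
  then obtain i c where i: "i \<in> {1..n}" "x = q i" and c: "y = (\<Sum>k=1..n. c k *\<^sub>C q k)" by blast
  have "a *\<^sub>C x = (\<Sum>k=1..n. (if k = i then a else 0) *\<^sub>C q k)"
  proof -
    have "(\<Sum>k=1..n. (if k = i then a else 0) *\<^sub>C q k) = (\<Sum>k=1..n. if k = i then a *\<^sub>C q k else 0)"
      by (rule sum.cong) auto
    then show ?thesis using i by simp
  qed
  then have "a *\<^sub>C x + y = (\<Sum>k=1..n. ((if k = i then a else 0) + c k) *\<^sub>C q k)"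
    unfolding c by (simp only: complex_vector.scale_left_distrib sum.distrib)
  then show ?case by (rule exI[of _ "\<lambda>k. (if k = i then a else 0) + c k"])
qed

text \<open>Dimension count: otherwise the remainder z, taken as index 0, and the vectors e_k would
  be n + 1 nonzero orthogonal vectors in the span of n vectors w_i.\<close>

lemma (in ip) orthonormal_expansion:
  assumes e: "orthonormal_on g {1..n} e"
    and e_span: "\<And>k. k \<in> {1..n} \<Longrightarrow> \<exists>c. e k = (\<Sum>i=1..n. c i *\<^sub>C w i)"
    and x: "\<exists>c. x = (\<Sum>i=1..n. c i *\<^sub>C w i)"
  shows "x = (\<Sum>k=1..n. g (e k) x *\<^sub>C e k)"
proof (rule ccontr)
  assume neq: "x \<noteq> (\<Sum>k=1..n. g (e k) x *\<^sub>C e k)"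
  define z where "z = x - (\<Sum>k=1..n. g (e k) x *\<^sub>C e k)"
  define v where "v k = (if k = 0 then z else e k)" for k :: nat
  obtain E where E: "\<And>k. k \<in> {1..n} \<Longrightarrow> e k = (\<Sum>i=1..n. E k i *\<^sub>C w i)"
    using e_span by metis
  obtain c where c: "x = (\<Sum>i=1..n. c i *\<^sub>C w i)" using x by blast
  have orth: "g (e k) z = 0" if "k \<in> {1..n}" for k
    using orthonormal_coeff[OF e, of "{1..n}" k "\<lambda>k. g (e k) x"] that
    by (simp add: z_def diff_right)
  have "z = (\<Sum>i=1..n. (c i - (\<Sum>k=1..n. g (e k) x * E k i)) *\<^sub>C w i)"
  proof -
    have "(\<Sum>k=1..n. g (e k) x *\<^sub>C e k) = (\<Sum>k=1..n. \<Sum>i=1..n. (g (e k) x * E k i) *\<^sub>C w i)"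
      by (rule sum.cong) (auto simp: E complex_vector.scale_sum_right complex_vector.scale_scale
          intro!: arg_cong2[of _ _ _ _ scaleC] arg_cong[of _ _ "g _"] sum.cong)
    also have "\<dots> = (\<Sum>i=1..n. (\<Sum>k=1..n. g (e k) x * E k i) *\<^sub>C w i)"
      by (subst sum.swap) (simp add: complex_vector.scale_sum_left)
    finally show ?thesis unfolding z_def by (subst c)
      (simp add: complex_vector.scale_left_diff_distrib sum_subtractf)
  qed
  then obtain Z where Z: "z = (\<Sum>i=1..n. Z i *\<^sub>C w i)" by (rule that)
  define M where "M i k = (if k = 0 then Z i else E k i)" for i k :: nat
  have v: "v k = (\<Sum>i=1..n. M i k *\<^sub>C w i)" if "k \<in> {0..n}" for k
    using E[of k] Z that by (auto simp: v_def M_def)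
  obtain a where a: "\<exists>k\<in>{0..n}. a k \<noteq> 0" "\<forall>i<n. (\<Sum>k=0..n. M (Suc i) k * a k) = 0"
    using underdetermined_system[of "{0..n}" n "\<lambda>i. M (Suc i)"] by auto
  have "(\<Sum>k=0..n. a k *\<^sub>C v k) = (\<Sum>k=0..n. \<Sum>i=1..n. (M i k * a k) *\<^sub>C w i)"
    by (rule sum.cong) (auto simp: v complex_vector.scale_sum_right complex_vector.scale_scale mult.commute)
  also have "\<dots> = (\<Sum>i=1..n. (\<Sum>k=0..n. M i k * a k) *\<^sub>C w i)"
    by (subst sum.swap) (simp add: complex_vector.scale_sum_left)
  also have "\<dots> = 0"
  proof (rule sum.neutral, rule ballI)
    fix i assume "i \<in> {1..n}"
    then have "(\<Sum>k=0..n. M i k * a k) = 0" using a(2)[rule_format, of "i - 1"] by auto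
    then show "(\<Sum>k=0..n. M i k * a k) *\<^sub>C w i = 0" by simp
  qed
  finally have sum0: "(\<Sum>k=0..n. a k *\<^sub>C v k) = 0" .
  have v_orth: "g (v i) (v k) = (if i = k then g (v i) (v i) else 0)"
    if ik: "i \<in> {0..n}" "k \<in> {0..n}" for i k
  proof (cases "i = k")
    case False
    consider "i = 0" "k \<in> {1..n}" | "k = 0" "i \<in> {1..n}" | "i \<in> {1..n}" "k \<in> {1..n}"
      using ik False by force
    then show ?thesis
    proof cases
      case 1
      then show ?thesis using orth[of k] conj[of z "e k"] by (simp add: v_def)
    next
      case 2
      then show ?thesis using orth[of i] by (simp add: v_def)
    next
      case 3
      then show ?thesis using e False by (simp add: v_def orthonormal_on_def)
    qed
  qed simp
  have "a i = 0" if i: "i \<in> {0..n}" for i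
  proof -
    have "0 = g (v i) (\<Sum>k=0..n. a k *\<^sub>C v k)" by (simp add: sum0)
    also have "\<dots> = (\<Sum>k=0..n. if i = k then a i * g (v i) (v i) else 0)"
      unfolding sum_right by (rule sum.cong) (use v_orth[OF i] in \<open>auto simp: scaleC_right\<close>)
    also have "\<dots> = a i * g (v i) (v i)" using i by simp
    finally have "a i = 0 \<or> g (v i) (v i) = 0" by simp
    moreover have "v i \<noteq> 0"
    proof (cases "i = 0")
      case True
      then show ?thesis using neq by (simp add: v_def z_def)
    next
      case False
      then have "g (e i) (e i) = 1" using e i by (simp add: orthonormal_on_def)
      then show ?thesis using False by (auto simp: v_def)
    qed
    ultimately show ?thesis using self[of "v i"] norm_zero_iff by simp
  qed
  with a(1) show False by blast
qed

lemma smalloI_bound: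
  fixes f G :: "nat \<Rightarrow> real"
  assumes "\<forall>\<^sub>F n in sequentially. \<bar>f n\<bar> \<le> h n * G n" "h \<longlonglongrightarrow> 0" "\<And>n. 0 \<le> G n"
  shows "f \<in> o(G)"
proof (rule landau_o.smallI)
  fix c :: real assume "c > 0"
  then have "\<forall>\<^sub>F n in sequentially. h n < c" using assms(2) by (intro order_tendstoD(2))
  with assms(1) show "\<forall>\<^sub>F n in sequentially. norm (f n) \<le> c * norm (G n)"
  proof eventually_elim
    case (elim n)
    then have "\<bar>f n\<bar> \<le> c * G n" using assms(3)[of n] by (meson less_imp_le mult_right_mono order_trans)
    then show ?case using assms(3)[of n] by simp
  qed
qed

locale harmonic_ritz = pd_op_eigen A N lam u + comparison A g mu q
  for A :: "'h::complex_hilbert operator" and N lam u g mu q +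
  fixes Lam :: "nat \<Rightarrow> nat \<Rightarrow> real" and U :: "nat \<Rightarrow> nat \<Rightarrow> 'h"
  assumes Ritz: "harmonic_ritz_pairs A q n (Lam n) (U n)"
begin

text \<open>The harmonic Ritz method for \<open>A\<close> with trial vectors \<open>q\<^sub>k\<close> is the Ritz method for \<open>T = A\<^sup>-\<^sup>1\<close> with
  trial vectors \<open>A q\<^sub>k\<close>.\<close>

lemma ritz_obtain:
  obtains \<phi> where "ritz A N lam u n \<phi> (\<lambda>i. 1 / Lam n i)"
    "\<And>i. i \<in> {1..n} \<Longrightarrow> 0 < Lam n i"
    "\<And>i. i \<in> {1..n} \<Longrightarrow> U n i = T (sqrt (Lam n i) *\<^sub>R \<phi> i)"
    "\<And>p. T p \<in> trial n \<Longrightarrow> p = (\<Sum>k=1..n. cinner (\<phi> k) p *\<^sub>C \<phi> k)"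
    "\<And>i. i \<in> {1..n} \<Longrightarrow> T (\<phi> i) \<in> trial n"
proof -
  note R = Ritz[of n, unfolded harmonic_ritz_pairs_def]
  have U_span: "U n i \<in> trial n" if "i \<in> {1..n}" for i
  proof -
    obtain x where "U n i = (\<Sum>j=1..n. x j *\<^sub>C q j)" using R \<open>i \<in> _\<close> by blast
    then show ?thesis
      by (simp only:) (intro complex_vector.span_sum complex_vector.span_scale complex_vector.span_base, auto)
  qed
  have "\<exists>f. U n i = T f" if "i \<in> {1..n}" for i by (rule cspan_range[OF U_span[OF that]])
  then obtain f where f: "\<And>i. i \<in> {1..n} \<Longrightarrow> U n i = T (f i)" by metis
  have f1: "cinner (f i) (T (f k)) = (if i = k then 1 else 0)"
    and f2: "cinner (f i) (f k) = (if i = k then complex_of_real (Lam n i) else 0)"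
    if "i \<in> {1..n}" "k \<in> {1..n}" for i k
  proof -
    have "H_inner A 1 (U n i) (U n k) = (if i = k then 1 else 0)"
      "H_inner A 2 (U n i) (U n k) = (if i = k then complex_of_real (Lam n i) else 0)"
      using R that by blast+
    then show "cinner (f i) (T (f k)) = (if i = k then 1 else 0)"
      "cinner (f i) (f k) = (if i = k then complex_of_real (Lam n i) else 0)"
      by (simp_all only: f[OF that(1)] f[OF that(2)] H_inner_T)
  qed
  have Lam: "0 < Lam n i" if i: "i \<in> {1..n}" for i
  proof -
    have "f i \<noteq> 0" using f1[OF i i] by auto
    moreover have "(norm (f i))\<^sup>2 = Lam n i"
      using f2[OF i i] by (simp add: power2_norm_eq_inner flip: Re_cinner)
    ultimately show ?thesis by (metis norm_eq_zero zero_less_power2)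
  qed
  \<comment> \<open>The f i are normalized for the form of T; division by sqrt Lam makes them
    orthonormal in the space itself and turns the diagonal of that form into 1 / Lam.\<close>
  define \<phi> where "\<phi> i = (1 / sqrt (Lam n i)) *\<^sub>R f i" for i
  have orth: "orthonormal_on cinner {1..n} \<phi>"
    unfolding orthonormal_on_def
  proof (intro ballI)
    fix i k assume ik: "i \<in> {1..n}" "k \<in> {1..n}"
    have "complex_of_real (sqrt (Lam n i)) * complex_of_real (sqrt (Lam n i)) = complex_of_real (Lam n i)"
      using Lam[OF ik(1)] by (simp flip: of_real_mult)
    then show "cinner (\<phi> i) (\<phi> k) = (if i = k then 1 else 0)"
      using f2[OF ik] Lam[OF ik(1)] unfolding \<phi>_def scaleC_of_real[symmetric]
      by (cases "i = k") (auto simp: cinner.scaleC_left cinner.scaleC_right)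
  qed
  show ?thesis
  proof (rule that[of \<phi>])
    show "ritz A N lam u n \<phi> (\<lambda>i. 1 / Lam n i)"
    proof (unfold_locales)
      show "orthonormal_on cinner {1..n} \<phi>" by (rule orth)
      fix i k assume ik: "i \<in> {1..n}" "k \<in> {1..n}"
      have "complex_of_real (sqrt (Lam n i)) * complex_of_real (sqrt (Lam n i)) = complex_of_real (Lam n i)"
        using Lam[OF ik(1)] by (simp flip: of_real_mult)
      then show "cinner (\<phi> i) (T (\<phi> k)) = (if i = k then complex_of_real (1 / Lam n i) else 0)"
        using f1[OF ik] unfolding \<phi>_def scaleC_of_real[symmetric] T_scaleC
        by (cases "i = k") (auto simp: cinner.scaleC_left cinner.scaleC_right)
    next
      fix i k assume ik: "1 \<le> i" "i \<le> k" "k \<le> n"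
      then have "Lam n i \<le> Lam n k" using R by (auto simp: mono_on_def)
      then show "1 / Lam n k \<le> 1 / Lam n i" using Lam[of i] ik by (simp add: frac_le)
    qed
    show "0 < Lam n i" if "i \<in> {1..n}" for i by (rule Lam[OF that])
    show "U n i = T (sqrt (Lam n i) *\<^sub>R \<phi> i)" if "i \<in> {1..n}" for i
      using f[OF that] Lam[OF that] by (simp add: \<phi>_def)
    show T\<phi>: "T (\<phi> i) \<in> trial n" if "i \<in> {1..n}" for i
      unfolding \<phi>_def scaleC_of_real[symmetric] T_scaleC f[OF that, symmetric]
      by (rule complex_vector.span_scale[OF U_span[OF that]])
    \<comment> \<open>The w_k = A q_k span the trial space of T, and n orthonormal vectors in the
      span of n vectors exhaust it.\<close>
    have "\<exists>w. q k = T w" if "k \<in> {1..n}" for k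
      using that by (intro cspan_range complex_vector.span_base) blast
    then obtain w where w: "\<And>k. k \<in> {1..n} \<Longrightarrow> q k = T (w k)" by metis
    have in_span: "\<exists>c. p = (\<Sum>k=1..n. c k *\<^sub>C w k)" if p: "T p \<in> trial n" for p
    proof -
      obtain c where "T p = (\<Sum>k=1..n. c k *\<^sub>C q k)" using cspan_image_sum[OF p] by blast
      also have "\<dots> = (\<Sum>k=1..n. c k *\<^sub>C T (w k))" by (rule sum.cong) (auto simp: w)
      also have "\<dots> = T (\<Sum>k=1..n. c k *\<^sub>C w k)"
        unfolding T.sum T_scaleC ..
      finally have "T (p - (\<Sum>k=1..n. c k *\<^sub>C w k)) = 0" by (simp add: T.diff)
      then have "p - (\<Sum>k=1..n. c k *\<^sub>C w k) = 0" by (rule T_inj)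
      then have "p = (\<Sum>k=1..n. c k *\<^sub>C w k)" by simp
      then show ?thesis by (rule exI[of _ c])
    qed
    show "p = (\<Sum>k=1..n. cinner (\<phi> k) p *\<^sub>C \<phi> k)" if "T p \<in> trial n" for p
      by (rule cinner.orthonormal_expansion[OF orth in_span[OF T\<phi>] in_span[OF that]])
  qed
qed

text \<open>In the coordinate f, \<open>H_inner A 2\<close> is the inner product of the space, so
  the projection becomes P. Duality is applied to an approximant of \<open>R (R e)\<close>, and best
  approximation then replaces P f by the given p.\<close>

lemma projection_error:
  assumes C: "\<And>h. \<exists>p. T p \<in> trial n \<and> norm (R h - p) \<le> \<kappa> * norm h" "0 \<le> \<kappa>"
    and p: "T p \<in> trial n"
  shows "H_norm A 1 (T f - orth_proj (H_inner A 2) (trial n) (T f)) \<le> \<kappa> * norm (f - p)"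
proof -
  obtain \<phi> where trial: "ritz A N lam u n \<phi> (\<lambda>i. 1 / Lam n i)"
    "\<And>p. T p \<in> trial n \<Longrightarrow> p = (\<Sum>k=1..n. cinner (\<phi> k) p *\<^sub>C \<phi> k)"
    "\<And>i. i \<in> {1..n} \<Longrightarrow> T (\<phi> i) \<in> trial n"
    by (rule ritz_obtain) blast
  interpret ritz A N lam u n \<phi> "\<lambda>i. 1 / Lam n i" by (rule trial(1))
  have P_id: "P p = p" if "T p \<in> trial n" for p using trial(2)[OF that] by (simp add: P_def)
  have "T (P f) \<in> trial n"
    unfolding P_def T.sum T_scaleC
    by (intro complex_vector.span_sum complex_vector.span_scale trial(3))
  moreover have orth: "H_inner A 2 x (T f - T (P f)) = 0" if x: "x \<in> trial n" for x
  proof -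
    obtain h where h: "x = T h" using cspan_range[OF x] by blast
    have "cinner h (f - P f) = 0"
      using cinner_P_left[of h f] P_id[of h] x h by (simp add: cinner.diff_right)
    then show ?thesis by (simp add: h H_inner_T flip: T.diff)
  qed
  ultimately have "orth_proj (H_inner A 2) (trial n) (T f) = T (P f)"
    unfolding orth_proj_def
  proof (intro the_equality conjI ballI)
    fix p' assume p': "p' \<in> trial n \<and> (\<forall>x\<in>trial n. H_inner A 2 x (T f - p') = 0)"
    then obtain h where h: "p' = T h" using cspan_range by blast
    let ?x = "T (P f) - p'"
    have x: "?x \<in> trial n" using \<open>T (P f) \<in> _\<close> p' by (simp add: complex_vector.span_diff)
    have "H_inner A 2 ?x (T f - p') = 0" "H_inner A 2 ?x (T f - T (P f)) = 0" using p' orth x by auto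
    then have "cinner (P f - h) (f - h) = 0" "cinner (P f - h) (f - P f) = 0"
      by (simp_all add: h H_inner_T flip: T.diff)
    then have "cinner (P f - h) (P f - h) = 0" by (simp add: cinner.diff_right)
    then have "inner (P f - h) (P f - h) = 0" by (simp flip: Re_cinner)
    then show "p' = T (P f)" using h by simp
  qed auto
  then have "H_norm A 1 (T f - orth_proj (H_inner A 2) (trial n) (T f)) = norm (R (f - P f))"
    by (simp add: H_norm_T del: One_nat_def flip: T.diff)
  also have "norm (R (f - P f)) \<le> \<kappa> * norm (f - P f)"
  proof -
    let ?e = "f - P f"
    obtain p' where p': "T p' \<in> trial n" "norm (R (R ?e) - p') \<le> \<kappa> * norm (R ?e)" using C(1) by blast
    have "(norm (R ?e))\<^sup>2 = inner ?e (R (R ?e))" by (simp add: norm_R_sq RR)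
    also have "\<dots> = inner ?e (R (R ?e) - p')"
      using inner_P[of p' f] P_id[OF p'(1)] by (simp add: inner_diff_right inner_commute)
    also have "\<dots> \<le> norm ?e * (\<kappa> * norm (R ?e))"
      by (rule order_trans[OF norm_cauchy_schwarz mult_left_mono[OF p'(2)]]) simp
    finally have "norm (R ?e) * norm (R ?e) \<le> norm (R ?e) * (\<kappa> * norm ?e)"
      by (simp add: power2_eq_square mult_ac)
    then show ?thesis using C(2) by (cases "norm (R ?e) = 0") (simp_all add: mult_le_cancel_left)
  qed
  also have "\<dots> \<le> \<kappa> * norm (f - p)"
    by (intro mult_left_mono best_approximation P_id p C)
  finally show ?thesis .
qed

lemma mu_powr_sq: "(mu (n + 1) powr (- 1/2) * mu (n + 1) powr (1 - \<sigma>))\<^sup>2 = mu (n + 1) powr (1 - 2 * \<sigma>)"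
  unfolding power2_eq_square powr_add[symmetric]
  by (rule arg_cong[of _ _ "\<lambda>x. mu (n + 1) powr x"]) simp

lemma projection_rate:
  assumes \<sigma>: "1 \<le> \<sigma>" and v: "v \<in> Domain (eigen_power g mu q \<sigma>)"
  shows "(\<lambda>n. (H_norm A 1 (v - orth_proj (H_inner A 2) (trial n) v))\<^sup>2)
    \<in> o(\<lambda>n. mu (n + 1) powr (1 - 2 * \<sigma>))"
proof -
  obtain y where y: "(v, y) \<in> eigen_power g mu q \<sigma>" using v by blast
  obtain C where C: "C > 0" "\<And>\<sigma> x y. 1 \<le> \<sigma> \<Longrightarrow> (x, y) \<in> eigen_power g mu q \<sigma> \<Longrightarrow>
    approximable C \<sigma> x y"
    by (rule approximation) blast
  obtain C' where C': "C' > 0" "\<And>h n. \<exists>p. T p \<in> trial n \<and>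
    norm (R h - p) \<le> C' * mu (n + 1) powr (- 1/2) * norm h" by (rule approximation_R) blast
  obtain f \<tau> where f: "v = T f" "\<tau> \<longlonglongrightarrow> 0" "\<And>n. 0 \<le> \<tau> n"
    "\<And>n. \<exists>p. T p \<in> trial n \<and> norm (f - p) \<le> C * mu (n + 1) powr (1 - \<sigma>) * \<tau> n"
    using C(2)[OF \<sigma> y] by blast
  show ?thesis
  proof (rule smalloI_bound[OF always_eventually, rule_format])
    fix n
    let ?x = "H_norm A 1 (v - orth_proj (H_inner A 2) (trial n) v)"
    obtain p where p: "T p \<in> trial n" "norm (f - p) \<le> C * mu (n + 1) powr (1 - \<sigma>) * \<tau> n"
      using f(4) by blast
    have "?x \<le> C' * mu (n + 1) powr (- 1/2) * norm (f - p)"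
      unfolding f(1) by (rule projection_error[OF C'(2) _ p(1)]) (use C'(1) in simp)
    also have "\<dots> \<le> C' * mu (n + 1) powr (- 1/2) * (C * mu (n + 1) powr (1 - \<sigma>) * \<tau> n)"
      using C'(1) by (intro mult_left_mono p) simp
    finally have "?x\<^sup>2 \<le> (C' * mu (n + 1) powr (- 1/2) * (C * mu (n + 1) powr (1 - \<sigma>) * \<tau> n))\<^sup>2"
      by (rule power_mono) (simp add: H_norm_def)
    also have "\<dots> = (C' * C * \<tau> n)\<^sup>2 * (mu (n + 1) powr (- 1/2) * mu (n + 1) powr (1 - \<sigma>))\<^sup>2"
      by (simp add: power_mult_distrib mult_ac)
    finally show "\<bar>?x\<^sup>2\<bar> \<le> (C' * C * \<tau> n)\<^sup>2 * mu (n + 1) powr (1 - 2 * \<sigma>)"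
      unfolding mu_powr_sq by simp
  next
    have "(\<lambda>n. (C' * C * \<tau> n)\<^sup>2) \<longlonglongrightarrow> (C' * C * 0)\<^sup>2" by (intro tendsto_intros f)
    then show "(\<lambda>n. (C' * C * \<tau> n)\<^sup>2) \<longlonglongrightarrow> 0" by simp
  qed simp
qed

text \<open>A single \<omega> bounds both errors, so that one choice of w serves both norms.\<close>

definition near_eigenvector :: "real \<Rightarrow> real \<Rightarrow> nat \<Rightarrow> nat \<Rightarrow> 'h \<Rightarrow> bool" where
  "near_eigenvector \<sigma> \<omega> n j w \<longleftrightarrow> w \<in> eigenspace A (complex_of_real (lam j)) \<and> H_norm A 1 w = 1 \<and>
      H_norm A 2 (w - U n j) \<le> \<omega> * mu (n + 1) powr (1 - \<sigma>) \<and>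
      (H_norm A 1 (w - U n j))\<^sup>2 \<le> \<omega> * mu (n + 1) powr (1 - 2 * \<sigma>)"

lemma ritz_rate:
  assumes \<sigma>: "1 \<le> \<sigma>" and j: "j \<in> I"
    and u: "\<And>i. 1 \<le> i \<Longrightarrow> i \<le> j \<Longrightarrow> u i \<in> Domain (eigen_power g mu q \<sigma>)"
  obtains \<omega> where "\<omega> \<longlonglongrightarrow> 0" "\<forall>\<^sub>F n in sequentially. 0 \<le> \<omega> n \<and>
    \<bar>Lam n j - lam j\<bar> \<le> \<omega> n * mu (n + 1) powr (2 - 2 * \<sigma>) \<and>
    Ex (near_eigenvector \<sigma> (\<omega> n) n j)"
proof -
  obtain C where C: "C > 0" "\<And>\<sigma> x y. 1 \<le> \<sigma> \<Longrightarrow> (x, y) \<in> eigen_power g mu q \<sigma> \<Longrightarrow>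
    approximable C \<sigma> x y"
    by (rule approximation) blast
  obtain C' where C': "C' > 0" "\<And>h n. \<exists>p. T p \<in> trial n \<and>
    norm (R h - p) \<le> C' * mu (n + 1) powr (- 1/2) * norm h" by (rule approximation_R) blast
  have lj: "0 < lam j" by (rule lam_pos[OF j])
  have "\<exists>\<tau>. \<tau> \<longlonglongrightarrow> 0 \<and> (\<forall>n. 0 \<le> \<tau> n \<and> (\<exists>p. T p \<in> trial n \<and>
      norm (u i - p) \<le> mu (n + 1) powr (1 - \<sigma>) * \<tau> n))" if i: "i \<in> {1..j}" for i
  proof -
    have iI: "i \<in> I" using I_downward[OF j] i by auto
    have li: "0 < lam i" by (rule lam_pos[OF iI])
    obtain y where "(u i, y) \<in> eigen_power g mu q \<sigma>" using u[of i] i by auto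
    from C(2)[OF \<sigma> this] obtain f \<tau> where f: "u i = T f" "\<tau> \<longlonglongrightarrow> 0" "\<And>n. 0 \<le> \<tau> n"
      "\<And>n. \<exists>p. T p \<in> trial n \<and> norm (f - p) \<le> C * mu (n + 1) powr (1 - \<sigma>) * \<tau> n"
      by blast
    \<comment> \<open>Here f = A u_i is a multiple of u_i, so rescaled approximants of f approximate
      u_i itself, as \<open>ritz_convergence\<close> asks.\<close>
    have "T ((1 / lam i) *\<^sub>R f - u i) = 0" using T_u[OF iI] by (simp add: T.diff T.scale flip: f(1))
    then have uf: "u i = (1 / lam i) *\<^sub>R f" using T_inj by fastforce
    have "\<exists>p. T p \<in> trial n \<and> norm (u i - p) \<le> mu (n + 1) powr (1 - \<sigma>) * (C / lam i * \<tau> n)" for n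
    proof -
      obtain p where p: "T p \<in> trial n" "norm (f - p) \<le> C * mu (n + 1) powr (1 - \<sigma>) * \<tau> n"
        using f(4) by blast
      have "u i - (1 / lam i) *\<^sub>R p = (1 / lam i) *\<^sub>R (f - p)" by (simp add: uf scaleR_diff_right)
      then have "norm (u i - (1 / lam i) *\<^sub>R p) = (1 / lam i) * norm (f - p)" using li by simp
      also have "\<dots> \<le> (1 / lam i) * (C * mu (n + 1) powr (1 - \<sigma>) * \<tau> n)"
        using li by (intro mult_left_mono p) simp
      finally have "norm (u i - (1 / lam i) *\<^sub>R p) \<le> mu (n + 1) powr (1 - \<sigma>) * (C / lam i * \<tau> n)"
        by (simp add: mult_ac)
      moreover have "T ((1 / lam i) *\<^sub>R p) \<in> trial n"
        unfolding scaleC_of_real[symmetric] T_scaleC by (rule complex_vector.span_scale[OF p(1)])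
      ultimately show ?thesis by blast
    qed
    moreover have "(\<lambda>n. C / lam i * \<tau> n) \<longlonglongrightarrow> 0" by (rule tendsto_mult_right_zero[OF f(2)])
    ultimately show ?thesis using f(3) C(1) li by (intro exI[of _ "\<lambda>n. C / lam i * \<tau> n"]) auto
  qed
  then obtain \<tau> where \<tau>: "\<And>i. i \<in> {1..j} \<Longrightarrow> \<tau> i \<longlonglongrightarrow> 0" "\<And>i n. i \<in> {1..j} \<Longrightarrow> 0 \<le> \<tau> i n"
    "\<And>i n. i \<in> {1..j} \<Longrightarrow> \<exists>p. T p \<in> trial n \<and> norm (u i - p) \<le> mu (n + 1) powr (1 - \<sigma>) * \<tau> i n"
    by metis
  \<comment> \<open>The sum over the finitely many i is a null sequence dominating each of
    them.\<close>
  define \<tau>' where "\<tau>' n = (\<Sum>i=1..j. \<tau> i n)" for n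
  have \<tau>'_lim: "\<tau>' \<longlonglongrightarrow> 0"
    unfolding \<tau>'_def using tendsto_sum[of "{1..j}" \<tau> "\<lambda>_. 0"] \<tau>(1) by simp
  have \<tau>'0: "0 \<le> \<tau>' n" for n unfolding \<tau>'_def by (rule sum_nonneg) (rule \<tau>(2))
  define \<eta> where "\<eta> n = mu (n + 1) powr (1 - \<sigma>) * \<tau>' n" for n
  define \<kappa> where "\<kappa> n = C' * mu (n + 1) powr (- 1/2)" for n
  have \<eta>0: "0 \<le> \<eta> n" and \<kappa>0: "0 \<le> \<kappa> n" for n using \<tau>'0 C'(1) by (auto simp: \<eta>_def \<kappa>_def)
  have u_approx: "\<exists>p. T p \<in> trial n \<and> norm (u i - p) \<le> \<eta> n" if "i \<in> {1..j}" for i n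
  proof -
    have "mu (n + 1) powr (1 - \<sigma>) * \<tau> i n \<le> \<eta> n"
      unfolding \<eta>_def \<tau>'_def using that \<tau>(2) by (intro mult_left_mono member_le_sum) auto
    then show ?thesis using \<tau>(3)[OF that, of n] by (meson order_trans)
  qed
  have \<eta>_lim: "\<eta> \<longlonglongrightarrow> 0"
  proof (rule Lim_null_comparison)
    show "\<forall>\<^sub>F n in sequentially. norm (\<eta> n) \<le> mu 1 powr (1 - \<sigma>) * \<tau>' n"
    proof (rule always_eventually, rule allI)
      fix n
      have "mu (n + 1) powr (1 - \<sigma>) \<le> mu 1 powr (1 - \<sigma>)"
        by (rule powr_mono2') (use \<sigma> mu_1 mu_le[of 1 "n + 1"] in auto)
      then show "norm (\<eta> n) \<le> mu 1 powr (1 - \<sigma>) * \<tau>' n"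
        using \<eta>0[of n] \<tau>'0[of n] by (simp add: \<eta>_def mult_right_mono)
    qed
    show "(\<lambda>n. mu 1 powr (1 - \<sigma>) * \<tau>' n) \<longlonglongrightarrow> 0" using tendsto_mult_right_zero[OF \<tau>'_lim] by simp
  qed
  obtain K \<delta> where K: "K > 0" "\<delta> > 0" "\<And>n \<phi> t \<eta> \<kappa>. ritz A N lam u n \<phi> t \<Longrightarrow> j \<le> n \<Longrightarrow>
    (\<And>i. 1 \<le> i \<Longrightarrow> i \<le> j \<Longrightarrow> \<exists>c. norm (u i - (\<Sum>k=1..n. c k *\<^sub>C \<phi> k)) \<le> \<eta>) \<Longrightarrow> 0 \<le> \<eta> \<Longrightarrow> \<eta> \<le> \<delta> \<Longrightarrow>
    (\<And>h. \<exists>c. norm (R h - (\<Sum>k=1..n. c k *\<^sub>C \<phi> k)) \<le> \<kappa> * norm h) \<Longrightarrow> 0 \<le> \<kappa> \<Longrightarrow>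
    ritz_estimate j K \<eta> \<kappa> (t j) (\<phi> j)"
    by (rule ritz_convergence[OF j]) blast
  \<comment> \<open>The summands belong to the Ritz value, the strong norm and the squared weak
    norm; \<open>2 * (lam j)\<^sup>2\<close> comes from returning from 1 / Lam to Lam with Lam <= 2
    \<open>lam j\<close>.\<close>
  define \<omega> where "\<omega> n = 2 * (lam j)\<^sup>2 * K * (\<tau>' n)\<^sup>2 + K * \<tau>' n + (K * C' * \<tau>' n)\<^sup>2" for n
  have \<omega>_lim: "\<omega> \<longlonglongrightarrow> 0"
  proof -
    have "\<omega> \<longlonglongrightarrow> 2 * (lam j)\<^sup>2 * K * 0\<^sup>2 + K * 0 + (K * C' * 0)\<^sup>2"
      unfolding \<omega>_def by (intro tendsto_intros \<tau>'_lim)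
    then show ?thesis by simp
  qed
  have \<omega>_ge: "2 * (lam j)\<^sup>2 * K * (\<tau>' n)\<^sup>2 \<le> \<omega> n" "K * \<tau>' n \<le> \<omega> n" "(K * C' * \<tau>' n)\<^sup>2 \<le> \<omega> n" "0 \<le> \<omega> n" for n
  proof -
    have "0 \<le> 2 * (lam j)\<^sup>2 * K * (\<tau>' n)\<^sup>2" "0 \<le> K * \<tau>' n" "0 \<le> (K * C' * \<tau>' n)\<^sup>2"
      using K(1) \<tau>'0[of n] by auto
    then show "2 * (lam j)\<^sup>2 * K * (\<tau>' n)\<^sup>2 \<le> \<omega> n" "K * \<tau>' n \<le> \<omega> n" "(K * C' * \<tau>' n)\<^sup>2 \<le> \<omega> n" "0 \<le> \<omega> n"
      unfolding \<omega>_def by linarith+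
  qed
  have "\<forall>\<^sub>F n in sequentially. \<eta> n < \<delta>" using \<eta>_lim K(2) by (rule order_tendstoD(2))
  moreover have "\<forall>\<^sub>F n in sequentially. j \<le> n" by (rule eventually_ge_at_top)
  ultimately have "\<forall>\<^sub>F n in sequentially. 0 \<le> \<omega> n \<and>
    \<bar>Lam n j - lam j\<bar> \<le> \<omega> n * mu (n + 1) powr (2 - 2 * \<sigma>) \<and>
    Ex (near_eigenvector \<sigma> (\<omega> n) n j)"
  proof eventually_elim
    case (elim n)
    obtain \<phi> where \<phi>: "ritz A N lam u n \<phi> (\<lambda>i. 1 / Lam n i)" "\<And>i. i \<in> {1..n} \<Longrightarrow> 0 < Lam n i"
      "\<And>i. i \<in> {1..n} \<Longrightarrow> U n i = T (sqrt (Lam n i) *\<^sub>R \<phi> i)"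
      "\<And>p. T p \<in> trial n \<Longrightarrow> p = (\<Sum>k=1..n. cinner (\<phi> k) p *\<^sub>C \<phi> k)"
      by (rule ritz_obtain) blast
    have jn: "j \<in> {1..n}" using j elim(2) by simp
    have L: "0 < Lam n j" by (rule \<phi>(2)[OF jn])
    have "ritz_estimate j K (\<eta> n) (\<kappa> n) (1 / Lam n j) (\<phi> j)"
    proof (rule K(3)[OF \<phi>(1) elim(2) _ \<eta>0 less_imp_le[OF elim(1)] _ \<kappa>0])
      show "\<exists>c. norm (u i - (\<Sum>k=1..n. c k *\<^sub>C \<phi> k)) \<le> \<eta> n" if "1 \<le> i" "i \<le> j" for i
        using u_approx[of i n] \<phi>(4) that by (metis atLeastAtMost_iff)
      show "\<exists>c. norm (R h - (\<Sum>k=1..n. c k *\<^sub>C \<phi> k)) \<le> \<kappa> n * norm h" for h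
        using C'(2)[of n h] \<phi>(4) unfolding \<kappa>_def by metis
    qed
    then obtain p where p: "T p = (1 / lam j) *\<^sub>R p" "norm (R p) = 1"
      "norm (p - sqrt (Lam n j) *\<^sub>R \<phi> j) \<le> K * \<eta> n"
      "norm (R (p - sqrt (Lam n j) *\<^sub>R \<phi> j)) \<le> K * (\<kappa> n * \<eta> n)"
      and t: "1 / (2 * lam j) \<le> 1 / Lam n j" "1 / Lam n j \<le> 1 / lam j" "1 / lam j - K * (\<eta> n)\<^sup>2 \<le> 1 / Lam n j"
      by (auto simp: real_sqrt_divide)
    have \<eta>_sq: "(\<eta> n)\<^sup>2 = mu (n + 1) powr (2 - 2 * \<sigma>) * (\<tau>' n)\<^sup>2"
      by (simp add: \<eta>_def power_mult_distrib power2_eq_square field_simps flip: powr_add)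
    have Lam_bounds: "lam j \<le> Lam n j" "Lam n j \<le> 2 * lam j"
      using t(1,2) L lj by (simp_all add: field_simps)
    have "Lam n j - lam j = (1 / lam j - 1 / Lam n j) * (lam j * Lam n j)"
      using L lj by (simp add: field_simps)
    also have "\<dots> \<le> (K * (\<eta> n)\<^sup>2) * (lam j * (2 * lam j))"
      using t L lj K(1) Lam_bounds by (intro mult_mono) auto
    also have "\<dots> = (2 * (lam j)\<^sup>2 * K * (\<tau>' n)\<^sup>2) * mu (n + 1) powr (2 - 2 * \<sigma>)"
      unfolding \<eta>_sq by (simp add: power2_eq_square)
    also have "\<dots> \<le> \<omega> n * mu (n + 1) powr (2 - 2 * \<sigma>)" by (intro mult_right_mono \<omega>_ge) simp
    finally have "\<bar>Lam n j - lam j\<bar> \<le> \<omega> n * mu (n + 1) powr (2 - 2 * \<sigma>)" using Lam_bounds by simp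
    moreover have "T p \<in> eigenspace A (complex_of_real (lam j))"
      using eigenspace_iff[of "lam j" "T p"] lj p(1) by (simp add: T.scale)
    moreover have "H_norm A 1 (T p) = 1" by (simp add: H_norm_T p(2) del: One_nat_def)
    moreover have "H_norm A 2 (T p - U n j) \<le> \<omega> n * mu (n + 1) powr (1 - \<sigma>)"
    proof -
      have "H_norm A 2 (T p - U n j) \<le> K * \<eta> n" using p(3) by (simp add: \<phi>(3)[OF jn] H_norm_T flip: T.diff)
      also have "\<dots> = K * \<tau>' n * mu (n + 1) powr (1 - \<sigma>)" by (simp add: \<eta>_def)
      also have "\<dots> \<le> \<omega> n * mu (n + 1) powr (1 - \<sigma>)" by (intro mult_right_mono \<omega>_ge) simp
      finally show ?thesis .
    qed
    moreover have "(H_norm A 1 (T p - U n j))\<^sup>2 \<le> \<omega> n * mu (n + 1) powr (1 - 2 * \<sigma>)"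
    proof -
      have "H_norm A 1 (T p - U n j) \<le> K * (\<kappa> n * \<eta> n)"
        unfolding \<phi>(3)[OF jn] T.diff[symmetric] H_norm_T by (rule p(4))
      then have "(H_norm A 1 (T p - U n j))\<^sup>2 \<le> (K * (\<kappa> n * \<eta> n))\<^sup>2"
        by (rule power_mono) (simp add: H_norm_def)
      also have "\<dots> = (K * C' * \<tau>' n)\<^sup>2 * (mu (n + 1) powr (- 1/2) * mu (n + 1) powr (1 - \<sigma>))\<^sup>2"
        by (simp add: \<eta>_def \<kappa>_def power_mult_distrib mult_ac)
      also have "\<dots> \<le> \<omega> n * mu (n + 1) powr (1 - 2 * \<sigma>)"
        unfolding mu_powr_sq by (intro mult_right_mono \<omega>_ge) simp
      finally show ?thesis .
    qed
    ultimately show ?case using \<omega>_ge(4) unfolding near_eigenvector_def by blast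
  qed
  with \<omega>_lim that show ?thesis by blast
qed

end

theorem theorem4p6:
  fixes A M :: "'h::complex_hilbert operator"
    and g :: "'h \<Rightarrow> 'h \<Rightarrow> complex"
    and lam mu :: "nat \<Rightarrow> real" and u q :: "nat \<Rightarrow> 'h"
    and Lam :: "nat \<Rightarrow> nat \<Rightarrow> real" and U :: "nat \<Rightarrow> nat \<Rightarrow> 'h"
    and N :: enat and l :: nat
  assumes separable: "\<exists>D :: 'h set. countable D \<and> closure D = UNIV"
    and A: "selfadjoint cinner A" "positive_definite cinner A"
    and A_eigen: "lower_eigenpairs A N lam u" and l: "enat l \<le> N"
    and G0: "equivalent_inner_product g"
    and M: "selfadjoint g M" "positive_definite g M" "compact_op (M\<inverse>)"
    and M_eigen: "discrete_eigenpairs g M mu q"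
    and Ritz: "\<And>n. harmonic_ritz_pairs A q n (Lam n) (U n)"
    and same_domain: "Domain (half_power A 3) = Domain (eigen_power g mu q (3/2))"
    and equiv_norms: "equivalent_norms_on (Domain (half_power A 3))
      (\<lambda>v. ip_norm g (op_app (eigen_power g mu q (3/2)) v)) (\<lambda>v. norm (op_app (half_power A 3) v))"
  shows "(\<forall>\<sigma>\<ge>1. \<forall>v\<in>Domain (eigen_power g mu q \<sigma>).
            (\<lambda>n. (H_norm A 1 (v - orth_proj (H_inner A 2) (cspan (q ` {1..n})) v))\<^sup>2)
              \<in> o(\<lambda>n. mu (n + 1) powr (1 - 2 * \<sigma>))) \<and>
         (\<forall>\<sigma>\<ge>1. (\<forall>j\<in>{1..l}. u j \<in> Domain (eigen_power g mu q \<sigma>)) \<longrightarrow>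
            (\<exists>w :: nat \<Rightarrow> nat \<Rightarrow> 'h.
               (\<forall>\<^sub>F n in sequentially. \<forall>j\<in>{1..l}.
                  w n j \<in> eigenspace A (complex_of_real (lam j)) \<and> H_norm A 1 (w n j) = 1) \<and>
               (\<forall>j\<in>{1..l}.
                  (\<lambda>n. Lam n j - lam j) \<in> o(\<lambda>n. mu (n + 1) powr (2 - 2 * \<sigma>)) \<and>
                  (\<lambda>n. H_norm A 2 (w n j - U n j)) \<in> o(\<lambda>n. mu (n + 1) powr (1 - \<sigma>)) \<and>
                  (\<lambda>n. (H_norm A 1 (w n j - U n j))\<^sup>2) \<in> o(\<lambda>n. mu (n + 1) powr (1 - 2 * \<sigma>)))))"
proof -
  interpret pd_op A by unfold_locales (rule A)+
  interpret pd_op_eigen A N lam u by unfold_locales (rule A_eigen)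
  interpret ip g by unfold_locales (use G0 in \<open>simp add: equivalent_inner_product_def\<close>)
  interpret comparison A g mu q
    by unfold_locales
      (use G0 M_eigen same_domain equiv_norms in
        \<open>simp_all add: equivalent_inner_product_def discrete_eigenpairs_def\<close>)
  interpret harmonic_ritz A N lam u g mu q Lam U
    by unfold_locales (rule Ritz)
  show ?thesis
  proof (intro conjI allI ballI impI, goal_cases)
    case (1 \<sigma> v)
    then show ?case by (rule projection_rate)
  next
    case (2 \<sigma>)
    note \<sigma> = 2(1) and u = 2(2)
    have "\<forall>j\<in>{1..l}. \<exists>\<omega>. \<omega> \<longlonglongrightarrow> 0 \<and> (\<forall>\<^sub>F n in sequentially. 0 \<le> \<omega> n \<and>
        \<bar>Lam n j - lam j\<bar> \<le> \<omega> n * mu (n + 1) powr (2 - 2 * \<sigma>) \<and> Ex (near_eigenvector \<sigma> (\<omega> n) n j))"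
    proof
      fix j assume j: "j \<in> {1..l}"
      have "enat j \<le> N" using j l order_trans[of "enat j" "enat l" N] by simp
      then have "j \<in> I" using j by simp
      moreover have "u i \<in> Domain (eigen_power g mu q \<sigma>)" if "1 \<le> i" "i \<le> j" for i
        using u that j by auto
      ultimately obtain \<omega> where "\<omega> \<longlonglongrightarrow> 0" "\<forall>\<^sub>F n in sequentially. 0 \<le> \<omega> n \<and>
        \<bar>Lam n j - lam j\<bar> \<le> \<omega> n * mu (n + 1) powr (2 - 2 * \<sigma>) \<and> Ex (near_eigenvector \<sigma> (\<omega> n) n j)"
        by (rule ritz_rate[OF \<sigma>])
      then show "\<exists>\<omega>. \<omega> \<longlonglongrightarrow> 0 \<and> (\<forall>\<^sub>F n in sequentially. 0 \<le> \<omega> n \<and>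
          \<bar>Lam n j - lam j\<bar> \<le> \<omega> n * mu (n + 1) powr (2 - 2 * \<sigma>) \<and> Ex (near_eigenvector \<sigma> (\<omega> n) n j))"
        by blast
    qed
    from bchoice[OF this] obtain \<omega> where \<omega>: "\<And>j. j \<in> {1..l} \<Longrightarrow> \<omega> j \<longlonglongrightarrow> 0"
      "\<And>j. j \<in> {1..l} \<Longrightarrow> \<forall>\<^sub>F n in sequentially. 0 \<le> \<omega> j n \<and>
        \<bar>Lam n j - lam j\<bar> \<le> \<omega> j n * mu (n + 1) powr (2 - 2 * \<sigma>) \<and> Ex (near_eigenvector \<sigma> (\<omega> j n) n j)"
      by blast
    \<comment> \<open>Where no such vector exists the choice is arbitrary; this affects only
      finitely many n for each j.\<close>
    define w where "w n j = (SOME w. near_eigenvector \<sigma> (\<omega> j n) n j w)" for n j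
    have w: "\<forall>\<^sub>F n in sequentially. near_eigenvector \<sigma> (\<omega> j n) n j (w n j)" if "j \<in> {1..l}" for j
      using \<omega>(2)[OF that]
    proof eventually_elim
      case (elim n)
      then have "Ex (near_eigenvector \<sigma> (\<omega> j n) n j)" by blast
      then show ?case unfolding w_def by (rule someI_ex)
    qed
    show ?case
    proof (intro exI[of _ w] conjI ballI eventually_ball_finite)
      fix j assume j: "j \<in> {1..l}"
      show "\<forall>\<^sub>F n in sequentially. w n j \<in> eigenspace A (complex_of_real (lam j)) \<and> H_norm A 1 (w n j) = 1"
        using w[OF j] by eventually_elim (simp add: near_eigenvector_def)
      show "(\<lambda>n. Lam n j - lam j) \<in> o(\<lambda>n. mu (n + 1) powr (2 - 2 * \<sigma>))"
        by (rule smalloI_bound[OF _ \<omega>(1)[OF j]]) (use \<omega>(2)[OF j] in \<open>auto elim: eventually_mono\<close>)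
      show "(\<lambda>n. H_norm A 2 (w n j - U n j)) \<in> o(\<lambda>n. mu (n + 1) powr (1 - \<sigma>))"
        by (rule smalloI_bound[OF _ \<omega>(1)[OF j]])
          (use w[OF j] in \<open>auto simp: near_eigenvector_def H_norm_def elim: eventually_mono\<close>)
      show "(\<lambda>n. (H_norm A 1 (w n j - U n j))\<^sup>2) \<in> o(\<lambda>n. mu (n + 1) powr (1 - 2 * \<sigma>))"
        by (rule smalloI_bound[OF _ \<omega>(1)[OF j]])
          (use w[OF j] in \<open>auto simp: near_eigenvector_def elim: eventually_mono\<close>)
    qed simp
  qed
qed

end
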